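(* Let $u \in \mathrm{Sp}(V)$ be unipotent, with orthogonal decomposition $V \downarrow K[u] = \sum_{1 \leq i \leq t} W(m_i) \perp \sum_{1 \leq j \leq s} V(2k_j)$. Denote by $\alpha \geq 0$ the largest integer such that $2^{\alpha} \mid m_i, k_j$ for all $i$ and $j$. Then the following hold: (i) Suppose that $s = 0$. Then $$\dim \mathfrak{g}_{ad}^u = \begin{cases} \dim \mathfrak{g}_{sc}^u,& \text{ if } \alpha = 0. \\ \dim \mathfrak{g}_{sc}^u+1,& \text{ if } \alpha > 0.\end{cases}$$ (ii) Suppose that $s > 0$. Then $$\dim \mathfrak{g}_{ad}^u = \begin{cases} \dim \mathfrak{g}_{sc}^u-1,& \text{ if } \alpha = 0 \text{ and } \nu_2(k_j) > 0 \text{ for some } j. \\ \dim \mathfrak{g}_{sc}^u-1,& \text{ if } \alpha = 0 \text{ and } \nu_2(m_i) = 0 \text{ for some } i. \\ \dim \mathfrak{g}_{sc}^u,& \text{ if } \alpha = 0 \text{ and } \nu_2(k_j) = 0,\ \nu_2(m_i) > 0 \text{ for all } i \text{ and } j. \\ \dim \mathfrak{g}_{sc}^u,& \text{ if } \alpha > 0.\end{cases}$$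
   Context: $K$ is an algebraically closed field of characteristic two. $V$ is a $K$-vector space of dimension $2\ell$ with a non-degenerate alternating bilinear form $b$; $G_{sc} = \mathrm{Sp}(V)$ (simply connected of type $C_\ell$) and $\mathfrak{g}_{sc} = \mathfrak{sp}(V)$, with $G_{sc}$ acting by conjugation. $\nu_2(a)$ is the largest $k \ge 0$ with $2^k \mid a$. For a module $M$ on which $u$ acts, $M^u=\{x\in M: ux=x\}$. The module $\mathfrak{g}_{ad}$: this is the Lie algebra of the simple algebraic group $G_{ad}$ of adjoint type $C_\ell$; $G_{sc}$ acts on it via the isogeny $G_{sc} \to G_{ad}$ sending each root element $x_\gamma(t)$ to the corresponding $x_\gamma(t)$, followed by the adjoint representation of $G_{ad}$. Explicitly: let $V_{\mathbb{C}}$ have basis $v_1,\dots,v_n$, $n=2\ell$, with alternating form $(v_i,v_{n-i+1})=1=-(v_{n-i+1},v_i)$ for $1\le i\le \ell$ and $(v_i,v_j)=0$ for $i+j\ne n+1$. Let $\{X_\gamma\}\cup\{H_{\alpha_i}\}$ be the standard Chevalley basis of $\mathfrak{sp}(V_{\mathbb{C}})$ (with diagonal Cartan subalgebra), $\mathfrak{g}_{\mathbb{Z}}$ its $\mathbb{Z}$-span, and $\mathfrak{g}^{ad}_{\mathbb{Z}}$ the $\mathbb{Z}$-span of $\mathfrak{g}_{\mathbb{Z}}$ and $H = \mathrm{diag}(1/2,\dots,1/2,-1/2,\dots,-1/2)$. Then $\mathfrak{g}_{sc} = K\otimes_{\mathbb{Z}}\mathfrak{g}_{\mathbb{Z}}$,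 $\mathfrak{g}_{ad} = K\otimes_{\mathbb{Z}}\mathfrak{g}^{ad}_{\mathbb{Z}}$, and the root element $x_\gamma(t)$ of $G_{sc}$ acts on $\mathfrak{g}_{ad}$ as $\sum_{k\ge0} t^k\,(\mathrm{ad}(X_\gamma)^k/k!)$ reduced modulo 2. $K[u]$ is the group algebra of $\langle u\rangle$. Every unipotent $u\in \mathrm{Sp}(V)$ admits a decomposition of $V$ as an orthogonal direct sum of $u$-invariant subspaces, each isomorphic (by a $u$-equivariant isometry) to one of the following bilinear modules; $V \downarrow K[u] = \sum W(m_i)\perp\sum V(2k_j)$ denotes such a decomposition (possibly with $t=0$ or $s=0$), with $m_i, k_j \geq 1$. In both definitions the space has basis $v_1,\dots,v_n$, $n=2m$, with $b(v_i,v_j)=1$ if $i+j=n+1$ and $0$ otherwise. - $V(2m)$, $m \ge 1$: $uv_1=v_1$; $uv_i=v_i+v_{i-1}+\cdots+v_1$ for $1<i\le m+1$; $uv_i=v_i+v_{i-1}$ for $m+1<i\le n$. - $W(m)$, $m\ge1$: $uv_1=v_1$; $uv_i=v_i+v_{i-1}+\cdots+v_1$ for $1<i\le m$; $uv_{m+1}=v_{m+1}$; $uv_i=v_i+v_{i-1}$ for $m+1<i\le n$. *)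

theory Defs
  imports
    "HOL-Library.Function_Algebras"
    "HOL-Computational_Algebra.Computational_Algebra"
    "Jordan_Normal_Form.Matrix"
begin

text \<open>
  A vector space \<open>V\<close> over \<open>K\<close> is a whole type \<open>'v\<close> with a scalar multiplication \<open>scale\<close>
  satisfying \<^locale>\<open>vector_space\<close>. Bases \<open>v\<^sub>1, \<dots>, v\<^sub>n\<close> and matrix units \<open>E\<^sub>i\<^sub>j\<close> are numbered from 1;
  the matrices of \<^theory>\<open>Jordan_Normal_Form.Matrix\<close> themselves have indices starting from 0.
\<close>

section \<open>Symplectic groups and their unipotent elements\<close>

definition nondeg_alternating ::
  "('k::field \<Rightarrow> 'v::ab_group_add \<Rightarrow> 'v) \<Rightarrow> ('v \<Rightarrow> 'v \<Rightarrow> 'k) \<Rightarrow> bool" where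
  "nondeg_alternating scale b \<longleftrightarrow>
     (\<forall>x. Vector_Spaces.linear scale (*) (\<lambda>y. b x y)) \<and>
     (\<forall>y. Vector_Spaces.linear scale (*) (\<lambda>x. b x y)) \<and>
     (\<forall>x. b x x = 0) \<and>
     (\<forall>x. (\<forall>y. b x y = 0) \<longrightarrow> x = 0)"

definition Sp ::
  "('k::field \<Rightarrow> 'v::ab_group_add \<Rightarrow> 'v) \<Rightarrow> ('v \<Rightarrow> 'v \<Rightarrow> 'k) \<Rightarrow> ('v \<Rightarrow> 'v) set" where
  "Sp scale b = {g. Vector_Spaces.linear scale scale g \<and> bij g \<and> (\<forall>x y. b (g x) (g y) = b x y)}"

definition unipotent :: "('v::ab_group_add \<Rightarrow> 'v) \<Rightarrow> bool" where
  "unipotent u \<longleftrightarrow> (\<exists>N. ((\<lambda>x. u x - x) ^^ N) = (\<lambda>_. 0))"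

definition is_basis_of ::
  "('k::field \<Rightarrow> 'v::ab_group_add \<Rightarrow> 'v) \<Rightarrow> nat \<Rightarrow> (nat \<Rightarrow> 'v) \<Rightarrow> 'v set \<Rightarrow> bool" where
  "is_basis_of scale n e U \<longleftrightarrow>
     inj_on e {1..n} \<and> \<not> module.dependent scale (e ` {1..n}) \<and> module.span scale (e ` {1..n}) = U"

definition symplectic_basis ::
  "('k::field \<Rightarrow> 'v::ab_group_add \<Rightarrow> 'v) \<Rightarrow> ('v \<Rightarrow> 'v \<Rightarrow> 'k) \<Rightarrow> nat \<Rightarrow> (nat \<Rightarrow> 'v) \<Rightarrow> bool" where
  "symplectic_basis scale b l v \<longleftrightarrow>
     is_basis_of scale (2 * l) v UNIV \<and>
     (\<forall>i\<in>{1..2*l}. \<forall>j\<in>{1..2*l}.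
        b (v i) (v j) = (if i + j = 2 * l + 1 then (if i \<le> l then 1 else - 1) else 0))"

section \<open>The bilinear modules \<open>V(2m)\<close> and \<open>W(m)\<close>, and orthogonal decompositions\<close>

definition antidiag_gram ::
  "('v \<Rightarrow> 'v \<Rightarrow> 'k::field) \<Rightarrow> nat \<Rightarrow> (nat \<Rightarrow> 'v) \<Rightarrow> bool" where
  "antidiag_gram b n e \<longleftrightarrow>
     (\<forall>i\<in>{1..n}. \<forall>j\<in>{1..n}. b (e i) (e j) = (if i + j = n + 1 then 1 else 0))"

text \<open>A subspace \<open>U\<close> is \<open>u\<close>-equivariantly isometric to \<open>V(2m)\<close> (resp. \<open>W(m)\<close>) iff it has a basis
  with the Gram matrix and the \<open>u\<close>-action of the defining basis of \<open>V(2m)\<close> (resp. \<open>W(m)\<close>).\<close>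

definition iso_V ::
  "('k::field \<Rightarrow> 'v::ab_group_add \<Rightarrow> 'v) \<Rightarrow> ('v \<Rightarrow> 'v \<Rightarrow> 'k) \<Rightarrow> ('v \<Rightarrow> 'v) \<Rightarrow> nat \<Rightarrow> 'v set \<Rightarrow> bool" where
  "iso_V scale b u m U \<longleftrightarrow>
     (\<exists>e. is_basis_of scale (2 * m) e U \<and> antidiag_gram b (2 * m) e \<and>
          u (e 1) = e 1 \<and>
          (\<forall>i. 1 < i \<and> i \<le> m + 1 \<longrightarrow> u (e i) = (\<Sum>j=1..i. e j)) \<and>
          (\<forall>i. m + 1 < i \<and> i \<le> 2 * m \<longrightarrow> u (e i) = e i + e (i - 1)))"

definition iso_W ::
  "('k::field \<Rightarrow> 'v::ab_group_add \<Rightarrow> 'v) \<Rightarrow> ('v \<Rightarrow> 'v \<Rightarrow> 'k) \<Rightarrow> ('v \<Rightarrow> 'v) \<Rightarrow> nat \<Rightarrow> 'v set \<Rightarrow> bool" where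
  "iso_W scale b u m U \<longleftrightarrow>
     (\<exists>e. is_basis_of scale (2 * m) e U \<and> antidiag_gram b (2 * m) e \<and>
          u (e 1) = e 1 \<and>
          (\<forall>i. 1 < i \<and> i \<le> m \<longrightarrow> u (e i) = (\<Sum>j=1..i. e j)) \<and>
          u (e (m + 1)) = e (m + 1) \<and>
          (\<forall>i. m + 1 < i \<and> i \<le> 2 * m \<longrightarrow> u (e i) = e i + e (i - 1)))"

definition orthogonal_direct_sum ::
  "('k::field \<Rightarrow> 'v::ab_group_add \<Rightarrow> 'v) \<Rightarrow> ('v \<Rightarrow> 'v \<Rightarrow> 'k) \<Rightarrow> 'i set \<Rightarrow> ('i \<Rightarrow> 'v set) \<Rightarrow> bool" where
  "orthogonal_direct_sum scale b I U \<longleftrightarrow>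
     (\<forall>i\<in>I. module.subspace scale (U i)) \<and>
     (\<forall>x. \<exists>!w. (\<forall>i\<in>I. w i \<in> U i) \<and> (\<forall>i. i \<notin> I \<longrightarrow> w i = 0) \<and> x = (\<Sum>i\<in>I. w i)) \<and>
     (\<forall>i\<in>I. \<forall>j\<in>I. i \<noteq> j \<longrightarrow> (\<forall>x\<in>U i. \<forall>y\<in>U j. b x y = 0))"

text \<open>\<open>V \<down> K[u] = \<Sum>\<^sub>1\<^sub>\<le>\<^sub>i\<^sub>\<le>\<^sub>t W(m\<^sub>i) \<perp> \<Sum>\<^sub>1\<^sub>\<le>\<^sub>j\<^sub>\<le>\<^sub>s V(2k\<^sub>j)\<close>; the summands are indexed by \<open>Inl i\<close> and \<open>Inr j\<close>.\<close>

definition decomposition ::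
  "('k::field \<Rightarrow> 'v::ab_group_add \<Rightarrow> 'v) \<Rightarrow> ('v \<Rightarrow> 'v \<Rightarrow> 'k) \<Rightarrow> ('v \<Rightarrow> 'v) \<Rightarrow>
   nat \<Rightarrow> (nat \<Rightarrow> nat) \<Rightarrow> nat \<Rightarrow> (nat \<Rightarrow> nat) \<Rightarrow> bool" where
  "decomposition scale b u t m s k \<longleftrightarrow>
     (\<forall>i\<in>{1..t}. 1 \<le> m i) \<and> (\<forall>j\<in>{1..s}. 1 \<le> k j) \<and>
     (\<exists>U :: nat + nat \<Rightarrow> 'v set.
        orthogonal_direct_sum scale b ({1..t} <+> {1..s}) U \<and>
        (\<forall>a\<in>{1..t} <+> {1..s}. u ` U a \<subseteq> U a) \<and>
        (\<forall>i\<in>{1..t}. iso_W scale b u (m i) (U (Inl i))) \<and>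
        (\<forall>j\<in>{1..s}. iso_V scale b u (k j) (U (Inr j))))"

section \<open>The simply connected Lie algebra\<close>

definition sp_algebra ::
  "('k::field \<Rightarrow> 'v::ab_group_add \<Rightarrow> 'v) \<Rightarrow> ('v \<Rightarrow> 'v \<Rightarrow> 'k) \<Rightarrow> ('v \<Rightarrow> 'v) set" where
  "sp_algebra scale b =
     {X. Vector_Spaces.linear scale scale X \<and> (\<forall>x y. b (X x) y + b x (X y) = 0)}"

definition g_sc_fixed ::
  "('k::field \<Rightarrow> 'v::ab_group_add \<Rightarrow> 'v) \<Rightarrow> ('v \<Rightarrow> 'v \<Rightarrow> 'k) \<Rightarrow> ('v \<Rightarrow> 'v) \<Rightarrow> ('v \<Rightarrow> 'v) set" where
  "g_sc_fixed scale b u = {X \<in> sp_algebra scale b. u \<circ> X \<circ> inv_into UNIV u = X}"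

definition dim_g_sc_fixed ::
  "('k::field \<Rightarrow> 'v::ab_group_add \<Rightarrow> 'v) \<Rightarrow> ('v \<Rightarrow> 'v \<Rightarrow> 'k) \<Rightarrow> ('v \<Rightarrow> 'v) \<Rightarrow> nat" where
  "dim_g_sc_fixed scale b u =
     vector_space.dim (\<lambda>c (X :: 'v \<Rightarrow> 'v) x. scale c (X x)) (g_sc_fixed scale b u)"

section \<open>The Chevalley basis in type \<open>C\<^sub>l\<close> and the adjoint lattice\<close>

text \<open>\<open>Diff i j\<close>, \<open>Plus i j\<close>, \<open>Minus i j\<close>, \<open>LPlus i\<close>, \<open>LMinus i\<close> stand for the roots
  \<open>\<epsilon>\<^sub>i - \<epsilon>\<^sub>j\<close>, \<open>\<epsilon>\<^sub>i + \<epsilon>\<^sub>j\<close>, \<open>-(\<epsilon>\<^sub>i + \<epsilon>\<^sub>j)\<close>, \<open>2\<epsilon>\<^sub>i\<close>, \<open>-2\<epsilon>\<^sub>i\<close>.\<close>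

datatype root = Diff nat nat | Plus nat nat | Minus nat nat | LPlus nat | LMinus nat

definition roots :: "nat \<Rightarrow> root set" where
  "roots l = {Diff i j | i j. i \<in> {1..l} \<and> j \<in> {1..l} \<and> i \<noteq> j}
     \<union> {Plus i j | i j. 1 \<le> i \<and> i < j \<and> j \<le> l} \<union> {Minus i j | i j. 1 \<le> i \<and> i < j \<and> j \<le> l}
     \<union> LPlus ` {1..l} \<union> LMinus ` {1..l}"

definition E :: "nat \<Rightarrow> nat \<Rightarrow> nat \<Rightarrow> 'a::comm_ring_1 mat" where
  "E n p q = mat n n (\<lambda>(i, j). if i + 1 = p \<and> j + 1 = q then 1 else 0)"

fun chev_X :: "nat \<Rightarrow> root \<Rightarrow> 'a::comm_ring_1 mat" where
  "chev_X l (Diff i j) = (let n = 2 * l in E n i j - E n (n - j + 1) (n - i + 1))"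
| "chev_X l (Plus i j) = (let n = 2 * l in E n j (n - i + 1) + E n i (n - j + 1))"
| "chev_X l (Minus i j) = (let n = 2 * l in E n (n - i + 1) j + E n (n - j + 1) i)"
| "chev_X l (LPlus i) = (let n = 2 * l in E n i (n - i + 1))"
| "chev_X l (LMinus i) = (let n = 2 * l in E n (n - i + 1) i)"

text \<open>\<open>chev_h l i\<close> is \<open>E\<^sub>i\<^sub>i - E\<^sub>i\<^sub>'\<^sub>i\<^sub>'\<close> with \<open>i' = 2l - i + 1\<close>, the coroot of \<open>2\<epsilon>\<^sub>i\<close>; \<open>chev_H l i\<close> is the
  coroot of the simple root \<open>\<alpha>\<^sub>i\<close>, where \<open>\<alpha>\<^sub>i = \<epsilon>\<^sub>i - \<epsilon>\<^sub>i\<^sub>+\<^sub>1\<close> for \<open>i < l\<close> and \<open>\<alpha>\<^sub>l = 2\<epsilon>\<^sub>l\<close>.\<close>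

definition chev_h :: "nat \<Rightarrow> nat \<Rightarrow> 'a::comm_ring_1 mat" where
  "chev_h l i = E (2 * l) i i - E (2 * l) (2 * l - i + 1) (2 * l - i + 1)"

definition chev_H :: "nat \<Rightarrow> nat \<Rightarrow> 'a::comm_ring_1 mat" where
  "chev_H l i = (if i < l then chev_h l i - chev_h l (i + 1) else chev_h l l)"

definition half_H :: "nat \<Rightarrow> rat mat" where
  "half_H l = mat (2 * l) (2 * l) (\<lambda>(i, j). if i = j then (if i < l then 1/2 else - 1/2) else 0)"

inductive_set z_span :: "nat \<Rightarrow> rat mat set \<Rightarrow> rat mat set" for n S where
  zero: "0\<^sub>m n n \<in> z_span n S"
| add: "A \<in> z_span n S \<Longrightarrow> X \<in> S \<Longrightarrow> A + X \<in> z_span n S"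
| sub: "A \<in> z_span n S \<Longrightarrow> X \<in> S \<Longrightarrow> A - X \<in> z_span n S"

definition g_Z :: "nat \<Rightarrow> rat mat set" where
  "g_Z l = z_span (2 * l) (chev_X l ` roots l \<union> chev_H l ` {1..l})"

definition g_ad_Z :: "nat \<Rightarrow> rat mat set" where
  "g_ad_Z l = z_span (2 * l) (g_Z l \<union> {half_H l})"

text \<open>
  The matrices \<open>ad_basis l p\<close> with \<open>p \<in> ad_index l\<close> form a \<open>\<int>\<close>-basis of \<open>g_ad_Z l\<close>
  (\<open>ad_basis_in\<close> and \<open>ad_basis_unique_coords\<close> below). Since \<open>2 H = \<Sum>\<^sub>i chev_h l i\<close>, the
  element \<open>chev_h l 1\<close> has to be left out.
\<close>

datatype ad_ix = Rt root | Cr nat | Half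

definition ad_index :: "nat \<Rightarrow> ad_ix set" where
  "ad_index l = Rt ` roots l \<union> Cr ` {2..l} \<union> {Half}"

fun ad_basis :: "nat \<Rightarrow> ad_ix \<Rightarrow> rat mat" where
  "ad_basis l (Rt \<gamma>) = chev_X l \<gamma>"
| "ad_basis l (Cr i) = chev_h l i"
| "ad_basis l Half = half_H l"

definition z_comb :: "nat \<Rightarrow> (ad_ix \<Rightarrow> int) \<Rightarrow> rat mat" where
  "z_comb l c =
     mat (2 * l) (2 * l) (\<lambda>(i, j). \<Sum>p\<in>ad_index l. of_int (c p) * ad_basis l p $$ (i, j))"

definition ad_coords :: "nat \<Rightarrow> rat mat \<Rightarrow> ad_ix \<Rightarrow> int" where
  "ad_coords l A = (THE c. (\<forall>p. p \<notin> ad_index l \<longrightarrow> c p = 0) \<and> A = z_comb l c)"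

section \<open>The adjoint Lie algebra as a module for the symplectic group\<close>

text \<open>
  \<open>K \<otimes> g_ad_Z l\<close> is the space of coordinate vectors with respect to the \<open>\<int>\<close>-basis \<open>ad_basis l\<close>;
  an endomorphism of \<open>g_ad_Z l\<close> acts on it by its integral matrix, mapped to \<open>K\<close>.
\<close>

definition g_ad :: "nat \<Rightarrow> (ad_ix \<Rightarrow> 'k::field) set" where
  "g_ad l = {y. \<forall>p. p \<notin> ad_index l \<longrightarrow> y p = 0}"

definition ad :: "'a::comm_ring_1 mat \<Rightarrow> 'a mat \<Rightarrow> 'a mat" where
  "ad X A = X * A - A * X"

text \<open>\<open>\<Sum>\<^sub>k t\<^sup>k ad(X\<^sub>\<gamma>)\<^sup>k / k!\<close>, where the terms with \<open>k > 2\<close> vanish (\<open>ad_chev_X_cube\<close> below).\<close>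

definition root_act_ad :: "nat \<Rightarrow> root \<Rightarrow> 'k::field \<Rightarrow> (ad_ix \<Rightarrow> 'k) \<Rightarrow> (ad_ix \<Rightarrow> 'k)" where
  "root_act_ad l \<gamma> t y = (\<lambda>p. \<Sum>q\<in>ad_index l. (\<Sum>k\<le>2. t ^ k *
     of_int (ad_coords l (inverse (fact k) \<cdot>\<^sub>m (ad (chev_X l \<gamma>) ^^ k) (ad_basis l q)) p)) * y q)"

text \<open>The root element \<open>x\<^sub>\<gamma>(t) = \<Sum>\<^sub>k t\<^sup>k X\<^sub>\<gamma>\<^sup>k / k!\<close> of \<open>Sp(V)\<close> is \<open>1 + t X\<^sub>\<gamma>\<close>, since \<open>X\<^sub>\<gamma>\<^sup>2 = 0\<close>
  (\<open>chev_X_square\<close> below). Here \<open>X\<^sub>\<gamma>\<close> acts on \<open>V\<close> through the symplectic basis \<open>v\<close>.\<close>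

definition mat_act ::
  "('k::field \<Rightarrow> 'v::ab_group_add \<Rightarrow> 'v) \<Rightarrow> nat \<Rightarrow> (nat \<Rightarrow> 'v) \<Rightarrow> 'k mat \<Rightarrow> 'v \<Rightarrow> 'v" where
  "mat_act scale n v A x =
     (\<Sum>i=1..n. \<Sum>j=1..n.
        scale (A $$ (i - 1, j - 1) * module.representation scale (v ` {1..n}) x (v j)) (v i))"

definition root_elt ::
  "('k::field \<Rightarrow> 'v::ab_group_add \<Rightarrow> 'v) \<Rightarrow> nat \<Rightarrow> (nat \<Rightarrow> 'v) \<Rightarrow> root \<Rightarrow> 'k \<Rightarrow> 'v \<Rightarrow> 'v" where
  "root_elt scale l v \<gamma> t = (\<lambda>x. x + scale t (mat_act scale (2 * l) v (chev_X l \<gamma>) x))"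

text \<open>
  \<open>Sp(V)\<close> is generated by its root elements, so its action on \<open>g_ad\<close> is determined by the action
  of these: \<open>ad_graph scale l v g x y\<close> says that \<open>g \<cdot> x = y\<close>.
\<close>

inductive ad_graph ::
  "('k::field \<Rightarrow> 'v::ab_group_add \<Rightarrow> 'v) \<Rightarrow> nat \<Rightarrow> (nat \<Rightarrow> 'v) \<Rightarrow>
   ('v \<Rightarrow> 'v) \<Rightarrow> (ad_ix \<Rightarrow> 'k) \<Rightarrow> (ad_ix \<Rightarrow> 'k) \<Rightarrow> bool"
  for scale l v where
  one: "x \<in> g_ad l \<Longrightarrow> ad_graph scale l v id x x"
| mult: "ad_graph scale l v g x y \<Longrightarrow> \<gamma> \<in> roots l \<Longrightarrow>
    ad_graph scale l v (root_elt scale l v \<gamma> t \<circ> g) x (root_act_ad l \<gamma> t y)"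

definition act_ad ::
  "('k::field \<Rightarrow> 'v::ab_group_add \<Rightarrow> 'v) \<Rightarrow> nat \<Rightarrow> (nat \<Rightarrow> 'v) \<Rightarrow>
   ('v \<Rightarrow> 'v) \<Rightarrow> (ad_ix \<Rightarrow> 'k) \<Rightarrow> (ad_ix \<Rightarrow> 'k)" where
  "act_ad scale l v g x = (THE y. ad_graph scale l v g x y)"

definition g_ad_fixed ::
  "('k::field \<Rightarrow> 'v::ab_group_add \<Rightarrow> 'v) \<Rightarrow> nat \<Rightarrow> (nat \<Rightarrow> 'v) \<Rightarrow> ('v \<Rightarrow> 'v) \<Rightarrow> (ad_ix \<Rightarrow> 'k) set" where
  "g_ad_fixed scale l v u = {x \<in> g_ad l. act_ad scale l v u x = x}"

definition dim_g_ad_fixed ::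
  "('k::field \<Rightarrow> 'v::ab_group_add \<Rightarrow> 'v) \<Rightarrow> nat \<Rightarrow> (nat \<Rightarrow> 'v) \<Rightarrow> ('v \<Rightarrow> 'v) \<Rightarrow> nat" where
  "dim_g_ad_fixed scale l v u =
     vector_space.dim (\<lambda>c (x :: ad_ix \<Rightarrow> 'k) p. c * x p) (g_ad_fixed scale l v u)"


section \<open>Nilpotency of the root vectors and the \<open>\<int>\<close>-basis of the adjoint lattice\<close>

lemma E_carrier [simp]: "E n p q \<in> carrier_mat n n" "dim_row (E n p q) = n" "dim_col (E n p q) = n"
  by (simp_all add: E_def)

lemma E_mult:
  assumes "1 \<le> q" "q \<le> n"
  shows "E n p q * E n r s = (if q = r then E n p s else 0\<^sub>m n n)"
proof (rule eq_matI)
  fix i j assume "i < dim_row (if q = r then E n p s else 0\<^sub>m n n :: 'a mat)"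
    "j < dim_col (if q = r then E n p s else 0\<^sub>m n n :: 'a mat)"
  then have ij: "i < n" "j < n" by (auto split: if_splits)
  have "(E n p q * E n r s :: 'a mat) $$ (i, j)
      = (\<Sum>k\<in>{0..<n}. (if i + 1 = p \<and> k + 1 = q then 1 else 0) * (if k + 1 = r \<and> j + 1 = s then 1 else 0))"
    using ij by (simp add: scalar_prod_def E_def)
  also have "\<dots> = (\<Sum>k\<in>{0..<n}. if k = q - 1 then (if i + 1 = p \<and> q = r \<and> j + 1 = s then 1 else 0) else 0)"
    using assms by (intro sum.cong) auto
  also have "\<dots> = (if i + 1 = p \<and> q = r \<and> j + 1 = s then 1 else 0)"
    using assms by (subst sum.delta) auto
  finally show "(E n p q * E n r s :: 'a mat) $$ (i, j) = (if q = r then E n p s else 0\<^sub>m n n) $$ (i, j)"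
    using ij by (auto simp: E_def)
qed auto

lemma chev_X_carrier [simp]: "chev_X l \<gamma> \<in> carrier_mat (2 * l) (2 * l)"
  by (cases \<gamma>) (simp_all add: Let_def minus_carrier_mat)

lemma diff_square_zero:
  assumes "A \<in> carrier_mat n n" "B \<in> carrier_mat n n"
    and "A * A = 0\<^sub>m n n" "A * B = 0\<^sub>m n n" "B * A = 0\<^sub>m n n" "B * B = 0\<^sub>m n n"
  shows "(A - B) * (A - B) = (0\<^sub>m n n :: 'a::comm_ring_1 mat)"
proof -
  have "(A - B) * (A - B) = (A * A - B * A) - (A * B - B * B)"
    using assms(1,2) by (simp add: minus_mult_distrib_mat[of _ n n] mult_minus_distrib_mat[of _ n n]
        minus_carrier_mat)
  then show ?thesis using assms(3-) by (simp add: minus_r_inv_mat[of _ n n])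
qed

lemma sum_square_zero:
  assumes "A \<in> carrier_mat n n" "B \<in> carrier_mat n n"
    and "A * A = 0\<^sub>m n n" "A * B = 0\<^sub>m n n" "B * A = 0\<^sub>m n n" "B * B = 0\<^sub>m n n"
  shows "(A + B) * (A + B) = (0\<^sub>m n n :: 'a::comm_ring_1 mat)"
proof -
  have "(A + B) * (A + B) = (A * A + B * A) + (A * B + B * B)"
    using assms(1,2) by (simp add: add_mult_distrib_mat[of _ n n] mult_add_distrib_mat[of _ n n])
  then show ?thesis using assms(3-) by simp
qed

lemma opp_ix:
  assumes "Suc 0 \<le> i" "i \<le> l" "j \<le> l"
  shows "Suc (2 * l - i) \<noteq> j" "j \<noteq> Suc (2 * l - i)" "Suc (2 * l - i) \<le> 2 * l"
  using assms by linarith+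

lemma opp_inj:
  assumes "i \<le> l" "j \<le> (l::nat)"
  shows "2 * l - i = 2 * l - j \<longleftrightarrow> i = j"
  using assms by linarith

lemma chev_X_square:
  assumes "\<gamma> \<in> roots l"
  shows "chev_X l \<gamma> * chev_X l \<gamma> = 0\<^sub>m (2 * l) (2 * l)"
  using assms
  by (cases \<gamma>) (auto simp: roots_def Let_def E_mult opp_ix opp_inj
      intro!: diff_square_zero[OF E_carrier(1) E_carrier(1)] sum_square_zero[OF E_carrier(1) E_carrier(1)])

lemma ad_carrier [simp]:
  "X \<in> carrier_mat n n \<Longrightarrow> A \<in> carrier_mat n n \<Longrightarrow> ad X A \<in> carrier_mat n n"
  unfolding ad_def by (intro minus_carrier_mat mult_carrier_mat)

lemma ad_cube_zero:
  assumes X: "X \<in> carrier_mat n n" and A: "A \<in> carrier_mat n n" and XX: "X * X = 0\<^sub>m n n"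
  shows "ad X (ad X (ad X A)) = 0\<^sub>m n n"
proof -
  define P where "P = X * A * X"
  have P: "P \<in> carrier_mat n n" using X A by (auto simp: P_def)
  have c: "X * A \<in> carrier_mat n n" "A * X \<in> carrier_mat n n" using X A by auto
  have XXA: "X * (X * A) = 0\<^sub>m n n"
    using assoc_mult_mat[OF X X A] XX A by simp
  have AXX: "A * X * X = 0\<^sub>m n n"
    using assoc_mult_mat[OF A X X] XX A by simp
  have XAX: "X * (A * X) = P"
    using assoc_mult_mat[OF X A X] by (simp add: P_def)
  have XP: "X * P = 0\<^sub>m n n"
    using assoc_mult_mat[OF X c(1) X] XXA X by (simp add: P_def)
  have PX: "P * X = 0\<^sub>m n n"
    using assoc_mult_mat[OF c(1) X X] XX by (simp add: P_def right_mult_zero_mat[OF c(1)])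
  have 2: "ad X (ad X A) = (0\<^sub>m n n - P) - (P - 0\<^sub>m n n)"
    unfolding ad_def
    using mult_minus_distrib_mat[OF X c] minus_mult_distrib_mat[OF c X] XXA AXX XAX
    by (simp add: P_def)
  have d: "0\<^sub>m n n - P \<in> carrier_mat n n" "P - 0\<^sub>m n n \<in> carrier_mat n n" 
    "0\<^sub>m n n \<in> carrier_mat n n" using P by auto
  show ?thesis
    unfolding 2 unfolding ad_def
    using mult_minus_distrib_mat[OF X d(1,2)] minus_mult_distrib_mat[OF d(1,2) X]
      mult_minus_distrib_mat[OF X d(3) P] minus_mult_distrib_mat[OF d(3) P X]
      mult_minus_distrib_mat[OF X P d(3)] minus_mult_distrib_mat[OF P d(3) X] XP PX X
    by (simp add: minus_r_inv_mat[of _ n n])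
qed

lemma ad_chev_X_cube:
  assumes "\<gamma> \<in> roots l" "A \<in> carrier_mat (2 * l) (2 * l)" "k > 2"
  shows "(ad (chev_X l \<gamma>) ^^ k) A = 0\<^sub>m (2 * l) (2 * l)"
proof -
  let ?f = "ad (chev_X l \<gamma>)"
  have f0: "?f (0\<^sub>m (2 * l) (2 * l)) = 0\<^sub>m (2 * l) (2 * l)"
    by (simp add: ad_def right_mult_zero_mat[OF chev_X_carrier] left_mult_zero_mat[OF chev_X_carrier])
  have f3: "?f (?f (?f B)) = 0\<^sub>m (2 * l) (2 * l)" if "B \<in> carrier_mat (2 * l) (2 * l)" for B
    using ad_cube_zero[OF chev_X_carrier that chev_X_square[OF assms(1)]] .
  have pz: "(?f ^^ m) (0\<^sub>m (2 * l) (2 * l)) = 0\<^sub>m (2 * l) (2 * l)" for m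
    by (induction m) (simp_all add: f0)
  obtain m where m: "k = m + 3"
  proof
    show "k = (k - 3) + 3" using assms(3) by simp
  qed
  show ?thesis unfolding m funpow_add using f3[OF assms(2)] pz by (simp add: numeral_3_eq_3)
qed

lemma finite_roots [simp]: "finite (roots l)"
proof -
  have "roots l \<subseteq> (\<lambda>(i, j). Diff i j) ` ({1..l} \<times> {1..l}) \<union> (\<lambda>(i, j). Plus i j) ` ({1..l} \<times> {1..l})
      \<union> (\<lambda>(i, j). Minus i j) ` ({1..l} \<times> {1..l}) \<union> LPlus ` {1..l} \<union> LMinus ` {1..l}"
    unfolding roots_def by (auto simp: image_iff)
  then show ?thesis by (rule finite_subset) auto
qed

lemma finite_ad_index [simp]: "finite (ad_index l)"
  by (simp add: ad_index_def)

lemma ad_basis_carrier [simp]: "ad_basis l p \<in> carrier_mat (2 * l) (2 * l)"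
  by (cases p) (simp_all add: chev_h_def half_H_def minus_carrier_mat)

lemma z_span_incl: "X \<in> S \<Longrightarrow> X \<in> carrier_mat n n \<Longrightarrow> X \<in> z_span n S"
  using z_span.add[OF z_span.zero, of X S n] by simp

lemma z_span_carrier:
  assumes "A \<in> z_span n S" "S \<subseteq> carrier_mat n n" shows "A \<in> carrier_mat n n"
  using assms by induction (auto simp: minus_carrier_mat)

lemma z_span_plus:
  assumes "B \<in> z_span n S" "A \<in> z_span n S" "S \<subseteq> carrier_mat n n"
  shows "A + B \<in> z_span n S"
  using assms
proof (induction)
  case zero
  then show ?case using z_span_carrier[of A n S] by simp
next
  case (add B X)
  then have "A + (B + X) = A + B + X" 
    using z_span_carrier[of A n S] z_span_carrier[of B n S] by (intro assoc_add_mat[symmetric, of _ n n]) auto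
  then show ?case using add by (auto intro: z_span.add)
next
  case (sub B X)
  then have "A \<in> carrier_mat n n" "B \<in> carrier_mat n n" "X \<in> carrier_mat n n"
    using z_span_carrier[of A n S] z_span_carrier[of B n S] by auto
  then have "A + (B - X) = A + B - X" by (intro eq_matI) auto
  then show ?case using sub by (auto intro: z_span.sub)
qed

lemma z_comb_single:
  assumes "p \<in> ad_index l" shows "z_comb l (\<lambda>q. if q = p then 1 else 0) = ad_basis l p"
proof (rule eq_matI)
  fix i j assume "i < dim_row (ad_basis l p)" "j < dim_col (ad_basis l p)"
  then have ij: "i < 2 * l" "j < 2 * l" using ad_basis_carrier[of l p] by auto
  have "(\<Sum>q\<in>ad_index l. of_int (if q = p then 1 else 0) * ad_basis l q $$ (i, j))
      = (\<Sum>q\<in>ad_index l. if q = p then ad_basis l p $$ (i, j) else 0)"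
    by (intro sum.cong) auto
  then show "z_comb l (\<lambda>q. if q = p then 1 else 0) $$ (i, j) = ad_basis l p $$ (i, j)"
    using ij assms by (simp add: z_comb_def)
qed (simp_all add: z_comb_def carrier_matD[OF ad_basis_carrier])

lemma z_comb_add: "z_comb l c + z_comb l d = z_comb l (\<lambda>p. c p + d p)"
  by (rule eq_matI) (auto simp: z_comb_def sum.distrib algebra_simps)

lemma z_comb_diff: "z_comb l c - z_comb l d = z_comb l (\<lambda>p. c p - d p)"
  by (rule eq_matI) (auto simp: z_comb_def sum_subtractf algebra_simps)

text \<open>The \<open>\<int>\<close>-span of \<open>ad_basis l\<close>; \<open>g_ad_Z_subset_lat\<close> shows that it contains \<open>g_ad_Z l\<close>.\<close>

definition lat :: "nat \<Rightarrow> rat mat set" where "lat l = range (z_comb l)"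

lemma lat_add: "A \<in> lat l \<Longrightarrow> B \<in> lat l \<Longrightarrow> A + B \<in> lat l"
  unfolding lat_def using z_comb_add by fastforce
lemma lat_diff: "A \<in> lat l \<Longrightarrow> B \<in> lat l \<Longrightarrow> A - B \<in> lat l"
  unfolding lat_def using z_comb_diff by fastforce
lemma lat_basis: "p \<in> ad_index l \<Longrightarrow> ad_basis l p \<in> lat l"
  unfolding lat_def using z_comb_single by (metis rangeI)
lemma lat_zero: "0\<^sub>m (2 * l) (2 * l) \<in> lat l"
proof -
  have "z_comb l (\<lambda>_. 0) = 0\<^sub>m (2 * l) (2 * l)" by (rule eq_matI) (auto simp: z_comb_def)
  then show ?thesis unfolding lat_def by (metis rangeI)
qed

lemma z_span_subset_lat: "A \<in> z_span (2 * l) S \<Longrightarrow> S \<subseteq> lat l \<Longrightarrow> A \<in> lat l"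
  by (induction rule: z_span.induct) (auto intro: lat_zero lat_add lat_diff)

lemma chev_h_carrier [simp]: "chev_h l i \<in> carrier_mat (2 * l) (2 * l)"
  by (simp add: chev_h_def minus_carrier_mat)

lemma chev_h_entry:
  assumes "1 \<le> i" "i \<le> l" "a < 2 * l" "b < 2 * l"
  shows "chev_h l i $$ (a, b) =
    (if a = b \<and> a + 1 = i then 1 else if a = b \<and> a + i = 2 * l then - 1 else 0)"
  using assms by (auto simp: chev_h_def E_def)

lemma ad_index_iff:
  "Half \<in> ad_index l" "Cr i \<in> ad_index l \<longleftrightarrow> i \<in> {2..l}" "Rt \<gamma> \<in> ad_index l \<longleftrightarrow> \<gamma> \<in> roots l"
  by (auto simp: ad_index_def)

lemma chev_h_one:
  assumes "1 \<le> l"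
  shows "chev_h l 1 = z_comb l (\<lambda>p. case p of Rt _ \<Rightarrow> 0 | Cr i \<Rightarrow> - 1 | Half \<Rightarrow> 2)"
proof (rule eq_matI)
  let ?c = "\<lambda>p. case p of Rt _ \<Rightarrow> 0 | Cr i \<Rightarrow> - 1 | Half \<Rightarrow> (2::int)"
  fix a b assume "a < dim_row (z_comb l ?c)" "b < dim_col (z_comb l ?c)"
  then have ab: "a < 2 * l" "b < 2 * l" by (auto simp: z_comb_def)
  let ?d = "if a = b then 1 else (0::rat)"
  have h: "chev_h l i $$ (a, b) = (if i = a + 1 then ?d else 0) - (if i = 2 * l - a then ?d else 0)"
    if "2 \<le> i" "i \<le> l" for i
  proof (cases "i = a + 1")
    case True
    then have "i \<noteq> 2 * l - a" using that by linarith
    then show ?thesis using that ab True by (simp add: chev_h_entry)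
  next
    case False
    then have "a + 1 \<noteq> i" "a + i = 2 * l \<longleftrightarrow> i = 2 * l - a" using ab by linarith+
    then show ?thesis using that ab False by (simp add: chev_h_entry)
  qed
  have t: "of_int (?c p) * ad_basis l p $$ (a, b) =
      (if p = Half then 2 * half_H l $$ (a, b) else 0)
      + ((if p = Cr (2 * l - a) then ?d else 0) - (if p = Cr (a + 1) then ?d else 0))"
    if "p \<in> ad_index l" for p
  proof (cases p)
    case (Cr i)
    then have "2 \<le> i" "i \<le> l" using that by (auto simp: ad_index_def)
    then show ?thesis using h[of i] Cr by simp
  qed simp_all
  have "z_comb l ?c $$ (a, b) = (\<Sum>p\<in>ad_index l. of_int (?c p) * ad_basis l p $$ (a, b))"
    using ab by (simp add: z_comb_def)
  also have "\<dots> = (\<Sum>p\<in>ad_index l. (if p = Half then 2 * half_H l $$ (a, b) else 0)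
      + ((if p = Cr (2 * l - a) then ?d else 0) - (if p = Cr (a + 1) then ?d else 0)))"
    by (rule sum.cong[OF refl t])
  also have "\<dots> = (if Half \<in> ad_index l then 2 * half_H l $$ (a, b) else 0)
      + ((if Cr (2 * l - a) \<in> ad_index l then ?d else 0) - (if Cr (a + 1) \<in> ad_index l then ?d else 0))"
    by (simp only: sum.distrib sum_subtractf sum.delta[OF finite_ad_index])
  finally have *: "z_comb l ?c $$ (a, b) = 2 * half_H l $$ (a, b)
      + ((if 2 * l - a \<in> {2..l} then ?d else 0) - (if a + 1 \<in> {2..l} then ?d else 0))"
    by (simp only: ad_index_iff if_True)
  show "chev_h l 1 $$ (a, b) = z_comb l ?c $$ (a, b)"
  proof (cases "a = b")
    case False
    then show ?thesis unfolding * using ab assms by (simp add: chev_h_entry half_H_def)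
  next
    case eq: True
    show ?thesis
    proof (cases "a < l")
      case True
      then have "2 * l - a \<notin> {2..l}" "a + 1 \<in> {2..l} \<longleftrightarrow> a \<noteq> 0" "a + 1 \<noteq> 2 * l"
        using assms by auto
      then show ?thesis unfolding * using ab assms eq True by (simp add: chev_h_entry half_H_def)
    next
      case False
      then have "2 * l - a \<in> {2..l} \<longleftrightarrow> a + 1 \<noteq> 2 * l" "a + 1 \<notin> {2..l}" "a \<noteq> 0"
        using assms ab by auto
      then show ?thesis unfolding * using ab assms eq False by (simp add: chev_h_entry half_H_def)
    qed
  qed
qed (simp_all add: z_comb_def carrier_matD[OF chev_h_carrier])

lemma chev_h_lat: "1 \<le> i \<Longrightarrow> i \<le> l \<Longrightarrow> chev_h l i \<in> lat l"
proof (cases "i = 1")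
  case True
  then show "1 \<le> i \<Longrightarrow> i \<le> l \<Longrightarrow> ?thesis" using chev_h_one[of l] by (auto simp: lat_def)
next
  case False
  then show "1 \<le> i \<Longrightarrow> i \<le> l \<Longrightarrow> ?thesis" using lat_basis[of "Cr i" l] by (auto simp: ad_index_def)
qed

lemma g_ad_Z_subset_lat: "g_ad_Z l \<subseteq> lat l"
proof -
  have H: "chev_H l i \<in> lat l" if "i \<in> {1..l}" for i
    using that by (auto simp: chev_H_def intro!: lat_diff chev_h_lat)
  have X: "chev_X l \<gamma> \<in> lat l" if "\<gamma> \<in> roots l" for \<gamma>
    using that lat_basis[of "Rt \<gamma>" l] by (auto simp: ad_index_def)
  have "g_Z l \<subseteq> lat l" unfolding g_Z_def using z_span_subset_lat H X by blast
  moreover have "half_H l \<in> lat l" using lat_basis[of Half l] by (auto simp: ad_index_def)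
  ultimately show ?thesis unfolding g_ad_Z_def using z_span_subset_lat by blast
qed

lemma g_Z_carrier: "g_Z l \<subseteq> carrier_mat (2 * l) (2 * l)"
  unfolding g_Z_def by (auto elim!: z_span_carrier simp: chev_H_def minus_carrier_mat)

lemma chev_h_g_Z: "1 \<le> i \<Longrightarrow> i \<le> l \<Longrightarrow> chev_h l i \<in> g_Z l"
proof (induction "l - i" arbitrary: i)
  case 0
  then have "chev_h l i = chev_H l l" by (simp add: chev_H_def)
  then show ?case using 0 by (auto simp: g_Z_def chev_H_def minus_carrier_mat intro!: z_span_incl)
next
  case (Suc d)
  have sub: "chev_X l ` roots l \<union> chev_H l ` {1..l} \<subseteq> carrier_mat (2 * l) (2 * l)"
    by (auto simp: chev_H_def minus_carrier_mat)
  have "chev_h l i = chev_h l (i + 1) + chev_H l i"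
    using Suc by (intro eq_matI) (auto simp: chev_H_def chev_h_def)
  moreover have "chev_H l i \<in> g_Z l" using Suc by (auto simp: g_Z_def chev_H_def minus_carrier_mat intro!: z_span_incl)
  moreover have "chev_h l (i + 1) \<in> g_Z l" using Suc by auto
  ultimately show ?case using z_span_plus[OF _ _ sub, of "chev_H l i" "chev_h l (i + 1)"]
    unfolding g_Z_def by metis
qed

lemma chev_X_g_Z: "\<gamma> \<in> roots l \<Longrightarrow> chev_X l \<gamma> \<in> g_Z l"
  unfolding g_Z_def by (rule z_span_incl) auto

lemma ad_basis_in:
  assumes "p \<in> ad_index l" shows "ad_basis l p \<in> g_ad_Z l"
proof -
  have "ad_basis l p \<in> g_Z l \<union> {half_H l}"
    using assms chev_h_g_Z[of _ l] chev_X_g_Z by (auto simp: ad_index_def)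
  then show ?thesis unfolding g_ad_Z_def by (rule z_span_incl) simp_all
qed

fun entry_pos :: "nat \<Rightarrow> root \<Rightarrow> nat \<times> nat" where
  "entry_pos l (Diff i j) = (i - 1, j - 1)"
| "entry_pos l (Plus i j) = (i - 1, 2 * l - j)"
| "entry_pos l (Minus i j) = (2 * l - i, j - 1)"
| "entry_pos l (LPlus i) = (i - 1, 2 * l - i)"
| "entry_pos l (LMinus i) = (2 * l - i, i - 1)"

lemma E_entry:
  assumes "a < n" "b < n"
  shows "E n p q $$ (a, b) = (if Suc a = p \<and> Suc b = q then 1 else 0)"
  using assms by (simp add: E_def)

lemma chev_X_entry:
  assumes "\<gamma> \<in> roots l" "a < 2 * l" "b < 2 * l"
  shows "chev_X l \<gamma> $$ (a, b) = (case \<gamma> of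
      Diff i j \<Rightarrow> (if a + 1 = i \<and> b + 1 = j then 1 else 0) - (if a + j = 2 * l \<and> b + i = 2 * l then 1 else 0)
    | Plus i j \<Rightarrow> (if a + 1 = j \<and> b + i = 2 * l then 1 else 0) + (if a + 1 = i \<and> b + j = 2 * l then 1 else 0)
    | Minus i j \<Rightarrow> (if a + i = 2 * l \<and> b + 1 = j then 1 else 0) + (if a + j = 2 * l \<and> b + 1 = i then 1 else 0)
    | LPlus i \<Rightarrow> (if a + 1 = i \<and> b + i = 2 * l then 1 else 0)
    | LMinus i \<Rightarrow> (if a + i = 2 * l \<and> b + 1 = i then 1 else 0))"
proof -
  have *: "c = 2 * l - i \<longleftrightarrow> c + i = 2 * l" if "i \<le> l" for c i
    using that by linarith
  show ?thesis
    using assms by (cases \<gamma>) (auto simp: roots_def Let_def E_entry * split del: if_split)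
qed

lemma entry_pos_char:
  assumes "\<gamma> \<in> roots l" "entry_pos l \<gamma> = (a, b)"
  shows "case \<gamma> of
      Diff i j \<Rightarrow> a + 1 = i \<and> b + 1 = j
    | Plus i j \<Rightarrow> a + 1 = i \<and> b + j = 2 * l
    | Minus i j \<Rightarrow> a + i = 2 * l \<and> b + 1 = j
    | LPlus i \<Rightarrow> a + 1 = i \<and> b + i = 2 * l
    | LMinus i \<Rightarrow> a + i = 2 * l \<and> b + 1 = i"
  using assms by (cases \<gamma>) (auto simp: roots_def)

lemma ad_basis_entry_root:
  assumes "\<gamma> \<in> roots l" "p \<in> ad_index l"
  shows "ad_basis l p $$ entry_pos l \<gamma> = (if p = Rt \<gamma> then 1 else 0)"
proof -
  obtain a b where ab: "entry_pos l \<gamma> = (a, b)" by force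
  have lt: "a < 2 * l" "b < 2 * l"
    using ab assms(1) by (auto simp: roots_def)
  have ne: "a \<noteq> b"
    using ab assms(1) by (auto simp: roots_def)
  show ?thesis
  proof (cases p)
    case (Rt \<delta>)
    then have \<delta>: "\<delta> \<in> roots l" using assms(2) by (auto simp: ad_index_def)
    have f: "c < l \<Longrightarrow> k \<le> l \<Longrightarrow> c + k = 2 * l \<longleftrightarrow> False" "l \<le> c \<Longrightarrow> k \<le> l \<Longrightarrow> Suc c = k \<longleftrightarrow> False"
      for c k by auto
    have "chev_X l \<delta> $$ (a, b) = (if \<delta> = \<gamma> then 1 else (0::rat))"
    proof (cases \<gamma>)
      case (Diff i j)
      have r: "i = Suc a" "j = Suc b" "a < l" "b < l"
        using entry_pos_char[OF assms(1) ab] assms(1) Diff lt by (auto simp: roots_def)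
      show ?thesis
        using \<delta> unfolding chev_X_entry[OF \<delta> lt] Diff
        by (cases \<delta>) (use r in \<open>auto simp: roots_def f\<close>)
    next
      case (Plus i j)
      have r: "i = Suc a" "b + j = 2 * l" "a < l" "l \<le> b" "i < j"
        using entry_pos_char[OF assms(1) ab] assms(1) Plus lt by (auto simp: roots_def)
      show ?thesis
        using \<delta> unfolding chev_X_entry[OF \<delta> lt] Plus
        by (cases \<delta>) (use r in \<open>auto simp: roots_def f\<close>)
    next
      case (Minus i j)
      have r: "a + i = 2 * l" "j = Suc b" "l \<le> a" "b < l" "i < j"
        using entry_pos_char[OF assms(1) ab] assms(1) Minus lt by (auto simp: roots_def)
      show ?thesis
        using \<delta> unfolding chev_X_entry[OF \<delta> lt] Minus
        by (cases \<delta>) (use r in \<open>auto simp: roots_def f\<close>)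
    next
      case (LPlus i)
      have r: "i = Suc a" "b + i = 2 * l" "a < l" "l \<le> b"
        using entry_pos_char[OF assms(1) ab] assms(1) LPlus lt by (auto simp: roots_def)
      show ?thesis
        using \<delta> unfolding chev_X_entry[OF \<delta> lt] LPlus
        by (cases \<delta>) (use r in \<open>auto simp: roots_def f\<close>)
    next
      case (LMinus i)
      have r: "a + i = 2 * l" "i = Suc b" "l \<le> a" "b < l"
        using entry_pos_char[OF assms(1) ab] assms(1) LMinus lt by (auto simp: roots_def)
      show ?thesis
        using \<delta> unfolding chev_X_entry[OF \<delta> lt] LMinus
        by (cases \<delta>) (use r in \<open>auto simp: roots_def f\<close>)
    qed
    then show ?thesis using Rt ab by auto
  qed (use lt ne ab in \<open>auto simp: chev_h_def half_H_def E_entry\<close>)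
qed

lemma entry_pos_less:
  "\<gamma> \<in> roots l \<Longrightarrow> fst (entry_pos l \<gamma>) < 2 * l \<and> snd (entry_pos l \<gamma>) < 2 * l"
  by (auto simp: roots_def)

lemma chev_X_diag: "\<gamma> \<in> roots l \<Longrightarrow> a < l \<Longrightarrow> chev_X l \<gamma> $$ (a, a) = (0 :: 'a::comm_ring_1)"
  using chev_X_entry[of \<gamma> l a a, where ?'a = 'a] by (cases \<gamma>) (auto simp: roots_def)

lemma z_comb_root: 
  assumes "\<gamma> \<in> roots l" 
  shows "z_comb l c $$ entry_pos l \<gamma> = of_int (c (Rt \<gamma>))"
proof -
  obtain a b where ab: "entry_pos l \<gamma> = (a, b)" by force
  have "z_comb l c $$ (a, b) = (\<Sum>p\<in>ad_index l. of_int (c p) * ad_basis l p $$ entry_pos l \<gamma>)"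
    using entry_pos_less[OF assms] ab by (simp add: z_comb_def)
  also have "\<dots> = (\<Sum>p\<in>ad_index l. if p = Rt \<gamma> then of_int (c p) else 0)"
    by (intro sum.cong) (auto simp: ad_basis_entry_root[OF assms])
  also have "\<dots> = of_int (c (Rt \<gamma>))" using assms by (subst sum.delta[OF finite_ad_index]) (auto simp: ad_index_def)
  finally show ?thesis using ab by simp
qed

lemma z_comb_diag:
  assumes "a < l"
  shows "z_comb l c $$ (a, a) = (if a \<ge> 1 then of_int (c (Cr (a + 1))) else 0) + of_int (c Half) / 2"
proof -
  have "z_comb l c $$ (a, a) = (\<Sum>p\<in>ad_index l. of_int (c p) * ad_basis l p $$ (a, a))"
    using assms by (simp add: z_comb_def)
  also have "\<dots> = (\<Sum>p\<in>ad_index l. (if p = Cr (a + 1) then of_int (c p) else 0)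
     + (if p = Half then of_int (c p) / 2 else 0))"
    using assms
    by (intro sum.cong) (auto simp: ad_index_def chev_X_diag chev_h_entry half_H_def split: if_splits)
  also have "\<dots> = (if a \<ge> 1 then of_int (c (Cr (a + 1))) else 0) + of_int (c Half) / 2"
    using assms by (simp only: sum.distrib sum.delta[OF finite_ad_index]) (auto simp: ad_index_def)
  finally show ?thesis .
qed

lemma z_comb_inj:
  assumes "1 \<le> l" "z_comb l c = z_comb l d" "p \<in> ad_index l" shows "c p = d p"
proof -
  have half: "c Half = d Half"
    using z_comb_diag[of 0 l c] z_comb_diag[of 0 l d] assms by simp
  have "c (Cr i) = d (Cr i)" if i: "i \<in> {2..l}" for i
  proof -
    obtain a where a: "i = Suc a" "1 \<le> a" "a < l" using i by (cases i) auto
    show ?thesis using z_comb_diag[of a l c] z_comb_diag[of a l d] assms half a by simp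
  qed
  moreover have "c (Rt \<gamma>) = d (Rt \<gamma>)" if "\<gamma> \<in> roots l" for \<gamma>
    using z_comb_root[OF that, of c] z_comb_root[OF that, of d] assms by simp
  ultimately show ?thesis using half assms(3) by (auto simp: ad_index_def)
qed

lemma ad_basis_unique_coords:
  assumes "1 \<le> l" "A \<in> g_ad_Z l"
  shows "\<exists>!c. (\<forall>p. p \<notin> ad_index l \<longrightarrow> c p = 0) \<and> A = z_comb l c"
proof -
  obtain c where c: "A = z_comb l c" using assms g_ad_Z_subset_lat by (auto simp: lat_def)
  define d where "d = (\<lambda>p. if p \<in> ad_index l then c p else 0)"
  have d: "z_comb l d = A" unfolding c z_comb_def d_def by (intro eq_matI) auto
  show ?thesis
  proof (rule ex1I[of _ d])
    fix e assume "(\<forall>p. p \<notin> ad_index l \<longrightarrow> e p = 0) \<and> A = z_comb l e"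
    then show "e = d" using z_comb_inj[OF assms(1), of e d] d by (auto simp: d_def fun_eq_iff)
  qed (use d in \<open>auto simp: d_def\<close>)
qed

end

theory Submission
  imports Defs
begin

text \<open>
  The module \<open>g_ad\<close> is \<open>gsp(V) / K\<close>, where \<open>gsp(V)\<close> consists of the \<open>X\<close> with
  \<open>b(X x, y) + b(x, X y) = \<mu> b(x, y)\<close> for some multiplier \<open>\<mu>\<close>: the element \<open>H\<close> of the lattice
  becomes \<open>diag(1, \<dots>, 1, 0, \<dots>, 0)\<close>, which has multiplier 1. Hence \<open>dim g_ad\<^sup>u + 1\<close> is the
  dimension of the space of all \<open>X \<in> gsp(V)\<close> with \<open>u X = (X + c) u\<close> for some scalar \<open>c\<close>, and
  \<open>g_sc\<^sup>u\<close> is the kernel of \<open>X \<mapsto> (\<mu>, c)\<close> on it. So \<open>dim g_ad\<^sup>u = dim g_sc\<^sup>u - 1 + r\<close>, where \<open>r\<close> is the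
  dimension of the space of the pairs \<open>(\<mu>, c)\<close> that occur. By orthogonal projection, that space is the
  intersection of the spaces belonging to the blocks. For \<open>W(m)\<close> it is \<open>K\<^sup>2\<close> if \<open>m\<close> is even
  and \<open>c = 0\<close> if \<open>m\<close> is odd; for \<open>V(2k)\<close> it is the line \<open>\<mu> = k c\<close>.
\<close>

section \<open>Symplectic spaces in characteristic two\<close>

text \<open>Two facts repair this: every isometry is a product of root elements
  (\<open>isom_G\<close>), and a root element acts, modulo scalars, by conjugation of endomorphisms
  of \<open>V\<close> (\<open>Psi_root_act\<close>). A word then acts by conjugation with its
  product, whatever the word, and being fixed by \<open>u\<close> means commuting with
  \<open>u\<close> up to a scalar \<open>c\<close>. The matrix diag(1, ..., 1, 0, ..., 0) is H +
  1/2: brackets do not see scalars, and this representative has integral entries, so it can be read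
  over \<open>K\<close>. Scalars themselves have multiplier 2 = 0. The constraints on a block come
  from powers of n = u - 1. Commuting n^i past X leaves the correction i c n^(i-1) u. On W(m) the
  power i = m turns the parity of m into the condition on \<open>c\<close>; on V(2k) the power 2k -
  1 links the two ends of the block, and the coefficient k arises from the full sums in the action
  of \<open>u\<close>.\<close>

locale symplectic_char2 = vector_space scale
  for scale :: "'k::field \<Rightarrow> 'v::ab_group_add \<Rightarrow> 'v" +
  fixes b :: "'v \<Rightarrow> 'v \<Rightarrow> 'k" and l :: nat and v :: "nat \<Rightarrow> 'v"
  assumes char2: "CHAR('k) = 2" and l_pos: "1 \<le> l"
    and form: "nondeg_alternating scale b" and basis: "symplectic_basis scale b l v"
begin

abbreviation lin :: "('v \<Rightarrow> 'v) \<Rightarrow> bool" where "lin \<equiv> Vector_Spaces.linear scale scale"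

lemma two_K: "(2::'k) = 0"
  using of_nat_CHAR[where ?'a='k] char2 by simp

lemma add_self_K [simp]: "(x::'k) + x = 0"
  using two_K by (metis mult_2 mult_zero_left)

lemma add_self_K_left [simp]: "(x::'k) + (x + y) = y"
  by (simp add: add.assoc[symmetric])

lemma minus_K [simp]: "- (x::'k) = x"
  by (simp add: minus_unique)

lemma diff_K [simp]: "(x::'k) - y = x + y"
  by (simp add: diff_conv_add_uminus del: add_uminus_conv_diff)

lemma add_eq_0_K: "(x::'k) + y = 0 \<longleftrightarrow> x = y"
  by (metis add_self_K add.left_cancel)

lemma of_nat_K: "(of_nat i :: 'k) = (if even i then 0 else 1)"
  by (cases "even i") (auto elim!: evenE oddE simp: two_K)

lemma add_self_V [simp]: "(x::'v) + x = 0"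
  using scale_left_distrib[of 1 1 x] by simp

lemma add_self_V_left [simp]: "(x::'v) + (x + y) = y"
  by (simp add: add.assoc[symmetric])

lemma minus_V [simp]: "- (x::'v) = x"
  by (simp add: minus_unique)

lemma diff_V [simp]: "(x::'v) - y = x + y"
  by (simp add: diff_conv_add_uminus del: add_uminus_conv_diff)

lemma b_add_left [simp]: "b (x + y) z = b x z + b y z"
  and b_add_right [simp]: "b z (x + y) = b z x + b z y"
  and b_scale_left [simp]: "b (scale c x) z = c * b x z"
  and b_scale_right [simp]: "b z (scale c x) = c * b z x"
  and b_zero_left [simp]: "b 0 z = 0"
  and b_zero_right [simp]: "b z 0 = 0"
  and b_self [simp]: "b x x = 0"
proof -
  have l: "Vector_Spaces.linear scale (*) (\<lambda>x. b x z)" "Vector_Spaces.linear scale (*) (\<lambda>x. b z x)" for z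
    using form by (auto simp: nondeg_alternating_def)
  show "b (x + y) z = b x z + b y z" "b z (x + y) = b z x + b z y"
    and sc: "b (scale c x) z = c * b x z" "b z (scale c x) = c * b z x" for x y z c
    using l[of z] by (simp_all add: Vector_Spaces.linear_iff)
  show "b 0 z = 0" "b z 0 = 0" by (metis sc scale_zero_left mult_zero_left)+
  show "b x x = 0" using form by (auto simp: nondeg_alternating_def)
qed

lemma b_sym: "b x y = b y x"
proof -
  have "b (x + y) (x + y) = b x y + b y x" by (simp del: b_self add: b_self[of x] b_self[of y])
  then have "b x y + b y x = 0" by (simp only: b_self)
  then show ?thesis by (simp add: add_eq_0_K)
qed

lemma b_sum_left: "b (\<Sum>i\<in>A. f i) z = (\<Sum>i\<in>A. b (f i) z)"
  by (induction A rule: infinite_finite_induct) auto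

lemma linI:
  assumes "\<And>x y. f (x + y) = f x + f y" "\<And>c x. f (scale c x) = scale c (f x)"
  shows "lin f"
  using assms vector_space_axioms by (simp add: Vector_Spaces.linear_iff)

lemma lin_add: "lin f \<Longrightarrow> f (x + y) = f x + f y"
  and lin_scale: "lin f \<Longrightarrow> f (scale c x) = scale c (f x)"
  by (simp_all add: Vector_Spaces.linear_iff)

lemma lin_zero: "lin f \<Longrightarrow> f 0 = 0"
  using lin_scale[of f 0 0] by simp

lemma lin_sum: "lin f \<Longrightarrow> f (\<Sum>i\<in>A. g i) = (\<Sum>i\<in>A. f (g i))"
  by (induction A rule: infinite_finite_induct) (auto simp: lin_add lin_zero)

text \<open>The hyperbolic partner: \<open>v i\<close> and \<open>v (op i)\<close> pair to
  1.\<close>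

definition op :: "nat \<Rightarrow> nat" where "op i = 2 * l + 1 - i"

definition ix :: "nat set" where "ix = {1..2 * l}"

lemma finite_ix [simp]: "finite ix"
  by (simp add: ix_def)

lemma op_ix [simp]: "i \<in> ix \<Longrightarrow> op i \<in> ix"
  by (auto simp: op_def ix_def)

lemma op_op [simp]: "i \<in> ix \<Longrightarrow> op (op i) = i"
  by (auto simp: op_def ix_def)

lemma op_ne [simp]: "i \<in> ix \<Longrightarrow> op i \<noteq> i"
  by (simp add: op_def ix_def) presburger

lemma op_eq_iff: "i \<in> ix \<Longrightarrow> j \<in> ix \<Longrightarrow> op i = op j \<longleftrightarrow> i = j"
  by (auto simp: op_def ix_def)

lemma gram: "i \<in> ix \<Longrightarrow> j \<in> ix \<Longrightarrow> b (v i) (v j) = (if j = op i then 1 else 0)"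
  using basis by (auto simp: symplectic_basis_def op_def ix_def)

text \<open>By \<open>gram\<close>, \<open>v (op i)\<close> is dual to \<open>v i\<close>, so
  coordinates are values of the form. Later computations use these instead of
  \<open>representation\<close>.\<close>

lemma expand: "x = (\<Sum>i\<in>ix. scale (b x (v (op i))) (v i))"
proof -
  have "x \<in> span (v ` ix)" using basis by (auto simp: symplectic_basis_def is_basis_of_def ix_def)
  then show ?thesis
  proof (induction rule: span_induct_alt)
    case base
    show ?case by simp
  next
    case (step c x y)
    then obtain j where j: "j \<in> ix" "x = v j" by auto
    have "(\<Sum>i\<in>ix. scale (b x (v (op i))) (v i)) = (\<Sum>i\<in>ix. if i = j then v j else 0)"
      using j by (intro sum.cong refl) (auto simp: gram op_eq_iff)
    then have "(\<Sum>i\<in>ix. scale (b x (v (op i))) (v i)) = x"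
      using j by simp
    then show ?case using step.IH[symmetric]
      by (simp add: scale_left_distrib sum.distrib scale_sum_right[symmetric] scale_scale[symmetric] del: scale_scale)
  qed
qed

lemma eq_by_gram:
  assumes "\<And>i. i \<in> ix \<Longrightarrow> b x (v i) = b y (v i)" shows "x = y"
  by (subst expand[of x], subst expand[of y]) (auto intro!: sum.cong simp: assms)

lemma lin_eq_on_basis:
  assumes "lin f" "lin g" "\<And>i. i \<in> ix \<Longrightarrow> f (v i) = g (v i)" shows "f = g"
proof
  fix x show "f x = g x"
    by (subst (1 2) expand[of x]) (auto intro!: sum.cong simp: assms lin_sum lin_scale)
qed

lemma rep_v:
  assumes "j \<in> ix" shows "representation (v ` ix) x (v j) = b x (v (op j))"
proof -
  have ind: "independent (v ` ix)" and sp: "span (v ` ix) = UNIV" and inj: "inj_on v ix"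
    using basis by (auto simp: symplectic_basis_def is_basis_of_def ix_def)
  have "x = (\<Sum>w\<in>v ` ix. scale (representation (v ` ix) x w) w)"
    using sum_representation_eq[OF ind, of x "v ` ix"] sp by simp
  also have "\<dots> = (\<Sum>i\<in>ix. scale (representation (v ` ix) x (v i)) (v i))"
    using inj by (simp add: sum.reindex)
  finally have "b x (v (op j)) = (\<Sum>i\<in>ix. representation (v ` ix) x (v i) * b (v i) (v (op j)))"
    by (metis (no_types, lifting) b_scale_left b_sum_left sum.cong)
  also have "\<dots> = (\<Sum>i\<in>ix. if i = j then representation (v ` ix) x (v j) else 0)"
    using assms by (intro sum.cong refl) (auto simp: gram op_eq_iff)
  finally show ?thesis using assms by simp
qed

subsection \<open>Generation by root elements\<close>

text \<open>The constructors mirror those of \<open>ad_graph\<close>, so the induction on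
  \<open>G\<close> produces a word for \<open>ad_graph\<close>.\<close>

inductive_set G :: "('v \<Rightarrow> 'v) set" where
  G_id: "id \<in> G"
| G_mult: "g \<in> G \<Longrightarrow> \<gamma> \<in> roots l \<Longrightarrow> root_elt scale l v \<gamma> t \<circ> g \<in> G"

lemma G_comp: "g \<in> G \<Longrightarrow> h \<in> G \<Longrightarrow> g \<circ> h \<in> G"
  by (induction rule: G.induct) (auto simp: comp_assoc intro: G.intros)

lemma G_root: "\<gamma> \<in> roots l \<Longrightarrow> root_elt scale l v \<gamma> t \<in> G"
  using G_mult[OF G_id] by simp

lemma mat_act_eq: "mat_act scale (2 * l) v A x =
   (\<Sum>i\<in>ix. \<Sum>j\<in>ix. scale (A $$ (i - 1, j - 1) * b x (v (op j))) (v i))"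
  unfolding mat_act_def ix_def[symmetric] by (intro sum.cong refl) (simp add: rep_v)

lemma mat_act_E:
  assumes "p \<in> ix" "q \<in> ix"
  shows "mat_act scale (2 * l) v (E (2 * l) p q) x = scale (b x (v (op q))) (v p)"
proof -
  have "E (2 * l) p q $$ (i - 1, j - 1) = (if i = p \<and> j = q then 1 else 0 :: 'k)"
    if "i \<in> ix" "j \<in> ix" for i j
    using that assms by (auto simp: E_def ix_def)
  then have "mat_act scale (2 * l) v (E (2 * l) p q) x =
      (\<Sum>i\<in>ix. \<Sum>j\<in>ix. if i = p \<and> j = q then scale (b x (v (op q))) (v p) else 0)"
    unfolding mat_act_eq by (intro sum.cong refl) simp
  also have "\<dots> =
      (\<Sum>i\<in>ix. if i = p then \<Sum>j\<in>ix. if j = q then scale (b x (v (op q))) (v p) else 0 else 0)"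
    by (intro sum.cong refl) simp
  also have "\<dots> = scale (b x (v (op q))) (v p)"
    using assms by simp
  finally show ?thesis .
qed

lemma mat_act_add:
  assumes "A \<in> carrier_mat (2 * l) (2 * l)" "B \<in> carrier_mat (2 * l) (2 * l)"
  shows "mat_act scale (2 * l) v (A + B) x = mat_act scale (2 * l) v A x + mat_act scale (2 * l) v B x"
  unfolding mat_act_eq sum.distrib[symmetric] using assms
  by (intro sum.cong refl) (auto simp: scale_left_distrib distrib_right ix_def)

lemma mat_K_minus:
  fixes A B :: "'k mat"
  assumes "A \<in> carrier_mat n n" "B \<in> carrier_mat n n" shows "A - B = A + B"
  using assms by (intro eq_matI) auto

definition trv :: "'v \<Rightarrow> 'k \<Rightarrow> 'v \<Rightarrow> 'v" where
  "trv w a x = x + scale (a * b x w) w"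

text \<open>For orthogonal basis vectors \<open>a\<close> and \<open>c\<close> this is the root
  element of a short root.\<close>

definition elt :: "'v \<Rightarrow> 'v \<Rightarrow> 'k \<Rightarrow> 'v \<Rightarrow> 'v" where
  "elt a c t x = x + scale (t * b x a) c + scale (t * b x c) a"

text \<open>The index pairs \<open>(q, p)\<close> and \<open>(op p, op q)\<close> are mirror images,
  and their matrix units make up one short root vector. Whether it is \<open>Diff\<close>,
  \<open>Plus\<close> or \<open>Minus\<close> depends on the halves in which \<open>p\<close> and
  \<open>q\<close> lie; signs disappear in characteristic two.\<close>

lemma chev_X_short:
  assumes "p \<in> ix" "q \<in> ix" "p \<noteq> q" "q \<noteq> op p"
  shows "\<exists>\<gamma>\<in>roots l. (chev_X l \<gamma> :: 'k mat) = E (2 * l) q p + E (2 * l) (op p) (op q)"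
proof -
  have comm: "E (2*l) a c + E (2*l) d e = E (2*l) d e + (E (2*l) a c :: 'k mat)" for a c d e
    by (intro eq_matI) auto
  note defs = roots_def Let_def op_def ix_def Suc_diff_le
  consider "p \<le> l" "q \<le> l" | "p \<le> l" "q > l" "op q < p" | "p \<le> l" "q > l" "p < op q"
    | "p > l" "q \<le> l" "op p < q" | "p > l" "q \<le> l" "q < op p" | "p > l" "q > l"
    using assms by (metis linorder_neqE_nat not_le op_op)
  then show ?thesis
  proof cases
    case 1
    then show ?thesis using assms
      by (intro bexI[of _ "Diff q p"]) (auto simp: defs mat_K_minus[of _ "2 * l"])
  next
    case 2
    then show ?thesis using assms 
      by (intro bexI[of _ "Minus (op q) p"]) (auto simp: defs comm)
  next
    case 3
    then show ?thesis using assms 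
      by (intro bexI[of _ "Minus p (op q)"]) (auto simp: defs comm)
  next
    case 4
    then show ?thesis using assms
      by (intro bexI[of _ "Plus (op p) q"]) (auto simp: defs comm)
  next
    case 5
    then show ?thesis using assms
      by (intro bexI[of _ "Plus q (op p)"]) (auto simp: defs comm)
  next
    case 6
    have *: "E (2*l) (op p) (op q) - E (2*l) q p = E (2 * l) q p + (E (2 * l) (op p) (op q) :: 'k mat)"
      by (simp add: mat_K_minus[of _ "2 * l"] comm)
    show ?thesis using assms 6 *
      by (intro bexI[of _ "Diff (op p) (op q)"]) (auto simp: defs)
  qed
qed

lemma elt_G:
  assumes "i \<in> ix" "j \<in> ix" "i \<noteq> j" "j \<noteq> op i"
  shows "elt (v i) (v j) t \<in> G"
proof -
  have "j \<noteq> op (op i)" "op i \<noteq> j" using assms by auto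
  then obtain \<gamma> where g: "\<gamma> \<in> roots l" "(chev_X l \<gamma> :: 'k mat) = E (2 * l) j (op i) + E (2 * l) i (op j)"
    using chev_X_short[of "op i" j] assms by auto
  have "root_elt scale l v \<gamma> t = elt (v i) (v j) t"
    using assms by (auto simp: fun_eq_iff root_elt_def g(2) mat_act_add mat_act_E elt_def scale_right_distrib add.assoc)
  then show ?thesis using G_root[OF g(1)] by metis
qed

lemma trv_basis_G:
  assumes "i \<in> ix" shows "trv (v i) a \<in> G"
proof -
  have "\<exists>\<gamma>\<in>roots l. (chev_X l \<gamma> :: 'k mat) = E (2 * l) i (op i)"
  proof (cases "i \<le> l")
    case True
    then show ?thesis using assms
      by (intro bexI[of _ "LPlus i"]) (auto simp: roots_def Let_def op_def ix_def Suc_diff_le)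
  next
    case False
    then show ?thesis using assms
      by (intro bexI[of _ "LMinus (op i)"]) (auto simp: roots_def Let_def op_def ix_def Suc_diff_le)
  qed
  then obtain \<gamma> where g: "\<gamma> \<in> roots l" "(chev_X l \<gamma> :: 'k mat) = E (2 * l) i (op i)" by auto
  have "root_elt scale l v \<gamma> a = trv (v i) a"
    using assms by (auto simp: fun_eq_iff root_elt_def g(2) mat_act_E trv_def)
  then show ?thesis using G_root[OF g(1)] by metis
qed

lemma elt_elt:
  assumes "b a c = 0" shows "elt a c t (elt a c t x) = x"
  using assms b_sym[of a c] by (simp add: elt_def algebra_simps)

text \<open>Conjugation by an isometry moves the direction of a transvection by that isometry, and
  \<open>elt a c t\<close> is an isometry and its own inverse when \<open>a\<close> and
  \<open>c\<close> are orthogonal.\<close>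

lemma trv_conj_elt:
  assumes "b a c = 0"
  shows "elt a c t \<circ> trv (elt a c t w) d \<circ> elt a c t = trv w d"
proof
  fix x
  have add: "elt a c t (y + scale e z) = elt a c t y + scale e (elt a c t z)" for y z e
    by (simp add: elt_def algebra_simps)
  have inv: "b (elt a c t y) (elt a c t z) = b y z" for y z
    using assms b_sym[of a c] b_sym[of a z] b_sym[of c z]
    by (simp add: elt_def algebra_simps)
  have "trv (elt a c t w) d (elt a c t x) = elt a c t x + scale (d * b x w) (elt a c t w)"
    by (simp only: trv_def inv)
  then show "(elt a c t \<circ> trv (elt a c t w) d \<circ> elt a c t) x = trv w d x"
    by (simp add: add elt_elt[OF assms]) (simp add: trv_def)
qed

lemma trv_trv: "trv a t (trv a t x) = x"
  by (simp add: trv_def algebra_simps)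

lemma trv_b: "b (trv a t x) (trv a t y) = b x y"
  using b_sym[of a y] by (simp add: trv_def algebra_simps)

lemma trv_conj_trv: "trv a t \<circ> trv (trv a t w) d \<circ> trv a t = trv w d"
proof
  fix x
  have add: "trv a t (y + scale e z) = trv a t y + scale e (trv a t z)" for y z e
    by (simp add: trv_def algebra_simps)
  have "trv (trv a t w) d (trv a t x) = trv a t x + scale (d * b x w) (trv a t w)"
    using trv_b[of a t x w] by (subst trv_def) simp
  then show "(trv a t \<circ> trv (trv a t w) d \<circ> trv a t) x = trv w d x"
    by (simp add: add trv_trv) (simp add: trv_def)
qed

lemma trv_scale: "trv (scale c w) d = trv w (d * c * c)"
  by (simp add: trv_def fun_eq_iff algebra_simps)

text \<open>Root elements clear all coordinates of \<open>w\<close> except a nonzero one, which conjugates the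
  transvection along \<open>w\<close> to a long root element.\<close>

lemma trv_G: "trv w d \<in> G"
proof (cases "\<exists>i\<in>ix. b w (v i) \<noteq> 0")
  case False
  then have "w = 0" using eq_by_gram[of w 0] by auto
  then have "trv w d = id" by (simp add: trv_def fun_eq_iff)
  then show ?thesis using G_id by simp
next
  case True
  then obtain i where i: "i \<in> ix" "b w (v i) \<noteq> 0" by auto
  \<comment> \<open>\<open>Q\<close> lists the indices whose coordinates may still have to be
    cleared; \<open>w\<close> is quantified because each move replaces it.\<close>
  have "\<forall>w. b w (v i) \<noteq> 0 \<longrightarrow> (\<forall>j\<in>ix - Q - {i, op i}. b w (v j) = 0) \<longrightarrow> trv w d \<in> G" if "finite Q" for Q
    using that
  proof (induction Q rule: finite_induct)
    case empty
    show ?case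
    proof (intro allI impI)
      fix w assume w: "b w (v i) \<noteq> 0" "\<forall>j\<in>ix - {} - {i, op i}. b w (v j) = 0"
      \<comment> \<open>The multiple of \<open>v i\<close> added by this transvection cancels the
        pairing with \<open>v (op i)\<close>, which leaves a multiple of
        \<open>v (op i)\<close>.\<close>
      define t where "t = b w (v (op i)) / b w (v i)"
      have eq: "trv (v i) t w = scale (b w (v i)) (v (op i))"
      proof (rule eq_by_gram)
        fix j assume j: "j \<in> ix"
        consider "j = i" | "j = op i" | "j \<noteq> i" "j \<noteq> op i" by blast
        then show "b (trv (v i) t w) (v j) = b (scale (b w (v i)) (v (op i))) (v j)"
          by cases (use w i j in \<open>auto simp: trv_def gram t_def\<close>)
      qed
      have "trv (trv (v i) t w) d \<in> G"
        unfolding eq trv_scale using i by (intro trv_basis_G) simp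
      then show "trv w d \<in> G"
        using trv_conj_trv[of "v i" t w d] trv_basis_G[OF i(1)] G_comp by metis
    qed
  next
    case (insert j Q)
    show ?case
    proof (intro allI impI)
      fix w assume w: "b w (v i) \<noteq> 0" "\<forall>j\<in>ix - insert j Q - {i, op i}. b w (v j) = 0"
      show "trv w d \<in> G"
      proof (cases "j \<in> ix - {i, op i}")
        case False
        then have "ix - insert j Q - {i, op i} = ix - Q - {i, op i}" by auto
        then show ?thesis using insert.IH w by auto
      next
        case True
        \<comment> \<open>The summand along \<open>v (op j)\<close> cancels the pairing with
          \<open>v j\<close>. The summand along \<open>v i\<close> changes only the pairing with
          \<open>v (op i)\<close>, which is dealt with in the empty case.\<close>
        define t where "t = b w (v j) / b w (v i)"
        let ?e = "elt (v i) (v (op j)) t"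
        have oj: "op j \<in> ix" "i \<noteq> op j" "op j \<noteq> op i" using True i by (auto simp: op_eq_iff)
        have o: "b (v i) (v (op j)) = 0" using i oj by (simp add: gram)
        have e: "b (?e w) (v q) = b w (v q) + (if q = j then b w (v j) else 0) +
            (if q = op i then t * b w (v (op j)) else 0)" if "q \<in> ix" for q
          using i True that w(1) by (auto simp: elt_def gram t_def)
        have "trv (?e w) d \<in> G"
        proof (rule insert.IH[rule_format])
          show "b (?e w) (v i) \<noteq> 0" using e[OF i(1)] w True op_ne[OF i(1)] by simp
          fix q assume q: "q \<in> ix - Q - {i, op i}"
          then show "b (?e w) (v q) = 0" using e[of q] w(2) by (cases "q = j") auto
        qed
        then show ?thesis
          using trv_conj_elt[OF o, of t w d] elt_G[OF i(1) oj(1) oj(2) oj(3)] G_comp by metis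
      qed
    qed
  qed
  from this[of ix] i show ?thesis by auto
qed

section \<open>Isometries as products of transvections\<close>

lemma trv_lin: "lin (trv w a)"
  by (rule linI) (simp_all add: trv_def algebra_simps)

lemma trv_fix: "b f w = 0 \<Longrightarrow> trv w a f = f"
  by (simp add: trv_def)

text \<open>Since \<open>b x (x + y) = b x y\<close>, the normalised transvection along
  \<open>x + y\<close> adds exactly \<open>x + y\<close> to \<open>x\<close>.\<close>

lemma trv_move:
  assumes "b x y \<noteq> 0" shows "trv (x + y) (1 / b x y) x = y"
  using assms by (simp add: trv_def add.assoc[symmetric])

definition isom :: "('v \<Rightarrow> 'v) \<Rightarrow> bool" where
  "isom g \<longleftrightarrow> lin g \<and> (\<forall>x y. b (g x) (g y) = b x y)"

lemma isom_comp: "isom g \<Longrightarrow> isom h \<Longrightarrow> isom (g \<circ> h)"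
  by (auto simp: isom_def intro!: linI simp: lin_add lin_scale)

lemma isom_trv: "isom (trv w a)"
  by (simp add: isom_def trv_lin trv_b)

lemma trv_trv_cancel: "trv w a \<circ> (trv w a \<circ> g) = g"
  by (simp add: fun_eq_iff trv_trv)

lemma G_trv_cancel: "trv w a \<circ> g \<in> G \<Longrightarrow> g \<in> G"
  using G_comp[OF trv_G] trv_trv_cancel by metis

text \<open>Two transvections at most move \<open>g x\<close> back to \<open>x\<close>, and two more move the partner of \<open>x\<close>
  back; they are chosen to fix the hyperbolic pairs already fixed by \<open>g\<close>.\<close>

lemma move_pair:
  assumes g: "isom g" and F: "\<And>f. f \<in> F \<Longrightarrow> g f = f \<and> b f x = 0 \<and> b f y = 0" and xy: "b x y = 1"
    and step: "\<And>h. isom h \<Longrightarrow> (\<And>f. f \<in> insert x (insert y F) \<Longrightarrow> h f = f) \<Longrightarrow> h \<in> G"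
  shows "g \<in> G"
proof -
  have gF: "b f (g x) = 0" "b f (g y) = 0" if "f \<in> F" for f
    using g F[OF that] by (metis isom_def)+
  have gxy: "b (g x) (g y) = 1" using g xy by (simp add: isom_def)
  \<comment> \<open>Since \<open>b x (h y) = b x y = 1\<close>, the direction \<open>h y + y\<close>
    is orthogonal to \<open>x\<close>, so the transvection taking \<open>h y\<close> to
    \<open>y\<close> keeps \<open>x\<close>.\<close>
  have stepA: "h \<in> G" if h: "isom h" "\<And>f. f \<in> F \<Longrightarrow> h f = f" "h x = x" "b (h y) y \<noteq> 0" for h
  proof (rule G_trv_cancel)
    let ?T = "trv (h y + y) (1 / b (h y) y)"
    have bx: "b x (h y) = 1" using h(1,3) xy by (metis isom_def)
    show "?T \<circ> h \<in> G"
    proof (rule step)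
      show "isom (?T \<circ> h)" using isom_comp isom_trv h by blast
      fix f assume "f \<in> insert x (insert y F)"
      then consider "f = x" | "f = y" | "f \<in> F" by blast
      then show "(?T \<circ> h) f = f"
      proof cases
        case 1
        then show ?thesis using h bx xy by (simp add: trv_fix)
      next
        case 2
        then show ?thesis using trv_move[OF h(4)] by simp
      next
        case 3
        have "b f (h y) = 0" using h F[OF 3] 3 by (metis isom_def)
        then show ?thesis using h(2)[OF 3] F[OF 3] by (simp add: trv_fix)
      qed
    qed
  qed
  have stepB: "h \<in> G" if h: "isom h" "\<And>f. f \<in> F \<Longrightarrow> h f = f" "h x = x" for h
  proof (cases "b (h y) y = 0")
    case False
    then show ?thesis using stepA h by blast
  next
    case True
    have bx: "b x (h y) = 1" using h(1,3) xy by (metis isom_def)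
    show ?thesis
    proof (rule G_trv_cancel)
      \<comment> \<open>This transvection keeps \<open>x\<close> and \<open>F\<close> and adds
        \<open>x\<close> to \<open>h y\<close>, which makes the pairing with \<open>y\<close> equal
        to 1.\<close>
      show "trv x 1 \<circ> h \<in> G"
      proof (rule stepA)
        show "isom (trv x 1 \<circ> h)" using isom_comp isom_trv h by blast
        show "(trv x 1 \<circ> h) x = x" using h by (simp add: trv_fix)
        show "(trv x 1 \<circ> h) f = f" if "f \<in> F" for f using h(2) F that by (simp add: trv_fix)
        show "b ((trv x 1 \<circ> h) y) y \<noteq> 0"
          using True bx b_sym[of x "h y"] xy by (simp add: trv_def)
      qed
    qed
  qed
  have stepC: "h \<in> G" if h: "isom h" "\<And>f. f \<in> F \<Longrightarrow> h f = f" "b (h x) x \<noteq> 0" for h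
  proof (rule G_trv_cancel)
    let ?T = "trv (h x + x) (1 / b (h x) x)"
    show "?T \<circ> h \<in> G"
    proof (rule stepB)
      show "isom (?T \<circ> h)" using isom_comp isom_trv h by blast
      show "(?T \<circ> h) x = x" using trv_move[OF h(3)] by simp
      fix f assume f: "f \<in> F"
      have "b f (h x) = 0" using h F[OF f] f by (metis isom_def)
      then show "(?T \<circ> h) f = f" using h(2)[OF f] F[OF f] by (simp add: trv_fix)
    qed
  qed
  show ?thesis
  proof (cases "b (g x) x = 0")
    case False
    then show ?thesis using stepC g F by blast
  next
    case True
    \<comment> \<open>When \<open>g x\<close> and \<open>x\<close> are orthogonal,
      \<open>trv_move\<close> does not apply to them, so the way leads through a \<open>z\<close>
      orthogonal to neither: one of \<open>y\<close>, \<open>g y\<close> and \<open>y + g y\<close>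
      works.\<close>
    have "\<exists>z. b (g x) z \<noteq> 0 \<and> b z x \<noteq> 0 \<and> (\<forall>f\<in>F. b f z = 0)"
    proof -
      consider "b (g x) y \<noteq> 0" | "b x (g y) \<noteq> 0" | "b (g x) y = 0" "b x (g y) = 0" by blast
      then show ?thesis
      proof cases
        case 1
        then show ?thesis using xy F b_sym[of x y] by (intro exI[of _ y]) auto
      next
        case 2
        then show ?thesis using gxy gF b_sym[of x "g y"] by (intro exI[of _ "g y"]) auto
      next
        case 3
        then show ?thesis using xy gxy F gF b_sym[of x "g y"] b_sym[of x y]
          by (intro exI[of _ "y + g y"]) auto
      qed
    qed
    then obtain z where z: "b (g x) z \<noteq> 0" "b z x \<noteq> 0" "\<And>f. f \<in> F \<Longrightarrow> b f z = 0" by blast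
    let ?T = "trv (g x + z) (1 / b (g x) z)"
    show ?thesis
    proof (rule G_trv_cancel)
      show "?T \<circ> g \<in> G"
      proof (rule stepC)
        show "isom (?T \<circ> g)" using isom_comp isom_trv g by blast
        show "b ((?T \<circ> g) x) x \<noteq> 0" using trv_move[OF z(1)] z(2) by simp
        fix f assume f: "f \<in> F"
        then show "(?T \<circ> g) f = f" using F[OF f] gF[OF f] z(3)[OF f] by (simp add: trv_fix)
      qed
    qed
  qed
qed

text \<open>The hyperbolic pairs are restored from the index \<open>l\<close> downwards:
  \<open>m\<close> counts those that \<open>g\<close> may still move, and an isometry moving none is
  the identity.\<close>

lemma isom_G:
  assumes "isom g" shows "g \<in> G"
proof -
  have "\<forall>g. isom g \<longrightarrow> (\<forall>i\<in>{m<..l}. g (v i) = v i \<and> g (v (op i)) = v (op i)) \<longrightarrow> g \<in> G" if "m \<le> l" for m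
    using that
  proof (induction m)
    case 0
    show ?case
    proof (intro allI impI)
      fix g assume g: "isom g" "\<forall>i\<in>{0<..l}. g (v i) = v i \<and> g (v (op i)) = v (op i)"
      have "g = id"
      proof (rule lin_eq_on_basis)
        show "lin g" using g by (simp add: isom_def)
        show "lin id" by (rule linI) auto
        fix i assume i: "i \<in> ix"
        show "g (v i) = id (v i)"
        proof (cases "i \<le> l")
          case True
          then show ?thesis using g i by (auto simp: ix_def)
        next
          case False
          then have "op i \<in> {0<..l}" using i by (auto simp: op_def ix_def)
          then show ?thesis using g(2) op_op[OF i] by fastforce
        qed
      qed
      then show "g \<in> G" using G_id by simp
    qed
  next
    case (Suc m)
    show ?case
    proof (intro allI impI)
      fix g assume g: "isom g" "\<forall>i\<in>{Suc m<..l}. g (v i) = v i \<and> g (v (op i)) = v (op i)"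
      let ?F = "v ` {Suc m<..l} \<union> (v \<circ> op) ` {Suc m<..l}"
      note o = op_def ix_def
      show "g \<in> G"
      proof (rule move_pair[OF g(1)])
        show "b (v (Suc m)) (v (op (Suc m))) = 1" using Suc.prems by (simp add: gram o)
        show "g f = f \<and> b f (v (Suc m)) = 0 \<and> b f (v (op (Suc m))) = 0" if "f \<in> ?F" for f
        proof -
          obtain i where i: "i \<in> {Suc m<..l}" "f = v i \<or> f = v (op i)" using \<open>f \<in> ?F\<close> by auto
          have "i \<in> ix" "Suc m \<in> ix" "op i \<noteq> op (Suc m)" "op i \<noteq> Suc m"
            using i(1) by (auto simp: o)
          then show ?thesis using i g(2) by (auto simp: gram op_eq_iff)
        qed
        fix h assume h: "isom h" "\<And>f. f \<in> insert (v (Suc m)) (insert (v (op (Suc m))) ?F) \<Longrightarrow> h f = f"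
        have "h (v i) = v i \<and> h (v (op i)) = v (op i)" if "i \<in> {m<..l}" for i
          using that h(2)[of "v i"] h(2)[of "v (op i)"] by (cases "i = Suc m") auto
        then show "h \<in> G" using Suc h by auto
      qed
    qed
  qed
  from this[of l] assms show ?thesis by auto
qed

end

context symplectic_char2
begin

section \<open>Similitude Lie algebra elements commuting with \<open>u\<close> up to scalars\<close>

definition gsp :: "'k \<Rightarrow> ('v \<Rightarrow> 'v) \<Rightarrow> bool" where
  "gsp \<mu> X \<longleftrightarrow> lin X \<and> (\<forall>x y. b (X x) y + b x (X y) = \<mu> * b x y)"

lemma spanning_induct:
  assumes "span S = UNIV" "P 0" "\<And>x y. P x \<Longrightarrow> P y \<Longrightarrow> P (x + y)" "\<And>c x. P x \<Longrightarrow> P (scale c x)"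
    and "\<And>x. x \<in> S \<Longrightarrow> P x"
  shows "P x"
proof -
  have "x \<in> span S" using assms(1) by simp
  then show ?thesis
  proof (induction rule: span_induct_alt)
    case (step c y z)
    then show ?case using assms(3-5) by auto
  qed (rule assms(2))
qed

lemma gsp_spanning:
  assumes S: "span S = UNIV" and X: "lin X"
    and base: "\<And>x y. x \<in> S \<Longrightarrow> y \<in> S \<Longrightarrow> b (X x) y + b x (X y) = \<mu> * b x y"
  shows "gsp \<mu> X"
proof -
  have "b (X x) y + b x (X y) = \<mu> * b x y" for x y
  proof (induction x rule: spanning_induct[OF S])
    case (4 x)
    show ?case
    proof (induction y rule: spanning_induct[OF S])
      case (4 y)
      then show ?case using base \<open>x \<in> S\<close> by auto
    next
      case (2 y z)
      have "b (X x) (y + z) + b x (X (y + z)) = (b (X x) y + b x (X y)) + (b (X x) z + b x (X z))"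
        by (simp add: lin_add[OF X] add_ac)
      then show ?case unfolding 2 by (simp add: distrib_left)
    next
      case (3 a y)
      have "b (X x) (scale a y) + b x (X (scale a y)) = a * (b (X x) y + b x (X y))"
        by (simp add: lin_scale[OF X] distrib_left)
      then show ?case unfolding 3 by simp
    qed (simp add: lin_zero[OF X])
  next
    case (2 x z)
    have "b (X (x + z)) y + b (x + z) (X y) = (b (X x) y + b x (X y)) + (b (X z) y + b z (X y))"
      by (simp add: lin_add[OF X] add_ac)
    then show ?case unfolding 2 by (simp add: distrib_left)
  next
    case (3 a x)
    have "b (X (scale a x)) y + b (scale a x) (X y) = a * (b (X x) y + b x (X y))"
      by (simp add: lin_scale[OF X] distrib_left)
    then show ?case unfolding 3 by simp
  qed (simp add: lin_zero[OF X])
  then show ?thesis using X by (simp add: gsp_def)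
qed

text \<open>For invertible \<open>u\<close> this says \<open>u X u^-1 = X + c\<close>:
  \<open>X\<close> is fixed by \<open>u\<close> modulo scalars.\<close>

definition qcomm :: "('v \<Rightarrow> 'v) \<Rightarrow> 'k \<Rightarrow> ('v \<Rightarrow> 'v) \<Rightarrow> bool" where
  "qcomm u c X \<longleftrightarrow> (\<forall>x. u (X x) = X (u x) + scale c (u x))"

section \<open>Powers of u - 1 and the constraints they impose on a block\<close>

definition nil :: "('v \<Rightarrow> 'v) \<Rightarrow> 'v \<Rightarrow> 'v" where "nil u x = u x + x"

lemma lin_nil: "lin u \<Longrightarrow> lin (nil u)"
  by (rule linI) (simp_all add: nil_def lin_add lin_scale algebra_simps)

lemma lin_pow: "lin f \<Longrightarrow> lin (f ^^ i)"
  by (induction i) (auto intro!: linI simp: lin_add lin_scale)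

lemma nil_pow_u:
  assumes "lin u" shows "(nil u ^^ i) (u x) = u ((nil u ^^ i) x)"
  using assms by (induction i) (simp_all add: nil_def lin_add)

text \<open>One step is b(n x, y) = b(u x, y) + b(u x, u y) = b(u x, n y). Powers of n thus move to
  the second argument at the cost of powers of \<open>u\<close> in the first.\<close>

lemma nil_pow_adj:
  assumes "isom u"
  shows "b ((nil u ^^ i) x) y = b ((u ^^ i) x) ((nil u ^^ i) y)"
proof (induction i arbitrary: x y)
  case (Suc i)
  have lu: "lin u" and iu: "b (u x) (u y) = b x y" for x y using assms by (auto simp: isom_def)
  have "(nil u ^^ Suc i) x = (nil u ^^ i) (u x) + (nil u ^^ i) x"
    by (simp add: funpow_swap1 nil_def[of u x] lin_add[OF lin_pow[OF lin_nil[OF lu]]])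
  then have "b ((nil u ^^ Suc i) x) y = b ((u ^^ i) (u x)) ((nil u ^^ i) y) + b ((u ^^ i) x) ((nil u ^^ i) y)"
    by (simp only: b_add_left Suc)
  also have "\<dots> = b ((u ^^ Suc i) x) ((nil u ^^ Suc i) y)"
    using iu[of "(u ^^ i) x" "(nil u ^^ i) y"] by (simp add: funpow_swap1[symmetric] nil_def[of u "(nil u ^^ i) y"])
  finally show ?case .
qed simp

text \<open>For one factor n X = X n + c u. As n commutes with \<open>u\<close>, every further
  factor contributes the same correction once more, and the number of factors matters modulo
  two.\<close>

lemma nil_pow_qcomm:
  assumes "lin u" "lin X" "qcomm u c X"
  shows "(nil u ^^ Suc i) (X x) = X ((nil u ^^ Suc i) x) + scale (of_nat (Suc i) * c) ((nil u ^^ i) (u x))"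
proof -
  have n1: "nil u (X y) = X (nil u y) + scale c (u y)" for y
    using assms by (simp add: nil_def qcomm_def lin_add algebra_simps)
  show ?thesis
  proof (induction i)
    case 0
    show ?case using n1 by simp
  next
    case (Suc i)
    have "(nil u ^^ Suc (Suc i)) (X x) = nil u ((nil u ^^ Suc i) (X x))" by simp
    also have "\<dots> = nil u (X ((nil u ^^ Suc i) x)) + scale (of_nat (Suc i) * c) ((nil u ^^ Suc i) (u x))"
      unfolding Suc by (simp add: lin_add[OF lin_nil] lin_scale[OF lin_nil] assms(1))
    also have "\<dots> = X ((nil u ^^ Suc (Suc i)) x) + scale c ((nil u ^^ Suc i) (u x))
        + scale (of_nat (Suc i) * c) ((nil u ^^ Suc i) (u x))"
      unfolding n1 nil_pow_u[OF assms(1)] by simp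
    also have "\<dots> = X ((nil u ^^ Suc (Suc i)) x) + scale (of_nat (Suc (Suc i)) * c) ((nil u ^^ Suc i) (u x))"
      by (simp only: add.assoc scale_left_distrib[symmetric]) (simp add: distrib_right)
    finally show ?case .
  qed
qed

definition W_act :: "('v \<Rightarrow> 'v) \<Rightarrow> nat \<Rightarrow> (nat \<Rightarrow> 'v) \<Rightarrow> bool" where
  "W_act u m e \<longleftrightarrow> u (e 1) = e 1 \<and> (\<forall>i. 1 < i \<and> i \<le> m \<longrightarrow> u (e i) = (\<Sum>j=1..i. e j)) \<and>
     u (e (m + 1)) = e (m + 1) \<and> (\<forall>i. m + 1 < i \<and> i \<le> 2 * m \<longrightarrow> u (e i) = e i + e (i - 1))"

definition V_act :: "('v \<Rightarrow> 'v) \<Rightarrow> nat \<Rightarrow> (nat \<Rightarrow> 'v) \<Rightarrow> bool" where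
  "V_act u m e \<longleftrightarrow> u (e 1) = e 1 \<and> (\<forall>i. 1 < i \<and> i \<le> m + 1 \<longrightarrow> u (e i) = (\<Sum>j=1..i. e j)) \<and>
     (\<forall>i. m + 1 < i \<and> i \<le> 2 * m \<longrightarrow> u (e i) = e i + e (i - 1))"

lemma u_head:
  fixes e :: "nat \<Rightarrow> 'v"
  assumes "u (e 1) = e 1" "\<forall>i. 1 < i \<and> i \<le> m \<longrightarrow> u (e i) = (\<Sum>j=1..i. e j)"
    and "1 \<le> i" "i \<le> m"
  shows "u (e i) = (\<Sum>j=1..i. e j)"
  using assms by (cases "i = 1") auto

lemma nil_head:
  fixes e :: "nat \<Rightarrow> 'v"
  assumes "u (e i) = (\<Sum>j=1..i. e j)" "1 \<le> i"
  shows "nil u (e i) = (\<Sum>j\<in>{1..<i}. e j)"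
proof -
  have "{1..i} = insert i {1..<i}" using assms(2) by auto
  then show ?thesis using assms(1) by (simp add: nil_def add.commute add.left_commute)
qed

text \<open>Each application of n lowers the index strictly. The coefficients \<open>a\<close> are
  general so that full sums and single predecessors are both covered.\<close>

lemma nil_pow_zero:
  assumes "lin u" "\<And>i. 1 \<le> i \<Longrightarrow> i \<le> m \<Longrightarrow> nil u (e i) = (\<Sum>j\<in>{1..<i}. scale (a i j) (e j))"
    and "1 \<le> i" "i \<le> m" "i \<le> r"
  shows "(nil u ^^ r) (e i) = 0"
  using assms(3-5)
proof (induction r arbitrary: i)
  case (Suc r)
  have "(nil u ^^ Suc r) (e i) = (nil u ^^ r) (nil u (e i))" by (simp add: funpow_swap1)
  also have "\<dots> = (\<Sum>j\<in>{1..<i}. scale (a i j) ((nil u ^^ r) (e j)))"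
    using assms(2)[OF Suc.prems(1,2)] lin_pow[OF lin_nil[OF assms(1)]] by (simp add: lin_sum lin_scale)
  also have "\<dots> = 0" using Suc by (intro sum.neutral) auto
  finally show ?case .
qed simp

text \<open>Pairing \<open>n\<^sup>m X - X n\<^sup>m = m c n\<^sup>m\<^sup>-\<^sup>1 u\<close> with \<open>e\<^sub>m\<close>, where \<open>n = u - 1\<close> and \<open>n\<^sup>m\<close> kills \<open>W(m)\<close>.\<close>

lemma W_obstruction:
  assumes u: "isom u" and X: "lin X" "qcomm u c X"
    and e: "antidiag_gram b (2 * m) e" "W_act u m e" and m: "odd m"
  shows "c = 0"
proof -
  have lu: "lin u" using u by (simp add: isom_def)
  obtain i where i: "m = Suc i" using m by (cases m) auto
  have low: "(nil u ^^ m) (e m) = 0"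
  proof (rule nil_pow_zero[OF lu, where m = m and a = "\<lambda>_ _. 1"])
    fix i assume "1 \<le> i" "i \<le> m"
    then show "nil u (e i) = (\<Sum>j\<in>{1..<i}. scale 1 (e j))"
      using nil_head[of u e i] u_head[of u e m i] e(2) by (simp add: W_act_def)
  qed (use i in auto)
  have top: "(nil u ^^ r) (e (2 * m)) = e (2 * m - r)" if "r < m" for r
    using that
  proof (induction r)
    case (Suc r)
    have "nil u (e (2 * m - r)) = e (2 * m - r - 1)"
      using e(2) Suc.prems by (simp add: W_act_def nil_def add_ac)
    then show ?case using Suc by simp
  qed simp
  have um: "u (e (Suc m)) = e (Suc m)" using e(2) by (simp add: W_act_def)
  have "2 * m - i = Suc m" using i by simp
  then have ti: "(nil u ^^ i) (e (2 * m)) = e (Suc m)" using top[of i] i by simp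
  then have tm: "(nil u ^^ m) (e (2 * m)) = 0" using i um by (simp add: nil_def)
  \<comment> \<open>The second half is one chain from \<open>e (2 * m)\<close> down to
    \<open>e (Suc m)\<close>, the partner of \<open>e m\<close>; n^m kills it, so only the
    correction term of \<open>nil_pow_qcomm\<close> remains.\<close>
  have "(nil u ^^ m) (X (e (2 * m))) = scale (of_nat m * c) (e (Suc m))"
    using nil_pow_qcomm[OF lu X, of i "e (2 * m)"] tm ti um unfolding i[symmetric]
    by (simp add: nil_pow_u[OF lu] lin_zero[OF X(1)])
  moreover have "b ((nil u ^^ m) (X (e (2 * m)))) (e m) = 0"
    using nil_pow_adj[OF u] low by simp
  moreover have "b (e (Suc m)) (e m) = 1" using e(1) i by (simp add: antidiag_gram_def)
  ultimately show ?thesis using m by (simp add: of_nat_K)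
qed

lemma V_nil:
  assumes "V_act u k e" "1 \<le> i" "i \<le> 2 * k"
  shows "nil u (e i) = (\<Sum>j\<in>{1..<i}. scale (if i \<le> k + 1 \<or> j = i - 1 then 1 else 0) (e j))"
proof (cases "i \<le> k + 1")
  case True
  then show ?thesis
    using nil_head[of u e i] u_head[of u e "k + 1" i] assms by (simp add: V_act_def)
next
  case False
  have "(\<Sum>j\<in>{1..<i}. scale (if i \<le> k + 1 \<or> j = i - 1 then 1 else 0) (e j))
      = (\<Sum>j\<in>{1..<i}. if j = i - 1 then e j else 0)"
    using False by (intro sum.cong) auto
  also have "\<dots> = e (i - 1)" using False by (subst sum.delta) auto
  finally show ?thesis
    using False assms by (simp add: V_act_def nil_def add_ac)
qed

text \<open>As n^(2k-1) maps \<open>e (2 * k)\<close> to \<open>e 1\<close>, which \<open>u\<close>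
  fixes, \<open>nil_pow_adj\<close> identifies b(X e_2k, e_1) with b(n^(2k-1) X e_2k, e_2k).
  Commuting the power past \<open>X\<close> turns the latter into b(X e_1, e_2k) + k c, and the two
  terms with \<open>X\<close> add up to \<open>\<mu>\<close>.\<close>

lemma V_obstruction:
  assumes u: "isom u" and X: "gsp \<mu> X" "qcomm u c X"
    and e: "antidiag_gram b (2 * k) e" "V_act u k e" and k: "1 \<le> k"
  shows "\<mu> = of_nat k * c"
proof -
  have lu: "lin u" and lX: "lin X" using u X by (auto simp: isom_def gsp_def)
  note n = V_nil[OF e(2)]
  note zero = nil_pow_zero[OF lu n]
  have lp: "lin (nil u ^^ r)" for r using lin_pow lin_nil lu by blast
  have one: "(nil u ^^ j) (e (Suc j)) = e 1" if "Suc j \<le> 2 * k" for j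
    using that
  proof (induction j)
    case (Suc j)
    let ?a = "\<lambda>i. if Suc (Suc j) \<le> k + 1 \<or> i = Suc (Suc j) - 1 then 1 else 0 :: 'k"
    have nn: "nil u (e (Suc (Suc j))) = (\<Sum>i\<in>{1..<Suc (Suc j)}. scale (?a i) (e i))"
      by (rule n) (use Suc.prems in auto)
    have "(nil u ^^ Suc j) (e (Suc (Suc j))) = (nil u ^^ j) (nil u (e (Suc (Suc j))))"
      by (simp add: funpow_swap1)
    also have "\<dots> = (\<Sum>i\<in>{1..<Suc (Suc j)}. scale (?a i) ((nil u ^^ j) (e i)))"
      unfolding nn lin_sum[OF lp] lin_scale[OF lp] ..
    also have "{1..<Suc (Suc j)} = insert (Suc j) {1..<Suc j}" by auto
    also have "(\<Sum>i\<in>insert (Suc j) {1..<Suc j}. scale (?a i) ((nil u ^^ j) (e i)))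
        = (nil u ^^ j) (e (Suc j)) + (\<Sum>i\<in>{1..<Suc j}. scale (?a i) ((nil u ^^ j) (e i)))"
      by simp
    also have "(\<Sum>i\<in>{1..<Suc j}. scale (?a i) ((nil u ^^ j) (e i))) = 0"
      using Suc.prems by (intro sum.neutral) (auto simp: zero)
    finally show ?case using Suc by simp
  qed simp
  \<comment> \<open>Every index i with 3 \<le> i \<le> k + 1 on the way down is mapped by n to a
    full sum, whose term \<open>e (i - 2)\<close> ends in one extra \<open>e 1\<close>. Above k + 1
    there is no such term, whence the minimum.\<close>
  have two: "(nil u ^^ j) (e (j + 2)) = e 2 + scale (of_nat (min j (k - 1))) (e 1)" if "j + 2 \<le> 2 * k" for j
    using that
  proof (induction j)
    case (Suc j)
    let ?a = "\<lambda>i. if Suc j + 2 \<le> k + 1 \<or> i = Suc j + 2 - 1 then 1 else 0 :: 'k"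
    have nn: "nil u (e (Suc j + 2)) = (\<Sum>i\<in>{1..<Suc j + 2}. scale (?a i) (e i))"
      by (rule n) (use Suc.prems in auto)
    have "(nil u ^^ Suc j) (e (Suc j + 2)) = (nil u ^^ j) (nil u (e (Suc j + 2)))"
      by (simp add: funpow_swap1)
    also have "\<dots> = (\<Sum>i\<in>{1..<Suc j + 2}. scale (?a i) ((nil u ^^ j) (e i)))"
      unfolding nn lin_sum[OF lp] lin_scale[OF lp] ..
    also have "{1..<Suc j + 2} = insert (j + 2) (insert (Suc j) {1..<Suc j})" by auto
    also have "(\<Sum>i\<in>insert (j + 2) (insert (Suc j) {1..<Suc j}). scale (?a i) ((nil u ^^ j) (e i)))
        = (nil u ^^ j) (e (j + 2)) + (scale (?a (Suc j)) ((nil u ^^ j) (e (Suc j)))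
          + (\<Sum>i\<in>{1..<Suc j}. scale (?a i) ((nil u ^^ j) (e i))))"
      by simp
    also have "(\<Sum>i\<in>{1..<Suc j}. scale (?a i) ((nil u ^^ j) (e i))) = 0"
      using Suc.prems by (intro sum.neutral) (auto simp: zero)
    also have "(nil u ^^ j) (e (Suc j)) = e 1" using one[of j] Suc.prems by simp
    also have "(nil u ^^ j) (e (j + 2)) = e 2 + scale (of_nat (min j (k - 1))) (e 1)"
      using Suc by simp
    also have "e 2 + scale (of_nat (min j (k - 1))) (e 1) + (scale (?a (Suc j)) (e 1) + 0)
      = e 2 + scale (of_nat (min j (k - 1)) + ?a (Suc j)) (e 1)"
      by (simp add: scale_left_distrib add.assoc)
    also have "of_nat (min j (k - 1)) + ?a (Suc j) = (of_nat (min (Suc j) (k - 1)) :: 'k)"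
    proof (cases "Suc j \<le> k - 1")
      case True
      then show ?thesis by (simp add: min_def add.commute)
    next
      case False
      then have "min j (k - 1) = k - 1" "min (Suc j) (k - 1) = k - 1" "\<not> Suc j + 2 \<le> k + 1" by auto
      then show ?thesis by simp
    qed
    finally show ?case .
  qed (simp add: numeral_2_eq_2)
  define j where "j = 2 * k - 2"
  have j: "2 * k = j + 2" "even j" using k by (auto simp: j_def)
  have u1: "u (e 1) = e 1" using e(2) by (simp add: V_act_def)
  have u2: "u (e 2) = e 1 + e 2" 
    using e(2) k by (simp add: V_act_def numeral_2_eq_2)
  have mj: "min j (k - 1) = k - 1" using k j by simp
  have gk: "(of_nat (k - 1) :: 'k) + 1 = of_nat k" 
    using k by (cases k) (simp_all add: add.commute)
  \<comment> \<open>The exponent is \<open>2 * k - 1\<close>, so the factor in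
    \<open>nil_pow_qcomm\<close> is odd.\<close>
  have ofj: "(of_nat (Suc j) :: 'k) = 1" using j by (simp add: of_nat_K)
  have "(nil u ^^ Suc j) (X (e (j + 2))) = X (e 1) + scale c (u (e 2 + scale (of_nat (k - 1)) (e 1)))"
    using nil_pow_qcomm[OF lu lX X(2), of j "e (j + 2)"] one[of "Suc j"] two[of j] j(1)
    unfolding ofj mj nil_pow_u[OF lu] by (simp del: funpow.simps)
  also have "u (e 2 + scale (of_nat (k - 1)) (e 1)) = e 2 + scale (of_nat (k - 1) + 1) (e 1)"
    using u1 u2 by (simp add: lin_add[OF lu] lin_scale[OF lu] scale_left_distrib add_ac)
  finally have N: "(nil u ^^ Suc j) (X (e (j + 2))) = X (e 1) + scale c (e 2 + scale (of_nat k) (e 1))"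
    unfolding gk .
  have up: "(u ^^ r) (e 1) = e 1" for r using u1 by (induction r) simp_all
  have isop: "b ((u ^^ r) x) ((u ^^ r) y) = b x y" for r x y
    using u by (induction r) (simp_all add: isom_def)
  have g: "b (e 1) (e (j + 2)) = 1" "b (e 2) (e (j + 2)) = 0"
    using e(1) j k by (auto simp: antidiag_gram_def)
  have "b (X (e (j + 2))) (e 1) = b ((nil u ^^ Suc j) (X (e (j + 2)))) (e (j + 2))"
    unfolding nil_pow_adj[OF u] using one[of "Suc j"] j isop[of "Suc j" _ "e 1"] up by (simp del: funpow.simps)
  also have "\<dots> = b (X (e 1)) (e (j + 2)) + c * of_nat k"
    unfolding N using g by simp
  finally have "b (e 1) (X (e (j + 2))) = b (X (e 1)) (e (j + 2)) + c * of_nat k"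
    using b_sym by metis
  moreover have "b (X (e 1)) (e (j + 2)) + b (e 1) (X (e (j + 2))) = \<mu> * b (e 1) (e (j + 2))"
    using X(1) unfolding gsp_def by blast
  ultimately show ?thesis using g by (simp add: mult.commute)
qed

subsection \<open>Constructions on the blocks\<close>

text \<open>\<open>d p\<close> is half the dimension of block \<open>p\<close>. Orthogonality
  between blocks and the Gram matrix within them form one condition, which exhibits a dual
  basis.\<close>

definition blocks :: "'i set \<Rightarrow> ('i \<Rightarrow> nat) \<Rightarrow> ('i \<Rightarrow> nat \<Rightarrow> 'v) \<Rightarrow> bool" where
  "blocks I d e \<longleftrightarrow> finite I \<and>
     (\<forall>p\<in>I. \<forall>i\<in>{1..2 * d p}. \<forall>q\<in>I. \<forall>j\<in>{1..2 * d q}.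
        b (e p i) (e q j) = (if p = q \<and> i + j = 2 * d p + 1 then 1 else 0)) \<and>
     span (\<Union>p\<in>I. e p ` {1..2 * d p}) = UNIV"

lemma blocks_gram:
  "blocks I d e \<Longrightarrow> p \<in> I \<Longrightarrow> q \<in> I \<Longrightarrow> 1 \<le> i \<Longrightarrow> i \<le> 2 * d p \<Longrightarrow> 1 \<le> j \<Longrightarrow> j \<le> 2 * d q \<Longrightarrow>
    b (e p i) (e q j) = (if p = q \<and> i + j = 2 * d p + 1 then 1 else 0)"
  by (auto simp: blocks_def)

text \<open>\<open>e p (2 * d p + 1 - i)\<close> is dual to \<open>e p i\<close>, so the map can be
  written down by pairing with the dual basis.\<close>

lemma blocks_extend:
  assumes "blocks I d e"
  obtains X where "lin X" "\<And>p i. p \<in> I \<Longrightarrow> 1 \<le> i \<Longrightarrow> i \<le> 2 * d p \<Longrightarrow> X (e p i) = f p i"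
proof
  let ?P = "SIGMA p:I. {1..2 * d p}"
  let ?X = "\<lambda>x. \<Sum>(p, i)\<in>?P. scale (b x (e p (2 * d p + 1 - i))) (f p i)"
  show "lin ?X"
    by (rule linI) (simp_all add: case_prod_unfold scale_left_distrib sum.distrib scale_sum_right)
  fix q j assume q: "q \<in> I" "1 \<le> j" "j \<le> 2 * d q"
  have fin: "finite ?P" using assms by (auto simp: blocks_def)
  have "?X (e q j) = (\<Sum>r\<in>?P. if r = (q, j) then f q j else 0)"
  proof (intro sum.cong refl)
    fix r assume r: "r \<in> ?P"
    obtain p i where pi: "r = (p, i)" by force
    have "b (e q j) (e p (2 * d p + 1 - i)) = (if p = q \<and> i = j then 1 else 0)"
      using r pi q blocks_gram[OF assms, of q p j "2 * d p + 1 - i"] by auto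
    then show "(case r of (p, i) \<Rightarrow> scale (b (e q j) (e p (2 * d p + 1 - i))) (f p i)) =
        (if r = (q, j) then f q j else 0)" using pi by simp
  qed
  also have "\<dots> = f q j" using fin q by simp
  finally show "?X (e q j) = f q j" .
qed

text \<open>In a block the shift coefficients \<open>\<phi>\<close> meet when i + j = 2d and must
  cancel, while the diagonal coefficients \<open>\<psi>\<close> meet when i + j = 2d + 1 and must
  add up to \<open>\<mu>\<close>. At the last index \<open>\<phi>\<close> is zero because
  \<open>e p (2 * d p + 1)\<close> lies outside the block.\<close>

lemma blocks_gsp:
  assumes bl: "blocks I d e" and X: "lin X"
    and Xe: "\<And>p i. p \<in> I \<Longrightarrow> 1 \<le> i \<Longrightarrow> i \<le> 2 * d p \<Longrightarrow>
      X (e p i) = scale (\<phi> p i) (e p (i + 1)) + scale (\<psi> p i) (e p i)"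
    and \<phi>: "\<And>p. p \<in> I \<Longrightarrow> \<phi> p (2 * d p) = 0"
      "\<And>p i j. p \<in> I \<Longrightarrow> 1 \<le> i \<Longrightarrow> 1 \<le> j \<Longrightarrow> i + j = 2 * d p \<Longrightarrow> \<phi> p i = \<phi> p j"
    and \<psi>: "\<And>p i j. p \<in> I \<Longrightarrow> 1 \<le> i \<Longrightarrow> 1 \<le> j \<Longrightarrow> i + j = 2 * d p + 1 \<Longrightarrow> \<psi> p i + \<psi> p j = \<mu>"
  shows "gsp \<mu> X"
proof -
  have left: "b (X (e p i)) (e q j) = (if p = q \<and> i + j = 2 * d p then \<phi> p i else 0)
      + (if p = q \<and> i + j = 2 * d p + 1 then \<psi> p i else 0)"
    if "p \<in> I" "q \<in> I" "1 \<le> i" "i \<le> 2 * d p" "1 \<le> j" "j \<le> 2 * d q" for p q i j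
  proof (cases "i = 2 * d p")
    case True
    then show ?thesis using that \<phi>(1) by (auto simp: Xe blocks_gram[OF bl])
  next
    case False
    then show ?thesis using that by (auto simp: Xe blocks_gram[OF bl])
  qed
  have base: "b (X (e p i)) (e q j) + b (e p i) (X (e q j)) = \<mu> * b (e p i) (e q j)"
    if pq: "p \<in> I" "q \<in> I" "1 \<le> i" "i \<le> 2 * d p" "1 \<le> j" "j \<le> 2 * d q" for p q i j
  proof -
    have "b (e p i) (X (e q j)) = b (X (e q j)) (e p i)" by (rule b_sym)
    then show ?thesis using left[OF pq] left[of q p j i] pq \<phi>(2)[of p i j] \<psi>[of p i j]
      by (auto simp: blocks_gram[OF bl] add.commute)
  qed
  show ?thesis
  proof (rule gsp_spanning[OF _ X])
    show "span (\<Union>p\<in>I. e p ` {1..2 * d p}) = UNIV" using bl by (simp add: blocks_def)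
  qed (use base in auto)
qed

lemma blocks_qcomm:
  assumes bl: "blocks I d e" and X: "lin X" and u: "lin u"
    and base: "\<And>p i. p \<in> I \<Longrightarrow> 1 \<le> i \<Longrightarrow> i \<le> 2 * d p \<Longrightarrow> u (X (e p i)) = X (u (e p i)) + scale c (u (e p i))"
  shows "qcomm u c X"
proof -
  have sp: "span (\<Union>p\<in>I. e p ` {1..2 * d p}) = UNIV" using bl by (simp add: blocks_def)
  have "u (X x) = X (u x) + scale c (u x)" for x
  proof (induction x rule: spanning_induct[OF sp])
    case (4 x)
    then show ?case using base by auto
  qed (simp_all add: lin_zero lin_add lin_scale X u scale_right_distrib add_ac mult.commute)
  then show ?thesis by (simp add: qcomm_def)
qed

text \<open>Both halves of the basis of W(m) span \<open>u\<close>-invariant subspaces, so the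
  projection onto one along the other commutes with \<open>u\<close>.\<close>

lemma W_projection_qcomm:
  assumes "W_act u m e" "lin X" "lin u"
    and X: "\<And>i. 1 \<le> i \<Longrightarrow> i \<le> 2 * m \<Longrightarrow> X (e i) = (if i \<le> m then e i else 0)"
    and i: "1 \<le> i" "i \<le> 2 * m"
  shows "u (X (e i)) = X (u (e i))"
proof -
  consider "i \<le> m" | "i = m + 1" | "i > m + 1" by linarith
  then show ?thesis
  proof cases
    case 1
    then have "u (e i) = (\<Sum>j=1..i. e j)" using assms(1) i u_head[of u e m i] by (simp add: W_act_def)
    then show ?thesis using 1 i X by (simp add: lin_sum[OF assms(2)])
  next
    case 2
    then show ?thesis using assms(1) X i lin_zero[OF assms(3)] by (auto simp: W_act_def)
  next
    case 3
    then show ?thesis using assms(1) X i lin_zero[OF assms(3)] 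
      by (auto simp: W_act_def lin_add[OF assms(2)])
  qed
qed

text \<open>If \<open>n e\<^sub>i = e\<^sub>i\<^sub>-\<^sub>1\<close> and \<open>D e\<^sub>i = i e\<^sub>i\<^sub>+\<^sub>1\<close>, then \<open>n D - D n = 1\<close> on a block of even size, so
  \<open>X = D (1 + n)\<close> solves \<open>u X = (X + 1) u\<close> for \<open>u = 1 + n\<close>. The formula for \<open>X (e i)\<close> is \<open>D (1 + n)\<close> on
  the second half of the basis and its adjoint on the first half.\<close>

lemma head_telescope:
  assumes X: "\<And>i. 1 \<le> i \<Longrightarrow> i \<le> m \<Longrightarrow>
      X (e i) = scale (of_nat i) (e (i + 1)) + scale (of_nat i + \<epsilon>) (e i)"
    and i: "i \<le> m"
  shows "(\<Sum>j=1..i. X (e j) + e j) = scale (of_nat i) (e (i + 1)) + scale \<epsilon> (\<Sum>j=1..i. e j)"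
  using i
proof (induction i)
  case (Suc i)
  \<comment> \<open>Modulo two, the summand at j is j e_(j+1) - (j - 1) e_j plus
    \<open>\<epsilon>\<close> times e_j, so the shift terms telescope.\<close>
  then show ?case using X[of "Suc i"]
    by (simp add: scale_left_distrib scale_right_distrib add_ac)
qed simp

text \<open>Here \<open>X\<close> is D (1 + n) plus the scalar \<open>m\<close>, and a scalar
  commutes with \<open>u\<close>. At \<open>i = 2 * m\<close> the vector beyond the block has the
  even coefficient \<open>2 * m\<close>.\<close>

lemma tail_qcomm:
  assumes "lin X" "lin u"
    and X: "X (e i) = scale (of_nat i) (e (i + 1)) + scale (of_nat (i + m + 1)) (e i)"
      "X (e (i - 1)) = scale (of_nat (i - 1)) (e i) + scale (of_nat (i - 1 + m + 1)) (e (i - 1))"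
    and u: "u (e i) = e i + e (i - 1)" "i < 2 * m \<Longrightarrow> u (e (i + 1)) = e (i + 1) + e i"
    and i: "1 \<le> i" "i \<le> 2 * m"
  shows "u (X (e i)) = X (u (e i)) + u (e i)"
proof (cases "i = 2 * m")
  case True
  then show ?thesis using assms
    by (cases "even m") (simp_all add: lin_add lin_scale lin_zero of_nat_K algebra_simps)
next
  case False
  then have "u (e (i + 1)) = e (i + 1) + e i" using u i by simp
  then show ?thesis using assms
    by (cases "even m"; cases "even i") (simp_all add: lin_add lin_scale lin_zero of_nat_K algebra_simps)
qed

text \<open>The halves meet at \<open>e (k + 1)\<close>, which \<open>u\<close> still maps to a full
  sum. This forces the diagonal coefficient there to vanish, whence the shift by \<open>k\<close> on
  the second half; paired diagonal coefficients then add up to \<open>k\<close>, as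
  \<open>V_obstruction\<close> demands for c = 1.\<close>

lemma V_derivation_qcomm:
  assumes act: "V_act u k e" and lX: "lin X" and lu: "lin u"
    and X: "\<And>i. 1 \<le> i \<Longrightarrow> i \<le> 2 * k \<Longrightarrow>
      X (e i) = scale (of_nat i) (e (i + 1)) + scale (of_nat (if i \<le> k then i else i + k + 1)) (e i)"
    and i: "1 \<le> i" "i \<le> 2 * k"
  shows "u (X (e i)) = X (u (e i)) + u (e i)"
proof -
  have head: "u (e j) = (\<Sum>q=1..j. e q)" if "1 \<le> j" "j \<le> k + 1" for j
    using act that u_head[of u e "k + 1" j] by (simp add: V_act_def)
  have X': "1 \<le> j \<Longrightarrow> j \<le> k \<Longrightarrow> X (e j) = scale (of_nat j) (e (j + 1)) + scale (of_nat j + 0) (e j)" for j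
    using X[of j] by simp
  have tel: "X (\<Sum>q=1..j. e q) + (\<Sum>q=1..j. e q) = scale (of_nat j) (e (j + 1))" if "j \<le> k" for j
    using head_telescope[of k X e 0 j, OF X' that] by (simp add: lin_sum[OF lX] sum.distrib)
  consider "i \<le> k" | "i = k + 1" | "i > k + 1" by linarith
  then show ?thesis
  proof cases
    case 1
    have "u (X (e i)) = scale (of_nat i) (u (e (i + 1)) + u (e i))"
      using X[OF i] 1 by (simp add: lin_add[OF lu] lin_scale[OF lu] scale_right_distrib)
    also have "u (e (i + 1)) + u (e i) = e (i + 1)"
      using head[of i] head[of "i + 1"] 1 i by (simp add: add_ac)
    finally show ?thesis using tel[OF 1] head[of i] 1 i by simp
  next
    case 2
    have sum: "(\<Sum>q=1..k + 1. e q) = (\<Sum>q=1..k. e q) + e (k + 1)" by simp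
    have "X (u (e i)) + u (e i) = (X (\<Sum>q=1..k. e q) + (\<Sum>q=1..k. e q)) + (X (e (k + 1)) + e (k + 1))"
      using head[of i] 2 by (simp add: lin_add[OF lX] add_ac)
    also have "\<dots> = scale (of_nat k) (e (k + 1)) + (X (e (k + 1)) + e (k + 1))"
      unfolding tel[OF order_refl] ..
    finally have R: "X (u (e i)) + u (e i) = scale (of_nat k) (e (k + 1)) + (X (e (k + 1)) + e (k + 1))" .
    have Xk: "X (e (k + 1)) = scale (of_nat (k + 1)) (e (k + 2))"
      using X[of "k + 1"] 2 i by (simp add: of_nat_K)
    show ?thesis
    proof (cases "even k")
      case True
      then have "k + 2 \<le> 2 * k" using 2 i by (cases k; cases "k - 1") auto
      then have "u (e (k + 2)) = e (k + 2) + e (k + 1)" using act by (simp add: V_act_def)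
      then show ?thesis unfolding R using True Xk 2 by (simp add: of_nat_K)
    next
      case False
      then show ?thesis unfolding R using Xk 2 lin_zero[OF lu] by (simp add: of_nat_K)
    qed
  next
    case 3
    show ?thesis
    proof (rule tail_qcomm[OF lX lu, where m = k])
      show "X (e i) = scale (of_nat i) (e (i + 1)) + scale (of_nat (i + k + 1)) (e i)"
        using X[OF i] 3 by simp
      show "X (e (i - 1)) = scale (of_nat (i - 1)) (e i) + scale (of_nat (i - 1 + k + 1)) (e (i - 1))"
        using X[of "i - 1"] 3 i by (cases i) (auto split: if_splits)
    qed (use act 3 i in \<open>auto simp: V_act_def\<close>)
  qed
qed

text \<open>For even \<open>m\<close> the coefficient of \<open>e (m + 1)\<close> in
  \<open>X (e m)\<close> vanishes, so the halves decouple and the first may be shifted by any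
  scalar. This \<open>\<epsilon>\<close> serves to match the multiplier of the other blocks.\<close>

lemma W_derivation_qcomm:
  assumes act: "W_act u m e" and lX: "lin X" and lu: "lin u" and even: "even m"
    and X: "\<And>i. 1 \<le> i \<Longrightarrow> i \<le> 2 * m \<Longrightarrow>
      X (e i) = scale (of_nat i) (e (i + 1)) + scale (if i \<le> m then of_nat i + \<epsilon> else of_nat (i + m + 1)) (e i)"
    and i: "1 \<le> i" "i \<le> 2 * m"
  shows "u (X (e i)) = X (u (e i)) + u (e i)"
proof -
  have head: "u (e j) = (\<Sum>q=1..j. e q)" if "1 \<le> j" "j \<le> m" for j
    using act that u_head[of u e m j] by (simp add: W_act_def)
  have X': "1 \<le> j \<Longrightarrow> j \<le> m \<Longrightarrow> X (e j) = scale (of_nat j) (e (j + 1)) + scale (of_nat j + \<epsilon>) (e j)" for j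
    using X[of j] by simp
  have tel: "X (\<Sum>q=1..j. e q) + (\<Sum>q=1..j. e q) = scale (of_nat j) (e (j + 1)) + scale \<epsilon> (\<Sum>q=1..j. e q)"
    if "j \<le> m" for j
    using head_telescope[of m X e \<epsilon> j, OF X' that] by (simp add: lin_sum[OF lX] sum.distrib)
  consider "i \<le> m" | "i = m + 1" | "i > m + 1" by linarith
  then show ?thesis
  proof cases
    case 1
    have "u (X (e i)) = scale (of_nat i) (u (e (i + 1)) + u (e i)) + scale \<epsilon> (u (e i))"
      using X[OF i] 1 by (simp add: lin_add[OF lu] lin_scale[OF lu] scale_right_distrib scale_left_distrib add_ac)
    also have "scale (of_nat i) (u (e (i + 1)) + u (e i)) = scale (of_nat i) (e (i + 1))"
    proof (cases "i = m")
      case True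
      then show ?thesis using even by (simp add: of_nat_K)
    next
      case False
      then show ?thesis
        using head[of i] head[of "i + 1"] 1 i by (simp add: add_ac)
    qed
    finally show ?thesis using tel[OF 1] head[of i] 1 i by simp
  next
    case 2
    have um: "u (e (m + 1)) = e (m + 1)" using act by (simp add: W_act_def)
    have Xm: "X (e (m + 1)) = e (m + 2)"
      using X[of "m + 1"] 2 i even by (simp add: of_nat_K)
    have "m + 2 \<le> 2 * m" using 2 i even by (cases m; cases "m - 1") auto
    then have "u (e (m + 2)) = e (m + 2) + e (m + 1)" using act by (simp add: W_act_def)
    then show ?thesis using Xm um 2 by simp
  next
    case 3
    show ?thesis
    proof (rule tail_qcomm[OF lX lu, where m = m])
      show "X (e i) = scale (of_nat i) (e (i + 1)) + scale (of_nat (i + m + 1)) (e i)"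
        using X[OF i] 3 by simp
      show "X (e (i - 1)) = scale (of_nat (i - 1)) (e i) + scale (of_nat (i - 1 + m + 1)) (e (i - 1))"
        using X[of "i - 1"] 3 i by (cases i) (auto split: if_splits)
    qed (use act 3 i in \<open>auto simp: W_act_def\<close>)
  qed
qed

section \<open>Endomorphisms of V assembled from all blocks\<close>

lemma exists_projection:
  assumes bl: "blocks I d e" and u: "lin u" and W: "\<And>p. p \<in> I \<Longrightarrow> W_act u (d p) (e p)"
  shows "\<exists>X. gsp 1 X \<and> qcomm u 0 X"
proof -
  obtain X where X: "lin X"
    "\<And>p i. p \<in> I \<Longrightarrow> 1 \<le> i \<Longrightarrow> i \<le> 2 * d p \<Longrightarrow> X (e p i) = (if i \<le> d p then e p i else 0)"
    using blocks_extend[OF bl, where f = "\<lambda>p i. if i \<le> d p then e p i else 0"] by metis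
  have "gsp 1 X"
    by (rule blocks_gsp[OF bl X(1), where \<phi> = "\<lambda>_ _. 0" and \<psi> = "\<lambda>p i. if i \<le> d p then 1 else 0"])
      (auto simp: X(2))
  moreover have "qcomm u 0 X"
    by (rule blocks_qcomm[OF bl X(1) u]) (simp add: W_projection_qcomm[OF W X(1) u X(2)])
  ultimately show ?thesis by blast
qed

lemma exists_derivation:
  fixes I :: "(nat + nat) set"
  assumes bl: "blocks I d e" and u: "lin u"
    and W: "\<And>i. Inl i \<in> I \<Longrightarrow> W_act u (d (Inl i)) (e (Inl i)) \<and> even (d (Inl i))"
    and V: "\<And>j. Inr j \<in> I \<Longrightarrow> V_act u (d (Inr j)) (e (Inr j)) \<and> of_nat (d (Inr j)) = \<epsilon>"
  shows "\<exists>X. gsp \<epsilon> X \<and> qcomm u 1 X"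
proof -
  \<comment> \<open>\<open>isl p\<close> marks the W-blocks. Paired indices give the sum
    \<open>d p\<close>, plus \<open>\<epsilon>\<close> on W-blocks, where \<open>d p\<close> is
    even; on V-blocks \<open>d p\<close> itself equals \<open>\<epsilon>\<close> in
    \<open>K\<close>. So all blocks have multiplier \<open>\<epsilon>\<close>.\<close>
  define \<psi> where "\<psi> p i = (if i \<le> d p then of_nat i + (if isl p then \<epsilon> else 0) else of_nat (i + d p + 1))" for p i
  define f where "f p i = scale (of_nat i) (e p (i + 1)) + scale (\<psi> p i) (e p i)" for p i
  obtain X where X: "lin X"
    "\<And>p i. p \<in> I \<Longrightarrow> 1 \<le> i \<Longrightarrow> i \<le> 2 * d p \<Longrightarrow> X (e p i) = f p i"
    using blocks_extend[OF bl, where f = f] by metis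
  have sum: "\<psi> p i + \<psi> p j = \<epsilon>" if "p \<in> I" "i + j = 2 * d p + 1" "i \<le> d p" for p i j
  proof -
    have j: "\<not> j \<le> d p" using that by auto
    have "even (j + d p + 1) \<longleftrightarrow> even (i + d p)" using that(2) by presburger
    then have "(of_nat (j + d p + 1) :: 'k) = of_nat (i + d p)" unfolding of_nat_K by simp
    then have "\<psi> p j = of_nat (i + d p)" using j by (simp only: \<psi>_def if_False)
    then have *: "\<psi> p i + \<psi> p j = of_nat (d p) + (if isl p then \<epsilon> else 0)"
      using that(3) by (simp add: \<psi>_def add_ac)
    show ?thesis
    proof (cases p)
      case (Inl r)
      then show ?thesis using W[of r] that(1) unfolding * by (simp add: of_nat_K)
    next
      case (Inr r)
      then show ?thesis using V[of r] that(1) unfolding * by simp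
    qed
  qed
  have "gsp \<epsilon> X"
  proof (rule blocks_gsp[OF bl X(1), where \<phi> = "\<lambda>_ i. of_nat i" and \<psi> = \<psi>])
    show "X (e p i) = scale (of_nat i) (e p (i + 1)) + scale (\<psi> p i) (e p i)"
      if "p \<in> I" "1 \<le> i" "i \<le> 2 * d p" for p i using X(2)[OF that] by (simp add: f_def)
    show "\<psi> p i + \<psi> p j = \<epsilon>" if "p \<in> I" "1 \<le> i" "1 \<le> j" "i + j = 2 * d p + 1" for p i j
    proof (cases "i \<le> d p")
      case True
      then show ?thesis using sum that by blast
    next
      case False
      then show ?thesis using sum[of p j i] that by (simp add: add.commute)
    qed
    show "(of_nat i :: 'k) = of_nat j" if "i + j = 2 * d p" for p :: "nat + nat" and i j
      using that unfolding of_nat_K by (metis even_add even_mult_iff even_numeral)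
  qed (simp add: of_nat_K)
  moreover have "qcomm u 1 X"
  proof (rule blocks_qcomm[OF bl X(1) u])
    fix p i assume p: "p \<in> I" "1 \<le> i" "i \<le> 2 * d p"
    show "u (X (e p i)) = X (u (e p i)) + scale 1 (u (e p i))"
    proof (cases p)
      case (Inl r)
      have "u (X (e p i)) = X (u (e p i)) + u (e p i)"
      proof (rule W_derivation_qcomm[OF _ X(1) u, where m = "d p" and \<epsilon> = \<epsilon>])
        show "X (e p i) = scale (of_nat i) (e p (i + 1)) +
            scale (if i \<le> d p then of_nat i + \<epsilon> else of_nat (i + d p + 1)) (e p i)"
          if "1 \<le> i" "i \<le> 2 * d p" for i
          using X(2)[OF p(1) that] Inl by (simp add: f_def \<psi>_def)
      qed (use W[of r] Inl p in auto)
      then show ?thesis by simp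
    next
      case (Inr r)
      have "u (X (e p i)) = X (u (e p i)) + u (e p i)"
      proof (rule V_derivation_qcomm[OF _ X(1) u, where k = "d p"])
        show "X (e p i) = scale (of_nat i) (e p (i + 1)) +
            scale (of_nat (if i \<le> d p then i else i + d p + 1)) (e p i)"
          if "1 \<le> i" "i \<le> 2 * d p" for i
          using X(2)[OF p(1) that] Inr by (simp add: f_def \<psi>_def)
      qed (use V[of r] Inr p in auto)
      then show ?thesis by simp
    qed
  qed
  ultimately show ?thesis by blast
qed

lemma decomposition_blocks:
  assumes "decomposition scale b u t m s k"
  obtains e where "blocks ({1..t} <+> {1..s}) (case_sum m k) e"
    "\<And>i. i \<in> {1..t} \<Longrightarrow> W_act u (m i) (e (Inl i)) \<and> antidiag_gram b (2 * m i) (e (Inl i)) \<and> 1 \<le> m i"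
    "\<And>j. j \<in> {1..s} \<Longrightarrow> V_act u (k j) (e (Inr j)) \<and> antidiag_gram b (2 * k j) (e (Inr j)) \<and> 1 \<le> k j"
proof -
  let ?I = "{1..t} <+> {1..s}" and ?d = "case_sum m k"
  obtain U :: "nat + nat \<Rightarrow> 'v set" where U: "orthogonal_direct_sum scale b ?I U"
    "\<forall>i\<in>{1..t}. iso_W scale b u (m i) (U (Inl i))" "\<forall>j\<in>{1..s}. iso_V scale b u (k j) (U (Inr j))"
    and pos: "\<forall>i\<in>{1..t}. 1 \<le> m i" "\<forall>j\<in>{1..s}. 1 \<le> k j"
    using assms unfolding decomposition_def by blast
  have "\<forall>i\<in>{1..t}. \<exists>e. W_act u (m i) e \<and> antidiag_gram b (2 * m i) e \<and> is_basis_of scale (2 * m i) e (U (Inl i))"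
    using U(2) unfolding iso_W_def W_act_def by blast
  then obtain e1 where e1: "\<And>i. i \<in> {1..t} \<Longrightarrow> W_act u (m i) (e1 i) \<and> antidiag_gram b (2 * m i) (e1 i) \<and>
      is_basis_of scale (2 * m i) (e1 i) (U (Inl i))" by metis
  have "\<forall>j\<in>{1..s}. \<exists>e. V_act u (k j) e \<and> antidiag_gram b (2 * k j) e \<and> is_basis_of scale (2 * k j) e (U (Inr j))"
    using U(3) unfolding iso_V_def V_act_def by blast
  then obtain e2 where e2: "\<And>j. j \<in> {1..s} \<Longrightarrow> V_act u (k j) (e2 j) \<and> antidiag_gram b (2 * k j) (e2 j) \<and>
      is_basis_of scale (2 * k j) (e2 j) (U (Inr j))" by metis
  define e where "e = case_sum e1 e2"
  have e: "antidiag_gram b (2 * ?d p) (e p)" "span (e p ` {1..2 * ?d p}) = U p" if "p \<in> ?I" for p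
    using that e1 e2 by (auto simp: e_def is_basis_of_def)
  have "blocks ?I ?d e"
    unfolding blocks_def
  proof (intro conjI ballI)
    show "finite ?I" by simp
    fix p i q j assume pq: "p \<in> ?I" "i \<in> {1..2 * ?d p}" "q \<in> ?I" "j \<in> {1..2 * ?d q}"
    show "b (e p i) (e q j) = (if p = q \<and> i + j = 2 * ?d p + 1 then 1 else 0)"
    proof (cases "p = q")
      case True
      then show ?thesis using e(1)[OF pq(1)] pq unfolding antidiag_gram_def by simp
    next
      case False
      have "e p i \<in> U p" "e q j \<in> U q" using e(2)[OF pq(1)] e(2)[OF pq(3)] pq span_base by blast+
      then show ?thesis using U(1) False pq unfolding orthogonal_direct_sum_def by auto
    qed
  next
    show "span (\<Union>p\<in>?I. e p ` {1..2 * ?d p}) = UNIV"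
    proof (intro equalityI subsetI UNIV_I)
      fix x
      obtain w where w: "\<forall>i\<in>?I. w i \<in> U i" "x = (\<Sum>i\<in>?I. w i)"
        using U(1) unfolding orthogonal_direct_sum_def by blast
      have "w p \<in> span (\<Union>p\<in>?I. e p ` {1..2 * ?d p})" if "p \<in> ?I" for p
        using w(1) that e(2)[OF that] span_mono[of "e p ` {1..2 * ?d p}" "\<Union>p\<in>?I. e p ` {1..2 * ?d p}"] by blast
      then show "x \<in> span (\<Union>p\<in>?I. e p ` {1..2 * ?d p})" unfolding w(2) by (intro span_sum)
    qed
  qed
  then show ?thesis using that[of e] e1 e2 pos by (simp add: e_def)
qed

end

section \<open>Integral forms of the adjoint module\<close>

definition eps :: "nat \<Rightarrow> nat \<Rightarrow> 'a::comm_ring_1" where "eps l a = (if a < l then 1 else - 1)"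

lemma eps_sq [simp]: "eps l a * eps l a = 1" "eps l a * (eps l a * x) = x"
  by (simp_all add: eps_def)

definition adj :: "nat \<Rightarrow> 'a::comm_ring_1 mat \<Rightarrow> 'a mat" where
  "adj l M = mat (2 * l) (2 * l) (\<lambda>(a, c). eps l a * eps l c * M $$ (2 * l - 1 - c, 2 * l - 1 - a))"

text \<open>\<open>adj l\<close> is the adjoint involution of the symplectic form with Gram matrix
  \<open>antidiag(1, \<dots>, 1, -1, \<dots>, -1)\<close>, so \<open>similitude l \<mu>\<close> describes the Lie algebra of the group of
  symplectic similitudes, with \<open>\<mu>\<close> the differential of the multiplier.\<close>

definition similitude :: "nat \<Rightarrow> 'a::comm_ring_1 \<Rightarrow> 'a mat \<Rightarrow> bool" where
  "similitude l \<mu> M \<longleftrightarrow> M \<in> carrier_mat (2 * l) (2 * l) \<and> M + adj l M = \<mu> \<cdot>\<^sub>m 1\<^sub>m (2 * l)"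

lemma adj_carrier [simp]: "adj l M \<in> carrier_mat (2 * l) (2 * l)"
  by (simp add: adj_def)

lemma adj_dim [simp]: "dim_row (adj l M) = 2 * l" "dim_col (adj l M) = 2 * l"
  by (simp_all add: adj_def)

lemma adj_entry: "a < 2 * l \<Longrightarrow> c < 2 * l \<Longrightarrow>
  adj l M $$ (a, c) = eps l a * eps l c * M $$ (2 * l - 1 - c, 2 * l - 1 - a)"
  by (simp add: adj_def)

lemma similitudeD:
  assumes "similitude l \<mu> M" "a < 2 * l" "c < 2 * l"
  shows "M $$ (a, c) + eps l a * eps l c * M $$ (2 * l - 1 - c, 2 * l - 1 - a) = (if a = c then \<mu> else 0)"
proof -
  have "(M + adj l M) $$ (a, c) = (\<mu> \<cdot>\<^sub>m 1\<^sub>m (2 * l)) $$ (a, c)" using assms by (simp add: similitude_def)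
  then show ?thesis using assms by (simp add: adj_entry similitude_def)
qed

lemma similitudeI:
  assumes "M \<in> carrier_mat (2 * l) (2 * l)"
    and "\<And>a c. a < 2 * l \<Longrightarrow> c < 2 * l \<Longrightarrow>
      M $$ (a, c) + eps l a * eps l c * M $$ (2 * l - 1 - c, 2 * l - 1 - a) = (if a = c then \<mu> else 0)"
  shows "similitude l \<mu> M"
  unfolding similitude_def using assms by (intro conjI eq_matI) (auto simp: adj_entry)

lemma adj_mult:
  assumes "M \<in> carrier_mat (2 * l) (2 * l)" "N \<in> carrier_mat (2 * l) (2 * l)"
  shows "adj l (M * N) = adj l N * adj l M"
proof (rule eq_matI)
  fix a c assume "a < dim_row (adj l N * adj l M)" "c < dim_col (adj l N * adj l M)"
  then have ac: "a < 2 * l" "c < 2 * l" by auto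
  let ?m = "\<lambda>a. 2 * l - 1 - a"
  have lt: "?m a < 2 * l" "?m c < 2 * l" using ac by auto
  have "adj l (M * N) $$ (a, c) = eps l a * eps l c * (\<Sum>k\<in>{0..<2 * l}. M $$ (?m c, k) * N $$ (k, ?m a))"
    using ac lt assms by (simp add: adj_entry scalar_prod_def)
  also have "(\<Sum>k\<in>{0..<2 * l}. M $$ (?m c, k) * N $$ (k, ?m a))
      = (\<Sum>k\<in>{0..<2 * l}. M $$ (?m c, ?m k) * N $$ (?m k, ?m a))"
    by (rule sum.reindex_bij_witness[of _ ?m ?m]) auto
  also have "eps l a * eps l c * \<dots> = (\<Sum>k\<in>{0..<2 * l}. adj l N $$ (a, k) * adj l M $$ (k, c))"
    unfolding sum_distrib_left
    by (intro sum.cong refl) (use ac in \<open>simp add: adj_entry mult_ac\<close>)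
  also have "\<dots> = (adj l N * adj l M) $$ (a, c)" using ac by (simp add: scalar_prod_def)
  finally show "adj l (M * N) $$ (a, c) = (adj l N * adj l M) $$ (a, c)" .
qed auto

lemma adj_similitude:
  assumes "similitude l \<mu> M" shows "adj l M = \<mu> \<cdot>\<^sub>m 1\<^sub>m (2 * l) - M"
proof (rule eq_matI)
  have M: "M \<in> carrier_mat (2 * l) (2 * l)" using assms by (simp add: similitude_def)
  fix a c assume "a < dim_row (\<mu> \<cdot>\<^sub>m 1\<^sub>m (2 * l) - M)" "c < dim_col (\<mu> \<cdot>\<^sub>m 1\<^sub>m (2 * l) - M)"
  then have ac: "a < 2 * l" "c < 2 * l" using M by auto
  show "adj l M $$ (a, c) = (\<mu> \<cdot>\<^sub>m 1\<^sub>m (2 * l) - M) $$ (a, c)"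
    using similitudeD[OF assms ac] ac M by (simp add: adj_entry eq_diff_eq add.commute eq_neg_iff_add_eq_0)
qed (use assms in \<open>auto simp: similitude_def\<close>)

lemma similitude_add:
  assumes "similitude l \<mu> M" "similitude l \<nu> N" shows "similitude l (\<mu> + \<nu>) (M + N)"
proof (rule similitudeI)
  show "M + N \<in> carrier_mat (2 * l) (2 * l)" using assms by (simp add: similitude_def)
  fix a c assume ac: "a < 2 * l" "c < 2 * l"
  have N: "N \<in> carrier_mat (2 * l) (2 * l)" using assms by (simp add: similitude_def)
  let ?e = "eps l a * eps l c" and ?a = "2 * l - 1 - c" and ?c = "2 * l - 1 - a"
  have "(M + N) $$ (a, c) + ?e * (M + N) $$ (?a, ?c)
      = (M $$ (a, c) + ?e * M $$ (?a, ?c)) + (N $$ (a, c) + ?e * N $$ (?a, ?c))"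
    using ac N by (simp add: distrib_left add_ac)
  then show "(M + N) $$ (a, c) + ?e * (M + N) $$ (?a, ?c) = (if a = c then \<mu> + \<nu> else 0)"
    by (simp only: similitudeD[OF assms(1) ac] similitudeD[OF assms(2) ac]) simp
qed

text \<open>\<open>adj\<close> reverses products and sends \<open>X\<close> to -X and
  \<open>B\<close> to \<open>\<mu>\<close> - B; the scalar cancels in the commutator.\<close>

lemma similitude_bracket:
  assumes X: "similitude l 0 X" and B: "similitude l \<mu> B"
  shows "similitude l 0 (X * B - B * X)"
proof -
  have c: "X \<in> carrier_mat (2 * l) (2 * l)" "B \<in> carrier_mat (2 * l) (2 * l)"
    using assms by (auto simp: similitude_def)
  let ?n = "2 * l" let ?I = "1\<^sub>m (2 * l) :: 'a mat"
  have z: "0 \<cdot>\<^sub>m ?I - X = - X" using c by (intro eq_matI) auto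
  have "adj l (X * B) = (\<mu> \<cdot>\<^sub>m ?I - B) * (- X)"
    using adj_mult[OF c] adj_similitude[OF X] adj_similitude[OF B] z by simp
  also have "\<dots> = (\<mu> \<cdot>\<^sub>m ?I) * (- X) - B * (- X)"
    using c by (intro minus_mult_distrib_mat) auto
  also have "\<dots> = B * X - \<mu> \<cdot>\<^sub>m X"
    using c by (intro eq_matI) (auto simp: mult_smult_assoc_mat[of _ ?n ?n])
  finally have 1: "adj l (X * B) = B * X - \<mu> \<cdot>\<^sub>m X" .
  have "adj l (B * X) = (- X) * (\<mu> \<cdot>\<^sub>m ?I - B)"
    using adj_mult[OF c(2,1)] adj_similitude[OF X] adj_similitude[OF B] z by simp
  also have "\<dots> = (- X) * (\<mu> \<cdot>\<^sub>m ?I) - (- X) * B"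
    using c by (intro mult_minus_distrib_mat) auto
  also have "\<dots> = X * B - \<mu> \<cdot>\<^sub>m X"
    using c by (intro eq_matI) (auto simp: mult_smult_distrib[of _ ?n ?n])
  finally have 2: "adj l (B * X) = X * B - \<mu> \<cdot>\<^sub>m X" .
  have "adj l (X * B - B * X) = adj l (X * B) - adj l (B * X)"
    using c by (intro eq_matI) (auto simp: adj_entry algebra_simps)
  also have "\<dots> = B * X - X * B" unfolding 1 2 using c by (intro eq_matI) auto
  finally show ?thesis unfolding similitude_def using c by (intro conjI eq_matI) auto
qed

text \<open>\<open>adj\<close> maps X B X to X (\<open>\<mu>\<close> - B) X, where the scalar
  contributes a multiple of X^2 = 0. For such \<open>X\<close> the matrix -X B X is half of the
  double bracket of \<open>B\<close> with \<open>X\<close>.\<close>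

lemma similitude_sandwich:
  assumes X: "similitude l 0 X" and B: "similitude l \<mu> B" and XX: "X * X = 0\<^sub>m (2 * l) (2 * l)"
  shows "similitude l 0 (- (X * B * X))"
proof -
  have c: "X \<in> carrier_mat (2 * l) (2 * l)" "B \<in> carrier_mat (2 * l) (2 * l)"
    using assms by (auto simp: similitude_def)
  let ?n = "2 * l" let ?I = "1\<^sub>m (2 * l) :: 'a mat"
  have z: "adj l X = - X" using adj_similitude[OF X] c by (intro eq_matI) auto
  have "adj l (X * B * X) = (- X) * (adj l B * (- X))"
    using adj_mult[of "X * B" l X] adj_mult[OF c] c z by simp
  also have "\<dots> = X * (adj l B * X)"
  proof -
    have "adj l B * (- X) = - (adj l B * X)" using c by (intro eq_matI) auto
    moreover have "(- X) * (- (adj l B * X)) = X * (adj l B * X)"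
      using c by (intro eq_matI) (auto simp: scalar_prod_def)
    ultimately show ?thesis by simp
  qed
  also have "adj l B * X = \<mu> \<cdot>\<^sub>m X - B * X"
    unfolding adj_similitude[OF B] using c 
    by (subst minus_mult_distrib_mat[of _ ?n ?n _ _ ?n]) (auto simp: mult_smult_assoc_mat[of _ ?n ?n])
  also have "X * (\<mu> \<cdot>\<^sub>m X - B * X) = X * (\<mu> \<cdot>\<^sub>m X) - X * (B * X)"
    using c by (intro mult_minus_distrib_mat) auto
  also have "\<dots> = - (X * B * X)"
    using c XX mult_smult_distrib[OF c(1) c(1), of \<mu>] assoc_mult_mat[OF c(1,2,1)] by (intro eq_matI) auto
  finally have "adj l (X * B * X) = - (X * B * X)" .
  moreover have "adj l (- M) = - adj l M" if "M \<in> carrier_mat ?n ?n" for M :: "'a mat"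
    using that by (intro eq_matI) (auto simp: adj_entry)
  ultimately have "adj l (- (X * B * X)) = - (- (X * B * X))" using c by simp
  then show ?thesis unfolding similitude_def using c by (intro conjI eq_matI) auto
qed

text \<open>\<open>half_H\<close> is replaced by \<open>half_H\<close> + 1/2, which has the same
  brackets but makes sense over every ring; so the same formula serves \<open>int\<close>,
  \<open>rat\<close> and \<open>K\<close>.\<close>

fun int_basis :: "nat \<Rightarrow> ad_ix \<Rightarrow> 'a::comm_ring_1 mat" where
  "int_basis l (Rt \<gamma>) = chev_X l \<gamma>"
| "int_basis l (Cr i) = chev_h l i"
| "int_basis l Half = mat (2 * l) (2 * l) (\<lambda>(i, j). if i = j \<and> i < l then 1 else 0)"

lemma int_basis_carrier [simp]: "int_basis l p \<in> carrier_mat (2 * l) (2 * l)"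
  by (cases p) simp_all

lemma int_basis_dim [simp]: "dim_row (int_basis l p) = 2 * l" "dim_col (int_basis l p) = 2 * l"
  using int_basis_carrier[of l p] by (metis carrier_matD)+

lemma chev_X_of_int:
  assumes "\<gamma> \<in> roots l" "a < 2 * l" "c < 2 * l"
  shows "chev_X l \<gamma> $$ (a, c) = of_int (chev_X l \<gamma> $$ (a, c))"
  unfolding chev_X_entry[OF assms] by (simp split: root.split)

lemma int_basis_of_int:
  assumes "p \<in> ad_index l" "a < 2 * l" "c < 2 * l"
  shows "int_basis l p $$ (a, c) = of_int (int_basis l p $$ (a, c))"
proof (cases p)
  case (Rt \<gamma>)
  then show ?thesis using chev_X_of_int assms by (auto simp: ad_index_def)
next
  case (Cr i)
  then show ?thesis using assms by (auto simp: ad_index_def chev_h_entry)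
qed (use assms in auto)

lemma ad_basis_int:
  assumes "p \<in> ad_index l" "a < 2 * l" "c < 2 * l"
  shows "ad_basis l p $$ (a, c) = int_basis l p $$ (a, c) - (if p = Half \<and> a = c then 1 / 2 else 0)"
  using assms by (cases p) (auto simp: half_H_def)

lemma entry_pos_ne: "\<gamma> \<in> roots l \<Longrightarrow> fst (entry_pos l \<gamma>) \<noteq> snd (entry_pos l \<gamma>)"
  by (auto simp: roots_def)

text \<open>Off the diagonal \<open>int_basis\<close> agrees with \<open>ad_basis\<close>. Its
  entries are images of integers, so the identity over \<open>rat\<close> descends to
  \<open>int\<close> and passes on to every ring.\<close>

lemma int_basis_entry_root:
  assumes "\<gamma> \<in> roots l" "p \<in> ad_index l"
  shows "int_basis l p $$ entry_pos l \<gamma> = (if p = Rt \<gamma> then 1 else 0)"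
proof -
  obtain a c where ac: "entry_pos l \<gamma> = (a, c)" by force
  have lt: "a < 2 * l" "c < 2 * l" "a \<noteq> c"
    using entry_pos_less[OF assms(1)] entry_pos_ne[OF assms(1)] ac by auto
  have "of_int (int_basis l p $$ (a, c)) = (if p = Rt \<gamma> then 1 else 0 :: rat)"
    using ad_basis_entry_root[OF assms] ad_basis_int[OF assms(2) lt(1,2)] lt(3) ac
      int_basis_of_int[OF assms(2) lt(1,2), where ?'a = rat] by simp
  then have "int_basis l p $$ (a, c) = (if p = Rt \<gamma> then 1 else 0 :: int)" by (simp split: if_splits)
  then show ?thesis using int_basis_of_int[OF assms(2) lt(1,2), where ?'a = 'a] ac by simp
qed

lemma sign_diff:
  assumes "P \<or> Q \<Longrightarrow> e = (1 :: 'a::comm_ring_1)"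
  shows "(if P then 1 else 0) - (if Q then 1 else 0) + e * ((if Q then 1 else 0) - (if P then 1 else 0)) = 0"
  using assms by (cases P; cases Q) auto

lemma sign_plus:
  assumes "P \<or> Q \<Longrightarrow> e = (- 1 :: 'a::comm_ring_1)"
  shows "(if P then 1 else 0) + (if Q then 1 else 0) + e * ((if Q then 1 else 0) + (if P then 1 else 0)) = 0"
  using assms by (cases P; cases Q) auto

lemma sign_long:
  assumes "P \<Longrightarrow> e = (- 1 :: 'a::comm_ring_1)"
  shows "(if P then 1 else 0) + e * (if P then 1 else 0) = 0"
  using assms by (cases P) auto

text \<open>Mirroring swaps the two matrix units of a short root vector and fixes the one of a long
  root vector. The sign is 1 when row and column lie in the same half, as for \<open>Diff\<close>,
  and -1 otherwise.\<close>

lemma chev_X_mirror: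
  assumes g: "\<gamma> \<in> roots l" and ac: "a < 2 * l" "c < 2 * l" and m: "a + a' + 1 = 2 * l" "c + c' + 1 = 2 * l"
  shows "chev_X l \<gamma> $$ (a, c) + eps l a * eps l c * chev_X l \<gamma> $$ (c', a') = (0 :: 'a::comm_ring_1)"
proof -
  have lt: "a' < 2 * l" "c' < 2 * l" using m by auto
  have m: "a' + 1 = i \<longleftrightarrow> a + i = 2 * l" "a' + i = 2 * l \<longleftrightarrow> a + 1 = i"
    "c' + 1 = i \<longleftrightarrow> c + i = 2 * l" "c' + i = 2 * l \<longleftrightarrow> c + 1 = i" for i
    using m by linarith+
  note e1 = chev_X_entry[OF g ac, where ?'a = 'a]
  note e2 = chev_X_entry[OF g lt(2,1), where ?'a = 'a]
  show ?thesis
  proof (cases \<gamma>)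
    case (Diff i j)
    let ?P = "a + 1 = i \<and> c + 1 = j" and ?Q = "a + j = 2 * l \<and> c + i = 2 * l"
    have "i \<le> l" "j \<le> l" using g Diff by (auto simp: roots_def)
    then have h: "?P \<or> ?Q \<Longrightarrow> eps l a * eps l c = (1 :: 'a)" by (auto simp: eps_def)
    then show ?thesis
      using sign_diff[of ?P ?Q "eps l a * eps l c :: 'a", OF h]
      unfolding e1 e2 unfolding Diff root.case m by (simp only: conj_commute)
  next
    case (Plus i j)
    let ?P = "a + 1 = j \<and> c + i = 2 * l" and ?Q = "a + 1 = i \<and> c + j = 2 * l"
    have "i \<le> l" "j \<le> l" using g Plus by (auto simp: roots_def)
    then have h: "?P \<or> ?Q \<Longrightarrow> eps l a * eps l c = (- 1 :: 'a)" by (auto simp: eps_def)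
    then show ?thesis
      using sign_plus[of ?P ?Q "eps l a * eps l c :: 'a", OF h]
      unfolding e1 e2 unfolding Plus root.case m by (simp only: conj_commute)
  next
    case (Minus i j)
    let ?P = "a + i = 2 * l \<and> c + 1 = j" and ?Q = "a + j = 2 * l \<and> c + 1 = i"
    have "i \<le> l" "j \<le> l" using g Minus by (auto simp: roots_def)
    then have h: "?P \<or> ?Q \<Longrightarrow> eps l a * eps l c = (- 1 :: 'a)" by (auto simp: eps_def)
    then show ?thesis
      using sign_plus[of ?P ?Q "eps l a * eps l c :: 'a", OF h]
      unfolding e1 e2 unfolding Minus root.case m by (simp only: conj_commute)
  next
    case (LPlus i)
    let ?P = "a + 1 = i \<and> c + i = 2 * l"
    have "i \<le> l" using g LPlus by (auto simp: roots_def)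
    then have h: "?P \<Longrightarrow> eps l a * eps l c = (- 1 :: 'a)" by (auto simp: eps_def)
    then show ?thesis
      using sign_long[of ?P "eps l a * eps l c :: 'a", OF h]
      unfolding e1 e2 unfolding LPlus root.case m by (simp only: conj_commute)
  next
    case (LMinus i)
    let ?P = "a + i = 2 * l \<and> c + 1 = i"
    have "i \<le> l" using g LMinus by (auto simp: roots_def)
    then have h: "?P \<Longrightarrow> eps l a * eps l c = (- 1 :: 'a)" by (auto simp: eps_def)
    then show ?thesis
      using sign_long[of ?P "eps l a * eps l c :: 'a", OF h]
      unfolding e1 e2 unfolding LMinus root.case m by (simp only: conj_commute)
  qed
qed

lemma int_basis_similitude:
  assumes "p \<in> ad_index l" shows "similitude l (if p = Half then 1 else 0) (int_basis l p)"
proof (rule similitudeI)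
  fix a c assume ac: "a < 2 * l" "c < 2 * l"
  define a' where "a' = 2 * l - 1 - a"
  define c' where "c' = 2 * l - 1 - c"
  have m: "a + a' + 1 = 2 * l" "c + c' + 1 = 2 * l" using ac by (auto simp: a'_def c'_def)
  have lt: "a' < 2 * l" "c' < 2 * l" using m by auto
  have "int_basis l p $$ (a, c) + eps l a * eps l c * int_basis l p $$ (c', a') =
      (if a = c then if p = Half then 1 else 0 else 0)"
  proof (cases p)
    case (Rt \<gamma>)
    then show ?thesis using chev_X_mirror[OF _ ac m, of \<gamma>] assms by (auto simp: ad_index_def)
  next
    case (Cr i)
    then have i: "1 \<le> i" "i \<le> l" using assms by (auto simp: ad_index_def)
    show ?thesis
    proof (cases "a = c")
      case True
      then have "c' = a'" "eps l a * eps l c = (1 :: 'a)" using m by auto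
      moreover have "a' + 1 = i \<longleftrightarrow> a + i = 2 * l" "a' + i = 2 * l \<longleftrightarrow> a + 1 = i" using m by linarith+
      moreover have "\<not> (a + 1 = i \<and> a + i = 2 * l)" using i by linarith
      ultimately show ?thesis
        unfolding Cr int_basis.simps chev_h_entry[OF i ac] chev_h_entry[OF i lt(2,1)] using True by auto
    next
      case False
      then have "c' \<noteq> a'" using m by auto
      then show ?thesis
        unfolding Cr int_basis.simps chev_h_entry[OF i ac] chev_h_entry[OF i lt(2,1)] using False by simp
    qed
  next
    case Half
    show ?thesis
    proof (cases "a = c")
      case True
      then have "c' = a'" "a' < l \<longleftrightarrow> \<not> a < l" using m by linarith+
      then show ?thesis using Half ac lt True by simp
    next
      case False
      then have "c' \<noteq> a'" using m by auto
      then show ?thesis using Half ac lt False by simp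
    qed
  qed
  then show "int_basis l p $$ (a, c) + eps l a * eps l c * int_basis l p $$ (2 * l - 1 - c, 2 * l - 1 - a) =
      (if a = c then if p = Half then 1 else 0 else 0)" unfolding a'_def c'_def .
qed simp

lemma similitude_chev_X: "\<gamma> \<in> roots l \<Longrightarrow> similitude l 0 (chev_X l \<gamma>)"
  using int_basis_similitude[of "Rt \<gamma>" l] by (simp add: ad_index_def)

section \<open>Coordinates of similitudes modulo scalars\<close>

definition comb :: "nat \<Rightarrow> (ad_ix \<Rightarrow> 'a::comm_ring_1) \<Rightarrow> nat \<Rightarrow> nat \<Rightarrow> 'a" where
  "comb l y a c = (\<Sum>p\<in>ad_index l. y p * int_basis l p $$ (a, c))"

lemma comb_root:
  assumes "\<gamma> \<in> roots l"
  shows "comb l y (fst (entry_pos l \<gamma>)) (snd (entry_pos l \<gamma>)) = y (Rt \<gamma>)"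
proof -
  have "comb l y (fst (entry_pos l \<gamma>)) (snd (entry_pos l \<gamma>)) = (\<Sum>p\<in>ad_index l. if p = Rt \<gamma> then y p else 0)"
    unfolding comb_def by (intro sum.cong refl) (simp add: int_basis_entry_root[OF assms])
  also have "\<dots> = y (Rt \<gamma>)" using assms by (simp add: ad_index_iff)
  finally show ?thesis .
qed

lemma chev_X_diag0: "\<gamma> \<in> roots l \<Longrightarrow> a < 2 * l \<Longrightarrow> chev_X l \<gamma> $$ (a, a) = (0 :: 'a::comm_ring_1)"
proof -
  assume g: "\<gamma> \<in> roots l" "a < 2 * l"
  have "a + a + 1 \<noteq> 2 * l" by presburger
  then show ?thesis unfolding chev_X_entry[OF g g(2)] using g(1)
    by (cases \<gamma>) (auto simp: roots_def)
qed

lemma comb_diag: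
  assumes "a < l"
  shows "comb l y a a = (if a \<ge> 1 then y (Cr (a + 1)) else 0) + y Half"
proof -
  have "comb l y a a = (\<Sum>p\<in>ad_index l. (if p = Cr (a + 1) then y p else 0) + (if p = Half then y p else 0))"
    unfolding comb_def using assms
    by (intro sum.cong refl) (auto simp: ad_index_def chev_X_diag0 chev_h_entry split: if_splits)
  also have "\<dots> = (if a \<ge> 1 then y (Cr (a + 1)) else 0) + y Half"
    using assms by (simp add: sum.distrib ad_index_iff)
  finally show ?thesis .
qed

text \<open>The only coroot with an entry here would be \<open>chev_h l 1\<close>, which the basis
  omits, and the integral form of \<open>Half\<close> lives on the first half. Hence this entry of a
  similitude measures its scalar part.\<close>

lemma comb_last:
  assumes "1 \<le> l" shows "comb l y (2 * l - 1) (2 * l - 1) = 0"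
  unfolding comb_def using assms
  by (intro sum.neutral) (auto simp: ad_index_def chev_X_diag0 chev_h_entry)

lemma similitude_comb: "similitude l (y Half) (mat (2 * l) (2 * l) (\<lambda>(a, c). comb l y a c))"
proof (rule similitudeI)
  fix a c assume ac: "a < 2 * l" "c < 2 * l"
  let ?e = "eps l a * eps l c" and ?a = "2 * l - 1 - c" and ?c = "2 * l - 1 - a"
  have "comb l y a c + ?e * comb l y ?a ?c =
      (\<Sum>p\<in>ad_index l. y p * (int_basis l p $$ (a, c) + ?e * int_basis l p $$ (?a, ?c)))"
    unfolding comb_def sum_distrib_left sum.distrib[symmetric]
    by (intro sum.cong refl) (simp only: distrib_left mult.left_commute)
  also have "\<dots> = (\<Sum>p\<in>ad_index l. if p = Half then if a = c then y p else 0 else 0)"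
  proof (intro sum.cong refl)
    fix p assume "p \<in> ad_index l"
    note * = similitudeD[OF int_basis_similitude[OF this] ac]
    show "y p * (int_basis l p $$ (a, c) + ?e * int_basis l p $$ (?a, ?c)) =
        (if p = Half then if a = c then y p else 0 else 0)"
      unfolding * by simp
  qed
  also have "\<dots> = (if a = c then y Half else 0)" by (simp add: ad_index_iff)
  finally show "mat (2 * l) (2 * l) (\<lambda>(a, c). comb l y a c) $$ (a, c)
     + ?e * mat (2 * l) (2 * l) (\<lambda>(a, c). comb l y a c) $$ (?a, ?c) = (if a = c then y Half else 0)"
    using ac by simp
qed simp

text \<open>Every off-diagonal position is \<open>entry_pos\<close> of a root or the mirror of one,
  and the first and last diagonal entries add up to \<open>\<mu>\<close>; so the tested entries
  determine all others.\<close>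

lemma similitude_zero:
  assumes M: "similitude l \<mu> M" and l: "1 \<le> l"
    and roots: "\<And>\<gamma>. \<gamma> \<in> roots l \<Longrightarrow> M $$ entry_pos l \<gamma> = 0"
    and diag: "\<And>a. a < l \<Longrightarrow> M $$ (a, a) = 0" and last: "M $$ (2 * l - 1, 2 * l - 1) = 0"
    and ac: "a < 2 * l" "c < 2 * l"
  shows "M $$ (a, c) = 0"
proof -
  let ?m = "\<lambda>a. 2 * l - 1 - a"
  have \<mu>: "\<mu> = 0" using similitudeD[OF M, of 0 0] diag[of 0] last l by (simp add: eps_def)
  have rel: "M $$ (a, c) = 0" if "M $$ (?m c, ?m a) = 0"
    using similitudeD[OF M ac] that \<mu> by (simp split: if_splits)
  have pos: "M $$ p = 0" if "\<exists>\<gamma>\<in>roots l. entry_pos l \<gamma> = p" for p using roots that by auto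
  consider "a < l" "c < l" | "a \<ge> l" "c \<ge> l" | "a < l" "c \<ge> l" | "a \<ge> l" "c < l" by linarith
  then show ?thesis
  proof cases
    case 1
    have "a \<noteq> c \<Longrightarrow> M $$ (a, c) = 0"
      by (rule pos, rule bexI[of _ "Diff (a + 1) (c + 1)"]) (use 1 in \<open>auto simp: roots_def\<close>)
    then show ?thesis using diag 1 by blast
  next
    case 2
    have "a \<noteq> c \<Longrightarrow> M $$ (?m c, ?m a) = 0"
      by (rule pos, rule bexI[of _ "Diff (2 * l - c) (2 * l - a)"]) (use 2 ac in \<open>auto simp: roots_def\<close>)
    moreover have "M $$ (?m a, ?m a) = 0" using diag[of "?m a"] 2 l by simp
    ultimately show ?thesis using rel by blast
  next
    case 3
    consider "a + 1 < 2 * l - c" | "a + 1 = 2 * l - c" | "a + 1 > 2 * l - c" by linarith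
    then show ?thesis
    proof cases
      case 1
      show ?thesis by (rule pos, rule bexI[of _ "Plus (a + 1) (2 * l - c)"]) (use 3 1 ac in \<open>auto simp: roots_def\<close>)
    next
      case 2
      show ?thesis by (rule pos, rule bexI[of _ "LPlus (a + 1)"]) (use 3 2 ac in \<open>auto simp: roots_def\<close>)
    next
      case h: 3
      show ?thesis by (rule rel, rule pos, rule bexI[of _ "Plus (2 * l - c) (a + 1)"])
          (use 3 h ac in \<open>auto simp: roots_def\<close>)
    qed
  next
    case 4
    consider "c + 1 > 2 * l - a" | "c + 1 = 2 * l - a" | "c + 1 < 2 * l - a" by linarith
    then show ?thesis
    proof cases
      case 1
      show ?thesis by (rule pos, rule bexI[of _ "Minus (2 * l - a) (c + 1)"]) (use 4 1 ac in \<open>auto simp: roots_def\<close>)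
    next
      case 2
      show ?thesis by (rule pos, rule bexI[of _ "LMinus (c + 1)"]) (use 4 2 ac in \<open>auto simp: roots_def\<close>)
    next
      case h: 3
      show ?thesis by (rule rel, rule pos, rule bexI[of _ "Minus (c + 1) (2 * l - a)"])
          (use 4 h ac in \<open>auto simp: roots_def\<close>)
    qed
  qed
qed

text \<open>The last diagonal entry is taken as the scalar part. What remains at (0, 0) is the
  \<open>Half\<close> coordinate, and \<open>chev_h l i\<close> is read off at its entry -1.\<close>

definition coords :: "nat \<Rightarrow> 'a::comm_ring_1 mat \<Rightarrow> ad_ix \<Rightarrow> 'a" where
  "coords l M p = (if p \<in> ad_index l then case p of Rt \<gamma> \<Rightarrow> M $$ entry_pos l \<gamma>
     | Cr i \<Rightarrow> M $$ (2 * l - 1, 2 * l - 1) - M $$ (2 * l - i, 2 * l - i)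
     | Half \<Rightarrow> M $$ (0, 0) - M $$ (2 * l - 1, 2 * l - 1) else 0)"

text \<open>The difference of both sides is a similitude vanishing at the positions tested by
  \<open>similitude_zero\<close>.\<close>

lemma similitude_coords:
  assumes M: "similitude l \<mu> M" and l: "1 \<le> l" and ac: "a < 2 * l" "c < 2 * l"
  shows "M $$ (a, c) = comb l (coords l M) a c + (if a = c then M $$ (2 * l - 1, 2 * l - 1) else 0)"
proof -
  define d where "d = M $$ (2 * l - 1, 2 * l - 1)"
  let ?C = "mat (2 * l) (2 * l) (\<lambda>(a, c). comb l (- coords l M) a c)"
  let ?I = "mat (2 * l) (2 * l) (\<lambda>(a, c). if a = c then - d else 0)"
  let ?D = "M + ?C + ?I"
  have Mc: "M \<in> carrier_mat (2 * l) (2 * l)" using M by (simp add: similitude_def)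
  have I: "similitude l (- (2 * d)) ?I"
    by (rule similitudeI) (auto simp: eps_def)
  have D: "similitude l (\<mu> + (- coords l M) Half + - (2 * d)) ?D"
    by (intro similitude_add M similitude_comb I)
  have neg: "comb l (- y) a c = - comb l y a c" for y :: "ad_ix \<Rightarrow> 'a" and a c
    by (simp add: comb_def sum_negf)
  have De: "?D $$ (a, c) = M $$ (a, c) - comb l (coords l M) a c - (if a = c then d else 0)"
    if "a < 2 * l" "c < 2 * l" for a c using that Mc by (simp add: neg)
  have z: "?D $$ (a, c) = 0"
  proof (rule similitude_zero[OF D l _ _ _ ac])
    fix \<gamma> assume g: "\<gamma> \<in> roots l"
    obtain a c where e: "entry_pos l \<gamma> = (a, c)" by force
    have lt: "a < 2 * l" "c < 2 * l" "a \<noteq> c"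
      using entry_pos_less[OF g] entry_pos_ne[OF g] e by auto
    have "comb l (coords l M) a c = M $$ (a, c)"
      using comb_root[OF g, of "coords l M"] g e by (simp add: coords_def ad_index_iff)
    then show "?D $$ entry_pos l \<gamma> = 0" unfolding e De[OF lt(1,2)] using lt by simp
  next
    fix a assume a: "a < l"
    have h: "Cr (a + 1) \<in> ad_index l" if "a \<ge> 1" using a that by (simp add: ad_index_iff)
    have "M $$ (a, a) + M $$ (2 * l - 1 - a, 2 * l - 1 - a) = \<mu>"
      using similitudeD[OF M, of a a] a by (simp add: eps_def)
    moreover have "M $$ (0, 0) + d = \<mu>" 
      using similitudeD[OF M, of 0 0] l by (simp add: eps_def d_def)
    ultimately have r: "M $$ (a, a) = M $$ (0, 0) + d - M $$ (2 * l - 1 - a, 2 * l - 1 - a)"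
      by (simp add: algebra_simps)
    show "?D $$ (a, a) = 0"
    proof (cases "a = 0")
      case True
      then show ?thesis using De[of 0 0] comb_diag[of 0 l "coords l M"] l
        by (simp add: coords_def ad_index_iff d_def)
    next
      case False
      then show ?thesis using De[of a a] comb_diag[OF a, of "coords l M"] a h
        by (simp add: coords_def ad_index_iff d_def[symmetric] r)
    qed
  next
    show "?D $$ (2 * l - 1, 2 * l - 1) = 0"
      using De[of "2 * l - 1" "2 * l - 1"] comb_last[OF l, of "coords l M"] l by (simp add: d_def)
  qed
  have "M $$ (a, c) - (comb l (coords l M) a c + (if a = c then d else 0)) = 0"
    using De[OF ac] unfolding z by (simp only: diff_diff_eq)
  then show ?thesis unfolding d_def by (simp only: right_minus_eq)
qed

lemma coords_outside: "p \<notin> ad_index l \<Longrightarrow> coords l M p = 0"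
  by (simp add: coords_def)

subsection \<open>Coordinates of the divided powers of \<open>ad X\<^sub>\<gamma>\<close>\<close>

lemma ad_coords_eq:
  assumes "1 \<le> l" "A = z_comb l c" "\<And>p. p \<notin> ad_index l \<Longrightarrow> c p = 0"
  shows "ad_coords l A = c"
  unfolding ad_coords_def
proof (rule the_equality)
  show "(\<forall>p. p \<notin> ad_index l \<longrightarrow> c p = 0) \<and> A = z_comb l c" using assms by auto
  fix e assume e: "(\<forall>p. p \<notin> ad_index l \<longrightarrow> e p = 0) \<and> A = z_comb l e"
  show "e = c"
  proof
    fix p show "e p = c p"
      using e assms z_comb_inj[OF assms(1), of e c p] by (cases "p \<in> ad_index l") auto
  qed
qed

lemma ad_coords_basis:
  assumes "1 \<le> l" "q \<in> ad_index l"
  shows "ad_coords l (ad_basis l q) = (\<lambda>p. if p = q then 1 else 0)"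
proof (rule ad_coords_eq[OF assms(1) z_comb_single[OF assms(2), symmetric]])
  fix p assume "p \<notin> ad_index l"
  then have "p \<noteq> q" using assms(2) by blast
  then show "(if p = q then 1 else 0) = (0 :: int)" by simp
qed

lemma z_comb_entry:
  assumes "a < 2 * l" "c < 2 * l"
  shows "z_comb l y $$ (a, c) = of_int (comb l y a c) - (if a = c then of_int (y Half) / 2 else 0)"
proof -
  have "z_comb l y $$ (a, c) = (\<Sum>p\<in>ad_index l. of_int (y p * int_basis l p $$ (a, c))
      - (if p = Half then if a = c then of_int (y p) / 2 else 0 else 0))"
    using assms unfolding z_comb_def
    by (auto intro!: sum.cong simp: ad_basis_int int_basis_of_int[of _ l a c, where ?'a = rat] algebra_simps)
  also have "\<dots> = of_int (comb l y a c) - (if a = c then of_int (y Half) / 2 else 0)"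
    by (simp add: sum_subtractf comb_def ad_index_iff)
  finally show ?thesis .
qed

text \<open>For multiplier 0 the scalar left over in \<open>similitude_coords\<close> is absorbed:
  the \<open>Half\<close> coordinate is minus twice that scalar, and \<open>half_H\<close> differs
  from its integral form by -1/2.\<close>

lemma z_comb_coords:
  assumes T: "similitude l 0 (T :: int mat)" and l: "1 \<le> l"
  shows "z_comb l (coords l T) = map_mat of_int T"
proof (rule eq_matI)
  have Tc: "T \<in> carrier_mat (2 * l) (2 * l)" using T by (simp add: similitude_def)
  fix a c assume "a < dim_row (map_mat of_int T :: rat mat)" "c < dim_col (map_mat of_int T :: rat mat)"
  then have ac: "a < 2 * l" "c < 2 * l" using Tc by auto
  have "T $$ (0, 0) + T $$ (2 * l - 1, 2 * l - 1) = 0"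
    using similitudeD[OF T, of 0 0] l by (simp add: eps_def)
  then have "coords l T Half = - 2 * T $$ (2 * l - 1, 2 * l - 1)"
    by (simp add: coords_def ad_index_iff)
  then show "z_comb l (coords l T) $$ (a, c) = map_mat of_int T $$ (a, c)"
    using ac Tc similitude_coords[OF T l ac] by (simp add: z_comb_entry)
qed (use T in \<open>auto simp: z_comb_def similitude_def\<close>)

lemma ad_coords_int:
  assumes "similitude l 0 (T :: int mat)" "1 \<le> l"
  shows "ad_coords l (map_mat of_int T) = coords l T"
  by (rule ad_coords_eq[OF assms(2)]) (simp_all add: z_comb_coords[OF assms] coords_outside)

lemma chev_X_map:
  assumes "\<gamma> \<in> roots l"
  shows "map_mat of_int (chev_X l \<gamma>) = (chev_X l \<gamma> :: 'a::comm_ring_1 mat)"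
  by (rule eq_matI) (use chev_X_of_int[OF assms, where ?'a = 'a] in \<open>auto simp: carrier_matD[OF chev_X_carrier]\<close>)

lemma int_basis_map:
  assumes "p \<in> ad_index l"
  shows "map_mat of_int (int_basis l p) = (int_basis l p :: 'a::comm_ring_1 mat)"
  by (rule eq_matI) (use int_basis_of_int[OF assms, where ?'a = 'a] in auto)

lemma ad_basis_half:
  assumes "p \<in> ad_index l"
  shows "ad_basis l p = int_basis l p + (if p = Half then - 1 / 2 else 0) \<cdot>\<^sub>m 1\<^sub>m (2 * l)"
  by (rule eq_matI) (use ad_basis_int[OF assms] in \<open>auto simp: carrier_matD[OF ad_basis_carrier]\<close>)

text \<open>This and \<open>sandwich_term\<close> are ad(X) and ad(X)^2 / 2 at a basis element,
  written without division so that they make sense over any ring.\<close>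

definition bracket_term :: "nat \<Rightarrow> root \<Rightarrow> ad_ix \<Rightarrow> 'a::comm_ring_1 mat" where
  "bracket_term l \<gamma> q = chev_X l \<gamma> * int_basis l q - int_basis l q * chev_X l \<gamma>"

definition sandwich_term :: "nat \<Rightarrow> root \<Rightarrow> ad_ix \<Rightarrow> 'a::comm_ring_1 mat" where
  "sandwich_term l \<gamma> q = - (chev_X l \<gamma> * int_basis l q * chev_X l \<gamma>)"

lemma bracket_term_map:
  assumes "\<gamma> \<in> roots l" "q \<in> ad_index l"
  shows "map_mat of_int (bracket_term l \<gamma> q) = (bracket_term l \<gamma> q :: 'a::comm_ring_1 mat)"
proof -
  have *: "map_mat of_int (A - B) = map_mat of_int A - (map_mat of_int B :: 'a mat)"
    if "A \<in> carrier_mat (2 * l) (2 * l)" "B \<in> carrier_mat (2 * l) (2 * l)" for A B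
    using that by (intro eq_matI) auto
  show ?thesis
    unfolding bracket_term_def
    by (simp add: * mult_carrier_mat[OF chev_X_carrier int_basis_carrier]
        mult_carrier_mat[OF int_basis_carrier chev_X_carrier]
        of_int_hom.mat_hom_mult[OF chev_X_carrier int_basis_carrier]
        of_int_hom.mat_hom_mult[OF int_basis_carrier chev_X_carrier] chev_X_map[OF assms(1)] int_basis_map[OF assms(2)])
qed

lemma sandwich_term_map:
  assumes "\<gamma> \<in> roots l" "q \<in> ad_index l"
  shows "map_mat of_int (sandwich_term l \<gamma> q) = (sandwich_term l \<gamma> q :: 'a::comm_ring_1 mat)"
proof -
  have *: "map_mat of_int (- A) = - (map_mat of_int A :: 'a mat)" for A
    by (intro eq_matI) auto
  have c: "chev_X l \<gamma> * int_basis l q \<in> carrier_mat (2 * l) (2 * l)"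
    by (rule mult_carrier_mat[OF chev_X_carrier int_basis_carrier])
  show ?thesis
    unfolding sandwich_term_def
    by (simp add: * of_int_hom.mat_hom_mult[OF c chev_X_carrier]
        of_int_hom.mat_hom_mult[OF chev_X_carrier int_basis_carrier] chev_X_map[OF assms(1)] int_basis_map[OF assms(2)])
qed

lemma bracket_term_similitude:
  assumes "\<gamma> \<in> roots l" "q \<in> ad_index l" shows "similitude l 0 (bracket_term l \<gamma> q)"
  unfolding bracket_term_def
  by (rule similitude_bracket[OF similitude_chev_X[OF assms(1)] int_basis_similitude[OF assms(2)]])

lemma sandwich_term_similitude:
  assumes "\<gamma> \<in> roots l" "q \<in> ad_index l" shows "similitude l 0 (sandwich_term l \<gamma> q)"
  unfolding sandwich_term_def
  by (rule similitude_sandwich[OF similitude_chev_X[OF assms(1)] int_basis_similitude[OF assms(2)] chev_X_square[OF assms(1)]])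

lemma ad_bracket:
  assumes "q \<in> ad_index l"
  shows "ad (chev_X l \<gamma>) (ad_basis l q) = bracket_term l \<gamma> q"
proof -
  let ?n = "2 * l" and ?X = "chev_X l \<gamma> :: rat mat" and ?B = "int_basis l q :: rat mat"
  define d where "d = (if q = Half then - 1 / 2 else 0 :: rat)"
  have c: "?X \<in> carrier_mat ?n ?n" "?B \<in> carrier_mat ?n ?n" "d \<cdot>\<^sub>m 1\<^sub>m ?n \<in> carrier_mat ?n ?n" by auto
  note P = mult_carrier_mat[OF c(1,2)] mult_carrier_mat[OF c(2,1)] smult_carrier_mat[OF c(1), of d]
  have cancel: "(P + D) - (Q + D) = P - Q"
    if "P \<in> carrier_mat ?n ?n" "Q \<in> carrier_mat ?n ?n" "D \<in> carrier_mat ?n ?n" for P Q D :: "rat mat"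
    using that by (intro eq_matI) auto
  have "?X * (?B + d \<cdot>\<^sub>m 1\<^sub>m ?n) = ?X * ?B + d \<cdot>\<^sub>m ?X"
    using mult_add_distrib_mat[OF c] mult_smult_distrib[OF c(1) one_carrier_mat] right_mult_one_mat[OF c(1)] by simp
  moreover have "(?B + d \<cdot>\<^sub>m 1\<^sub>m ?n) * ?X = ?B * ?X + d \<cdot>\<^sub>m ?X"
    using add_mult_distrib_mat[OF c(2,3,1)] mult_smult_assoc_mat[OF one_carrier_mat c(1)] left_mult_one_mat[OF c(1)] by simp
  ultimately show ?thesis
    unfolding ad_def bracket_term_def ad_basis_half[OF assms] d_def[symmetric]
    by (simp only: cancel[OF P])
qed

text \<open>With X^2 = 0 the double bracket is -2 X B X, so the division by 2 is exact.\<close>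

lemma ad_sandwich:
  assumes "\<gamma> \<in> roots l" "q \<in> ad_index l"
  shows "(1 / 2) \<cdot>\<^sub>m ad (chev_X l \<gamma>) (ad (chev_X l \<gamma>) (ad_basis l q)) = sandwich_term l \<gamma> q"
proof -
  let ?n = "2 * l" and ?X = "chev_X l \<gamma> :: rat mat" and ?B = "int_basis l q :: rat mat"
  have X: "?X \<in> carrier_mat ?n ?n" and B: "?B \<in> carrier_mat ?n ?n" by auto
  note c = mult_carrier_mat[OF X B] mult_carrier_mat[OF B X]
  have P: "?X * ?B * ?X \<in> carrier_mat ?n ?n" using mult_carrier_mat[OF c(1) X] .
  have half: "(1 / 2) \<cdot>\<^sub>m ((0\<^sub>m ?n ?n - P) - (P - 0\<^sub>m ?n ?n)) = - P" if "P \<in> carrier_mat ?n ?n" for P :: "rat mat"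
    using that by (intro eq_matI) auto
  have XXB: "?X * (?X * ?B) = 0\<^sub>m ?n ?n"
    using assoc_mult_mat[OF X X B] chev_X_square[OF assms(1), where ?'a = rat] B by simp
  have BXX: "?B * ?X * ?X = 0\<^sub>m ?n ?n"
    using assoc_mult_mat[OF B X X] chev_X_square[OF assms(1), where ?'a = rat] B by simp
  have "?X * (?X * ?B - ?B * ?X) = 0\<^sub>m ?n ?n - ?X * ?B * ?X"
    using mult_minus_distrib_mat[OF X c] XXB assoc_mult_mat[OF X B X] by simp
  moreover have "(?X * ?B - ?B * ?X) * ?X = ?X * ?B * ?X - 0\<^sub>m ?n ?n"
    using minus_mult_distrib_mat[OF c X] BXX by simp
  ultimately show ?thesis
    unfolding ad_bracket[OF assms(2)] unfolding bracket_term_def sandwich_term_def ad_def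
    by (simp only: half[OF P])
qed

text \<open>This removes \<open>THE\<close> and rational matrices from the definition of the action:
  its coefficients are images of integers read off from two integral matrices.\<close>

lemma divided_power_coords:
  assumes l: "1 \<le> l" and g: "\<gamma> \<in> roots l" and q: "q \<in> ad_index l"
  shows "(\<Sum>k\<le>2. t ^ k * of_int (ad_coords l (inverse (fact k) \<cdot>\<^sub>m (ad (chev_X l \<gamma>) ^^ k) (ad_basis l q)) p))
    = (if p = q then 1 else 0) + (t * of_int (coords l (bracket_term l \<gamma> q) p)
      + t ^ 2 * (of_int (coords l (sandwich_term l \<gamma> q) p) :: 'a::comm_ring_1))"
proof -
  let ?M = "\<lambda>k. inverse (fact k) \<cdot>\<^sub>m (ad (chev_X l \<gamma>) ^^ k) (ad_basis l q)"
  have one: "inverse 1 \<cdot>\<^sub>m A = A" for A :: "rat mat" by (intro eq_matI) auto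
  have 0: "ad_coords l (?M 0) p = (if p = q then 1 else 0)"
    unfolding funpow.simps fact_0 one id_apply ad_coords_basis[OF l q] ..
  have "?M 1 = ad (chev_X l \<gamma>) (ad_basis l q)"
    unfolding fact_1 one by simp
  then have "?M 1 = map_mat of_int (bracket_term l \<gamma> q)"
    by (simp only: ad_bracket[OF q] bracket_term_map[OF g q])
  then have 1: "ad_coords l (?M 1) p = coords l (bracket_term l \<gamma> q) p"
    by (simp only: ad_coords_int[OF bracket_term_similitude[OF g q] l])
  have "inverse (fact 2) = (1 / 2 :: rat)" by simp
  moreover have "(ad (chev_X l \<gamma>) ^^ 2) (ad_basis l q) = ad (chev_X l \<gamma>) (ad (chev_X l \<gamma>) (ad_basis l q))"
    by (simp add: numeral_2_eq_2)
  ultimately have "?M 2 = map_mat of_int (sandwich_term l \<gamma> q)"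
    by (simp only: ad_sandwich[OF g q] sandwich_term_map[OF g q])
  then have 2: "ad_coords l (?M 2) p = coords l (sandwich_term l \<gamma> q) p"
    by (simp only: ad_coords_int[OF sandwich_term_similitude[OF g q] l])
  have "{..2} = {0, 1, 2 :: nat}" by auto
  then have sum: "(\<Sum>k\<le>2. f k) = f 0 + (f 1 + f 2)" for f :: "nat \<Rightarrow> 'a" by simp
  show ?thesis unfolding sum 0 1 2 by simp
qed

lemma root_act_ad_eq:
  assumes l: "1 \<le> l" and g: "\<gamma> \<in> roots l" and p: "p \<in> ad_index l"
  shows "root_act_ad l \<gamma> t y p = y p + (\<Sum>q\<in>ad_index l.
    (t * of_int (coords l (bracket_term l \<gamma> q) p) + t ^ 2 * of_int (coords l (sandwich_term l \<gamma> q) p)) * y q)"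
proof -
  let ?c = "\<lambda>q. t * of_int (coords l (bracket_term l \<gamma> q) p) + t ^ 2 * of_int (coords l (sandwich_term l \<gamma> q) p)"
  have "root_act_ad l \<gamma> t y p = (\<Sum>q\<in>ad_index l. ((if p = q then 1 else 0) + ?c q) * y q)"
    unfolding root_act_ad_def by (intro sum.cong refl) (simp only: divided_power_coords[OF l g])
  also have "\<dots> = (\<Sum>q\<in>ad_index l. (if p = q then y q else 0) + ?c q * y q)"
    by (intro sum.cong refl) (simp only: distrib_right if_distrib[of "\<lambda>x. x * _"] mult_1_left mult_zero_left)
  also have "\<dots> = y p + (\<Sum>q\<in>ad_index l. ?c q * y q)"
    unfolding sum.distrib using p by simp
  finally show ?thesis .
qed

lemma root_act_ad_outside:
  assumes l: "1 \<le> l" and g: "\<gamma> \<in> roots l" and p: "p \<notin> ad_index l"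
  shows "root_act_ad l \<gamma> t y p = 0"
  unfolding root_act_ad_def
proof (rule sum.neutral, rule ballI)
  fix q assume q: "q \<in> ad_index l"
  have "p \<noteq> q" using p q by blast
  then show "(\<Sum>k\<le>2. t ^ k * of_int (ad_coords l (inverse (fact k) \<cdot>\<^sub>m (ad (chev_X l \<gamma>) ^^ k) (ad_basis l q)) p)) * y q = 0"
    unfolding divided_power_coords[OF l g q] coords_outside[OF p] by simp
qed

section \<open>The adjoint module inside \<open>End(V)\<close> modulo scalars\<close>

context symplectic_char2
begin

definition act :: "'k mat \<Rightarrow> 'v \<Rightarrow> 'v" where "act = mat_act scale (2 * l) v"

lemma act_eq: "act A x = (\<Sum>i\<in>ix. \<Sum>j\<in>ix. scale (A $$ (i - 1, j - 1) * b x (v (op j))) (v i))"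
  by (simp add: act_def mat_act_eq)

lemma root_elt_act: "root_elt scale l v \<gamma> t x = x + scale t (act (chev_X l \<gamma>) x)"
  by (simp add: root_elt_def act_def)

lemma lin_act: "lin (act M)"
  by (rule linI)
    (simp_all add: act_eq distrib_left scale_left_distrib sum.distrib scale_sum_right mult_ac)

lemma act_v:
  assumes "j \<in> ix" shows "act M (v j) = (\<Sum>i\<in>ix. scale (M $$ (i - 1, j - 1)) (v i))"
proof -
  have "(\<Sum>q\<in>ix. scale (M $$ (i - 1, q - 1) * b (v j) (v (op q))) (v i)) =
      (\<Sum>q\<in>ix. if q = j then scale (M $$ (i - 1, j - 1)) (v i) else 0)" for i
    using assms by (intro sum.cong refl) (auto simp: gram op_eq_iff)
  then show ?thesis using assms by (simp add: act_eq)
qed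

lemma b_act_v:
  assumes "i \<in> ix" "j \<in> ix" shows "b (act M (v j)) (v i) = M $$ (op i - 1, j - 1)"
proof -
  have "b (act M (v j)) (v i) = (\<Sum>q\<in>ix. M $$ (q - 1, j - 1) * b (v q) (v i))"
    using assms by (simp add: act_v b_sum_left)
  also have "\<dots> = (\<Sum>q\<in>ix. if q = op i then M $$ (op i - 1, j - 1) else 0)"
  proof (intro sum.cong refl)
    fix q assume q: "q \<in> ix"
    have "i = op q \<longleftrightarrow> q = op i" using assms q by auto
    then show "M $$ (q - 1, j - 1) * b (v q) (v i) = (if q = op i then M $$ (op i - 1, j - 1) else 0)"
      using assms q by (simp add: gram)
  qed
  finally show ?thesis using assms by simp
qed

lemma lin_eq_by_gram:
  assumes "lin f" "lin g" "\<And>i j. i \<in> ix \<Longrightarrow> j \<in> ix \<Longrightarrow> b (f (v j)) (v i) = b (g (v j)) (v i)"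
  shows "f = g"
  using assms by (intro lin_eq_on_basis eq_by_gram)

lemma lin_sum_scale:
  assumes "\<And>p. p \<in> S \<Longrightarrow> lin (f p)"
  shows "lin (\<lambda>x. (\<Sum>p\<in>S. scale (c p) (f p x)) + scale d x)"
  by (rule linI) (simp_all add: assms lin_add lin_scale sum.distrib scale_right_distrib
      scale_sum_right mult_ac add_ac cong: sum.cong)

lemma act_lincomb:
  assumes "\<And>a c. a < 2 * l \<Longrightarrow> c < 2 * l \<Longrightarrow> M $$ (a, c) = (\<Sum>p\<in>S. y p * B p $$ (a, c)) + (if a = c then d else 0)"
  shows "act M x = (\<Sum>p\<in>S. scale (y p) (act (B p) x)) + scale d x"
proof -
  have "act M = (\<lambda>x. (\<Sum>p\<in>S. scale (y p) (act (B p) x)) + scale d x)"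
  proof (rule lin_eq_by_gram[OF lin_act])
    show "lin (\<lambda>x. (\<Sum>p\<in>S. scale (y p) (act (B p) x)) + scale d x)"
      by (rule lin_sum_scale) (rule lin_act)
    fix i j assume ij: "i \<in> ix" "j \<in> ix"
    have "op i - 1 < 2 * l" "j - 1 < 2 * l" "op i - 1 = j - 1 \<longleftrightarrow> i = op j"
      using ij l_pos by (auto simp: ix_def op_def)
    then show "b (act M (v j)) (v i) = b ((\<Sum>p\<in>S. scale (y p) (act (B p) (v j))) + scale d (v j)) (v i)"
      using ij assms by (simp add: b_act_v b_sum_left gram)
  qed
  then show ?thesis by (rule fun_cong)
qed

lemma act_mult:
  assumes M: "M \<in> carrier_mat (2 * l) (2 * l)" and N: "N \<in> carrier_mat (2 * l) (2 * l)"
  shows "act (M * N) x = act M (act N x)"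
proof -
  have "act (M * N) = (\<lambda>x. act M (act N x))"
  proof (rule lin_eq_by_gram[OF lin_act])
    show "lin (\<lambda>x. act M (act N x))"
      by (rule linI) (simp_all add: lin_add[OF lin_act] lin_scale[OF lin_act])
    fix i j assume ij: "i \<in> ix" "j \<in> ix"
    have lt: "op i - 1 < 2 * l" "j - 1 < 2 * l" using ij l_pos by (auto simp: ix_def op_def)
    have "b (act (M * N) (v j)) (v i) = (\<Sum>k\<in>{0..<2 * l}. M $$ (op i - 1, k) * N $$ (k, j - 1))"
      using ij lt M N by (simp add: b_act_v scalar_prod_def)
    also have "\<dots> = (\<Sum>q\<in>ix. M $$ (op i - 1, q - 1) * N $$ (q - 1, j - 1))"
      by (rule sum.reindex_bij_witness[of _ "\<lambda>q. q - 1" Suc]) (auto simp: ix_def)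
    also have "\<dots> = b (act M (act N (v j))) (v i)"
      using ij by (simp add: act_v[of j N] lin_sum[OF lin_act] lin_scale[OF lin_act] b_sum_left b_act_v mult.commute)
    finally show "b (act (M * N) (v j)) (v i) = b (act M (act N (v j))) (v i)" .
  qed
  then show ?thesis by (rule fun_cong)
qed

lemma span_v: "span (v ` ix) = UNIV"
  using basis by (auto simp: symplectic_basis_def is_basis_of_def ix_def)

lemma gsp_act:
  assumes M: "similitude l \<mu> M" shows "gsp \<mu> (act M)"
proof (rule gsp_spanning[OF span_v lin_act])
  fix x y assume "x \<in> v ` ix" "y \<in> v ` ix"
  then obtain j i where ij: "j \<in> ix" "i \<in> ix" "x = v j" "y = v i" by auto
  have a: "op i - 1 < 2 * l" "j - 1 < 2 * l" "op i - 1 = j - 1 \<longleftrightarrow> i = op j"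
    "2 * l - 1 - (j - 1) = op j - 1" "2 * l - 1 - (op i - 1) = i - 1"
    using ij l_pos by (auto simp: ix_def op_def)
  have e: "eps l a = (1 :: 'k)" for a by (simp add: eps_def)
  have "M $$ (op i - 1, j - 1) + M $$ (op j - 1, i - 1) = (if i = op j then \<mu> else 0)"
    using similitudeD[OF M a(1,2)] unfolding a(3-5) e by simp
  then show "b (act M x) y + b x (act M y) = \<mu> * b x y"
    using ij b_sym[of "v j" "act M (v i)"] by (simp add: b_act_v gram)
qed

lemma gsp_matrix:
  assumes X: "gsp \<mu> X" obtains M where "similitude l \<mu> M" "X = act M"
proof
  \<comment> \<open>Coordinates are pairings with partners; matrix indices start at 0, hence the
    shifts by one.\<close>
  let ?M = "mat (2 * l) (2 * l) (\<lambda>(a, c). b (X (v (c + 1))) (v (op (a + 1))))"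
  have e: "eps l a = (1 :: 'k)" for a by (simp add: eps_def)
  show "similitude l \<mu> ?M"
  proof (rule similitudeI)
    fix a c assume ac: "a < 2 * l" "c < 2 * l"
    then have ix: "a + 1 \<in> ix" "c + 1 \<in> ix" by (auto simp: ix_def)
    have o: "2 * l - 1 - c + 1 = op (c + 1)" "2 * l - 1 - a + 1 = op (a + 1)"
      using ac by (auto simp: op_def)
    have "b (X (v (c + 1))) (v (op (a + 1))) + b (v (c + 1)) (X (v (op (a + 1)))) = \<mu> * b (v (c + 1)) (v (op (a + 1)))"
      using X by (simp add: gsp_def)
    then have "b (X (v (c + 1))) (v (op (a + 1))) + b (X (v (op (a + 1)))) (v (c + 1)) = (if a = c then \<mu> else 0)"
      using gram[OF ix(2) op_ix[OF ix(1)]] op_eq_iff[OF ix] b_sym[of "v (c + 1)"] by simp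
    moreover have "?M $$ (2 * l - 1 - c, 2 * l - 1 - a) = b (X (v (op (a + 1)))) (v (c + 1))"
      using ac ix o by simp
    moreover have "?M $$ (a, c) = b (X (v (c + 1))) (v (op (a + 1)))" using ac by simp
    ultimately show "?M $$ (a, c) + eps l a * eps l c * ?M $$ (2 * l - 1 - c, 2 * l - 1 - a) = (if a = c then \<mu> else 0)"
      unfolding e by simp
  qed simp
  show "X = act ?M"
  proof (rule lin_eq_by_gram[OF _ lin_act])
    show "lin X" using X by (simp add: gsp_def)
    fix i j assume ij: "i \<in> ix" "j \<in> ix"
    then have "op i - 1 < 2 * l" "j - 1 < 2 * l" "op i - 1 + 1 = op i" "j - 1 + 1 = j"
      using op_ix[OF ij(1)] by (auto simp: ix_def)
    then show "b (X (v j)) (v i) = b (act ?M (v j)) (v i)" using ij by (simp add: b_act_v)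
  qed
qed

text \<open>Identifies \<open>g_ad\<close> with \<open>gsp\<close> modulo scalars
  (\<open>gsp_decompose\<close>, \<open>Psi_scalar\<close>), choosing the representative whose last
  diagonal entry is 0.\<close>

definition Psi :: "(ad_ix \<Rightarrow> 'k) \<Rightarrow> 'v \<Rightarrow> 'v" where
  "Psi y x = (\<Sum>p\<in>ad_index l. scale (y p) (act (int_basis l p) x))"

lemma lin_Psi: "lin (Psi y)"
  by (rule linI) (simp_all add: Psi_def lin_add[OF lin_act] lin_scale[OF lin_act] sum.distrib
      scale_right_distrib scale_sum_right mult_ac)

lemma Psi_act: "Psi y = act (mat (2 * l) (2 * l) (\<lambda>(a, c). comb l y a c))"
proof
  fix x show "Psi y x = act (mat (2 * l) (2 * l) (\<lambda>(a, c). comb l y a c)) x"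
    using act_lincomb[where M = "mat (2 * l) (2 * l) (\<lambda>(a, c). comb l y a c)" and S = "ad_index l"
        and y = y and B = "int_basis l" and d = 0 and x = x]
    by (simp add: comb_def Psi_def)
qed

lemma gsp_Psi: "gsp (y Half) (Psi y)"
  unfolding Psi_act by (rule gsp_act[OF similitude_comb])

lemma gsp_decompose:
  assumes "gsp \<mu> X" obtains y d where "y \<in> g_ad l" "\<And>x. X x = Psi y x + scale d x"
proof -
  obtain M where M: "similitude l \<mu> M" "X = act M" using gsp_matrix[OF assms] .
  have "X x = Psi (coords l M) x + scale (M $$ (2 * l - 1, 2 * l - 1)) x" for x
    unfolding M(2) Psi_def
    by (rule act_lincomb) (simp add: similitude_coords[OF M(1) l_pos] comb_def)
  moreover have "coords l M \<in> g_ad l" by (simp add: g_ad_def coords_outside)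
  ultimately show ?thesis using that by blast
qed

lemma Psi_scalar:
  assumes y: "y \<in> g_ad l" and s: "\<And>x. Psi y x = scale d x" shows "y = (\<lambda>_. 0)"
proof -
  have c: "comb l y a c = (if a = c then d else 0)" if ac: "a < 2 * l" "c < 2 * l" for a c
  proof -
    have ix: "a + 1 \<in> ix" "c + 1 \<in> ix" using ac by (auto simp: ix_def)
    have "comb l y a c = b (Psi y (v (c + 1))) (v (op (a + 1)))"
      unfolding Psi_act using ac ix by (simp add: b_act_v)
    also have "\<dots> = (if a = c then d else 0)"
      unfolding s using gram[OF ix(2) op_ix[OF ix(1)]] op_eq_iff[OF ix] by simp
    finally show ?thesis .
  qed
  have d: "d = 0" using c[of "2 * l - 1" "2 * l - 1"] comb_last[OF l_pos, of y] l_pos by simp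
  have rt: "y (Rt \<gamma>) = 0" if g: "\<gamma> \<in> roots l" for \<gamma>
  proof -
    have "comb l y (fst (entry_pos l \<gamma>)) (snd (entry_pos l \<gamma>)) = 0"
      using entry_pos_less[OF g] by (subst c) (simp_all add: d)
    then show ?thesis by (simp add: comb_root[OF g])
  qed
  have half: "y Half = 0" using comb_diag[of 0 l y] c[of 0 0] d l_pos by simp
  have cr: "y (Cr i) = 0" if i: "i \<in> {2..l}" for i
  proof -
    obtain a where a: "i = Suc a" "1 \<le> a" "a < l" using i by (cases i) auto
    then show ?thesis using comb_diag[OF a(3), of y] c[of a a] d half by simp
  qed
  show ?thesis
  proof
    fix p show "y p = 0"
      using y rt half cr by (cases "p \<in> ad_index l") (auto simp: ad_index_def g_ad_def)
  qed
qed

lemma Psi_add: "Psi (\<lambda>p. y p + z p) x = Psi y x + Psi z x"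
  by (simp add: Psi_def scale_left_distrib sum.distrib)

lemma Psi_eq_mod_scalar:
  assumes "y \<in> g_ad l" "z \<in> g_ad l" and s: "\<And>x. Psi y x = Psi z x + scale d x"
  shows "y = z"
proof -
  have "Psi (\<lambda>p. y p + z p) x = scale d x" for x
    unfolding Psi_add s by (simp add: add_ac)
  moreover have "(\<lambda>p. y p + z p) \<in> g_ad l" using assms by (simp add: g_ad_def)
  ultimately have "(\<lambda>p. y p + z p) = (\<lambda>_. 0)" by (rule Psi_scalar[rotated])
  then show ?thesis by (simp add: fun_eq_iff add_eq_0_K)
qed

text \<open>\<open>Psi\<close> recovers \<open>T\<close> only up to its last diagonal entry. These
  entries are the source of the scalar in \<open>Psi_root_act\<close>.\<close>

lemma Psi_coords:
  fixes T :: "int mat"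
  assumes T: "similitude l 0 T"
  shows "Psi (\<lambda>p. of_int (coords l T p)) x =
    act (map_mat of_int T) x + scale (of_int (T $$ (2 * l - 1, 2 * l - 1))) x"
proof -
  have Tc: "T \<in> carrier_mat (2 * l) (2 * l)" using T by (simp add: similitude_def)
  have "act (map_mat of_int T) x = Psi (\<lambda>p. of_int (coords l T p)) x
      + scale (of_int (T $$ (2 * l - 1, 2 * l - 1))) x"
    unfolding Psi_def
  proof (rule act_lincomb)
    fix a c assume ac: "a < 2 * l" "c < 2 * l"
    have "map_mat of_int T $$ (a, c) = (of_int (T $$ (a, c)) :: 'k)" using ac Tc by simp
    also have "\<dots> = of_int (comb l (coords l T) a c) + (if a = c then of_int (T $$ (2 * l - 1, 2 * l - 1)) else 0)"
      by (subst similitude_coords[OF T l_pos ac]) simp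
    also have "of_int (comb l (coords l T) a c) =
        (\<Sum>p\<in>ad_index l. of_int (coords l T p) * (int_basis l p $$ (a, c) :: 'k))"
      unfolding comb_def of_int_sum of_int_mult
      by (intro sum.cong refl) (simp add: int_basis_of_int[OF _ ac, where ?'a = 'k])
    finally show "map_mat of_int T $$ (a, c) = (\<Sum>p\<in>ad_index l. of_int (coords l T p) * (int_basis l p $$ (a, c) :: 'k))
        + (if a = c then of_int (T $$ (2 * l - 1, 2 * l - 1)) else 0)" .
  qed
  then show ?thesis by (simp add: add.assoc)
qed

lemma act_bracket:
  "act (bracket_term l \<gamma> q) x = act (chev_X l \<gamma>) (act (int_basis l q) x) + act (int_basis l q) (act (chev_X l \<gamma>) x)"
proof -
  note c = mult_carrier_mat[OF chev_X_carrier[of l \<gamma>] int_basis_carrier[of l q]]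
    mult_carrier_mat[OF int_basis_carrier[of l q] chev_X_carrier[of l \<gamma>]]
  show ?thesis
    unfolding bracket_term_def mat_K_minus[OF c]
    using mat_act_add[OF c, of x] by (simp add: act_mult act_def[symmetric])
qed

lemma act_sandwich:
  "act (sandwich_term l \<gamma> q) x = act (chev_X l \<gamma>) (act (int_basis l q) (act (chev_X l \<gamma>) x))"
proof -
  have neg: "- M = (M :: 'k mat)" for M by (intro eq_matI) auto
  note c = mult_carrier_mat[OF chev_X_carrier[of l \<gamma>] int_basis_carrier[of l q]]
  show ?thesis
    unfolding sandwich_term_def neg act_mult[OF c chev_X_carrier] act_mult[OF chev_X_carrier int_basis_carrier] ..
qed

text \<open>(1 + tX) A (1 + tX) = A + t (XA + AX) + t^2 XAX has exactly the bracket and sandwich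
  terms. A root element is its own inverse in characteristic two, so this is conjugation.\<close>

lemma Psi_root_act:
  assumes g: "\<gamma> \<in> roots l"
  obtains \<kappa> where "\<And>x. Psi (root_act_ad l \<gamma> t y) x =
    root_elt scale l v \<gamma> t (Psi y (root_elt scale l v \<gamma> t x)) + scale \<kappa> x"
proof -
  let ?X = "act (chev_X l \<gamma>)" and ?A = "\<lambda>q. act (int_basis l q)" and ?I = "ad_index l"
  define c1 where "c1 q p = (of_int (coords l (bracket_term l \<gamma> q) p) :: 'k)" for q p
  define c2 where "c2 q p = (of_int (coords l (sandwich_term l \<gamma> q) p) :: 'k)" for q p
  define d1 where "d1 q = (of_int (bracket_term l \<gamma> q $$ (2 * l - 1, 2 * l - 1)) :: 'k)" for q
  define d2 where "d2 q = (of_int (sandwich_term l \<gamma> q $$ (2 * l - 1, 2 * l - 1)) :: 'k)" for q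
  have P1: "Psi (c1 q) x = ?X (?A q x) + ?A q (?X x) + scale (d1 q) x" if "q \<in> ?I" for q x
    using Psi_coords[OF bracket_term_similitude[OF g that], of x]
    by (simp add: bracket_term_map[OF g that] act_bracket c1_def[abs_def] d1_def)
  have P2: "Psi (c2 q) x = ?X (?A q (?X x)) + scale (d2 q) x" if "q \<in> ?I" for q x
    using Psi_coords[OF sandwich_term_similitude[OF g that], of x]
    by (simp add: sandwich_term_map[OF g that] act_sandwich c2_def[abs_def] d2_def)
  define \<kappa> where "\<kappa> = (\<Sum>q\<in>?I. y q * (t * d1 q + t ^ 2 * d2 q))"
  have "Psi (root_act_ad l \<gamma> t y) x =
    root_elt scale l v \<gamma> t (Psi y (root_elt scale l v \<gamma> t x)) + scale \<kappa> x" for x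
  proof -
    have "Psi (root_act_ad l \<gamma> t y) x =
        (\<Sum>p\<in>?I. scale (y p) (?A p x) + (\<Sum>q\<in>?I. scale ((t * c1 q p + t ^ 2 * c2 q p) * y q) (?A p x)))"
      unfolding Psi_def
      by (intro sum.cong refl) (simp add: root_act_ad_eq[OF l_pos g] scale_left_distrib scale_sum_left c1_def c2_def)
    also have "\<dots> = Psi y x + (\<Sum>p\<in>?I. \<Sum>q\<in>?I. scale ((t * c1 q p + t ^ 2 * c2 q p) * y q) (?A p x))"
      by (simp add: sum.distrib Psi_def)
    also have "(\<Sum>p\<in>?I. \<Sum>q\<in>?I. scale ((t * c1 q p + t ^ 2 * c2 q p) * y q) (?A p x))
        = (\<Sum>q\<in>?I. \<Sum>p\<in>?I. scale ((t * c1 q p + t ^ 2 * c2 q p) * y q) (?A p x))"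
      by (rule sum.swap)
    also have "\<dots> = (\<Sum>q\<in>?I. scale (y q) (scale t (Psi (c1 q) x) + scale (t ^ 2) (Psi (c2 q) x)))"
      unfolding Psi_def
      by (intro sum.cong refl)
        (simp add: scale_sum_right scale_right_distrib scale_left_distrib sum.distrib distrib_left mult_ac)
    also have "\<dots> = (\<Sum>q\<in>?I. scale (y q) (scale t (?X (?A q x)))) + (\<Sum>q\<in>?I. scale (y q) (scale t (?A q (?X x))))
        + (\<Sum>q\<in>?I. scale (y q) (scale (t ^ 2) (?X (?A q (?X x))))) + scale \<kappa> x"
      unfolding \<kappa>_def scale_sum_left sum.distrib[symmetric]
      by (intro sum.cong refl) (simp add: P1 P2 scale_right_distrib scale_left_distrib distrib_left mult_ac add_ac)
    also have "(\<Sum>q\<in>?I. scale (y q) (scale t (?X (?A q x)))) = scale t (?X (Psi y x))"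
      by (simp add: Psi_def lin_sum[OF lin_act] lin_scale[OF lin_act] scale_sum_right mult_ac)
    also have "(\<Sum>q\<in>?I. scale (y q) (scale t (?A q (?X x)))) = scale t (Psi y (?X x))"
      by (simp add: Psi_def scale_sum_right mult_ac)
    also have "(\<Sum>q\<in>?I. scale (y q) (scale (t ^ 2) (?X (?A q (?X x))))) = scale (t ^ 2) (?X (Psi y (?X x)))"
      by (simp add: Psi_def lin_sum[OF lin_act] lin_scale[OF lin_act] scale_sum_right mult_ac)
    finally show ?thesis
      by (simp add: root_elt_act lin_add[OF lin_act] lin_scale[OF lin_act] lin_add[OF lin_Psi]
          lin_scale[OF lin_Psi] scale_right_distrib power2_eq_square add_ac)
  qed
  then show ?thesis using that by blast
qed

section \<open>Group elements acting by conjugation modulo scalars\<close>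

lemma lin_root_elt: "lin (root_elt scale l v \<gamma> t)"
  by (rule linI) (simp_all add: root_elt_act lin_add[OF lin_act] lin_scale[OF lin_act]
      scale_right_distrib mult_ac add_ac)

lemma root_elt_involution:
  assumes "\<gamma> \<in> roots l"
  shows "root_elt scale l v \<gamma> t (root_elt scale l v \<gamma> t x) = x"
proof -
  have "act (chev_X l \<gamma>) (act (chev_X l \<gamma>) x) = act (0\<^sub>m (2 * l) (2 * l)) x"
    using act_mult[of "chev_X l \<gamma>" "chev_X l \<gamma>" x] chev_X_square[OF assms, where ?'a = 'k] by simp
  also have "\<dots> = 0"
    using act_lincomb[where M = "0\<^sub>m (2 * l) (2 * l)" and S = "{}" and d = 0 and x = x] by simp
  finally show ?thesis
    by (simp add: root_elt_act lin_add[OF lin_act] lin_scale[OF lin_act] add_ac)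
qed

text \<open>The relation says \<open>Psi y\<close> = g (\<open>Psi x\<close>) g^-1 +
  \<open>\<kappa>\<close>, written without inverses. Only the product \<open>g\<close> of the word
  enters, which makes the result independent of the word.\<close>

lemma ad_graph_Psi:
  assumes "ad_graph scale l v g x y"
  shows "x \<in> g_ad l \<and> y \<in> g_ad l \<and> lin g \<and> surj g \<and> (\<exists>\<kappa>. \<forall>z. Psi y (g z) = g (Psi x z) + scale \<kappa> (g z))"
  using assms
proof induction
  case (one x)
  moreover have "lin id" by (rule linI) simp_all
  ultimately show ?case
    by (intro conjI exI[of _ 0] allI) (assumption | rule surj_id | simp)+
next
  case (mult g x y \<gamma> t)
  let ?h = "root_elt scale l v \<gamma> t"
  obtain \<kappa> where \<kappa>: "\<And>z. Psi y (g z) = g (Psi x z) + scale \<kappa> (g z)" using mult.IH by blast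
  obtain \<kappa>' where \<kappa>': "\<And>z. Psi (root_act_ad l \<gamma> t y) z = ?h (Psi y (?h z)) + scale \<kappa>' z"
    using Psi_root_act[OF mult.hyps(2), of t y] by metis
  have "Psi (root_act_ad l \<gamma> t y) ((?h \<circ> g) z) = (?h \<circ> g) (Psi x z) + scale (\<kappa> + \<kappa>') ((?h \<circ> g) z)" for z
    by (simp add: \<kappa> \<kappa>' root_elt_involution[OF mult.hyps(2)] lin_add[OF lin_root_elt]
        lin_scale[OF lin_root_elt] scale_left_distrib add_ac)
  moreover have "root_act_ad l \<gamma> t y \<in> g_ad l"
    using root_act_ad_outside[OF l_pos mult.hyps(2)] unfolding g_ad_def by blast
  moreover have "lin (?h \<circ> g)"
    using mult.IH lin_root_elt by (intro linI) (simp_all add: lin_add lin_scale)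
  moreover have "surj ?h" using root_elt_involution[OF mult.hyps(2)] by (metis surjI)
  ultimately show ?case using mult.IH comp_surj[of g ?h] by blast
qed

lemma ad_graph_total:
  assumes "g \<in> G" "x \<in> g_ad l" shows "\<exists>y. ad_graph scale l v g x y"
  using assms by induction (blast intro: ad_graph.intros)+

lemma add_swap: "p = q + r \<longleftrightarrow> q = p + r" for p q r :: 'v
  by (metis add.assoc add_self_V add_0_right)

lemma qcomm_iff: "qcomm u c X \<longleftrightarrow> (\<forall>z. X (u z) = u (X z) + scale c (u z))"
  unfolding qcomm_def by (rule iff_allI) (rule add_swap)

lemma conjugate_mod_scalar_unique:
  assumes "surj u" and z: "z \<in> g_ad l" "w \<in> g_ad l"
    and zu: "\<And>q. Psi z (u q) = u (Psi x q) + scale c (u q)"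
    and wu: "\<And>q. Psi w (u q) = u (Psi x q) + scale d (u q)"
  shows "z = w"
proof (rule Psi_eq_mod_scalar[OF z])
  fix q
  obtain p where p: "q = u p" using assms(1) by (metis surjD)
  have "Psi w q + scale (c + d) q = u (Psi x p) + scale c q"
    unfolding p wu by (simp add: scale_left_distrib add_ac)
  then show "Psi z q = Psi w q + scale (c + d) q"
    unfolding p zu by (rule sym)
qed

text \<open>A word for \<open>u\<close> exists by \<open>isom_G\<close>, and its result is unique
  because \<open>Psi\<close> is injective modulo scalars; this justifies the \<open>THE\<close> in
  \<open>act_ad\<close>.\<close>

lemma act_ad_fixed_iff:
  assumes u: "isom u" and x: "x \<in> g_ad l"
  shows "act_ad scale l v u x = x \<longleftrightarrow> (\<exists>c. qcomm u c (Psi x))"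
proof -
  obtain y where y: "ad_graph scale l v u x y" using ad_graph_total[OF isom_G[OF u] x] by blast
  obtain \<kappa> where \<kappa>: "\<And>z. Psi y (u z) = u (Psi x z) + scale \<kappa> (u z)" and yg: "y \<in> g_ad l" and su: "surj u"
    using ad_graph_Psi[OF y] by blast
  have "act_ad scale l v u x = y"
    unfolding act_ad_def
  proof (rule the_equality)
    show "ad_graph scale l v u x y" by (rule y)
    fix z assume "ad_graph scale l v u x z"
    from ad_graph_Psi[OF this] obtain d where
      d: "\<And>q. Psi z (u q) = u (Psi x q) + scale d (u q)" and z: "z \<in> g_ad l" by blast
    show "z = y" by (rule conjugate_mod_scalar_unique[OF su z yg d \<kappa>])
  qed
  moreover have "y = x \<longleftrightarrow> (\<exists>c. qcomm u c (Psi x))"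
  proof
    assume yx: "y = x"
    show "\<exists>c. qcomm u c (Psi x)"
      using \<kappa> unfolding yx by (intro exI[of _ \<kappa>] qcomm_iff[THEN iffD2] allI)
  next
    assume "\<exists>c. qcomm u c (Psi x)"
    then obtain c where c: "\<And>z. Psi x (u z) = u (Psi x z) + scale c (u z)" unfolding qcomm_iff by blast
    show "y = x" by (rule conjugate_mod_scalar_unique[OF su yg x \<kappa> c])
  qed
  ultimately show ?thesis by simp
qed

end

section \<open>Dimensions\<close>

lemma (in vector_space_pair) dim_image_inj:
  assumes f: "Vector_Spaces.linear s1 s2 f" and inj: "inj_on f (vs1.span S)"
  shows "vs2.dim (f ` S) = vs1.dim S"
proof -
  obtain B where B: "B \<subseteq> S" "vs1.independent B" "S \<subseteq> vs1.span B" "card B = vs1.dim S"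
    using vs1.basis_exists .
  have sp: "vs1.span B = vs1.span S"
    using B vs1.span_mono[of B S] vs1.span_mono[of S "vs1.span B"] vs1.span_span[of B] by auto
  have "vs2.independent (f ` B)"
    using linear_independent_injective_image[OF f B(2)] inj sp by simp
  moreover have "vs2.span (f ` B) = vs2.span (f ` S)"
    using linear_span_image[OF f] sp by simp
  ultimately have "vs2.dim (f ` S) = card (f ` B)" by (intro vs2.dim_eq_card) auto
  moreover have "inj_on f B" using inj sp vs1.span_superset inj_on_subset by metis
  ultimately show ?thesis using B(4) by (simp add: card_image)
qed

lemma (in vector_space) dim_codim_one:
  assumes S: "subspace S" and T: "subspace T" and ST: "S \<subseteq> T" and F: "finite F" "T \<subseteq> span F"
    and x: "x \<in> T" "x \<notin> S" and cod: "\<And>y. y \<in> T \<Longrightarrow> \<exists>a. y - scale a x \<in> S"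
  shows "dim T = dim S + 1"
proof -
  obtain B where B: "B \<subseteq> S" "independent B" "S \<subseteq> span B" "card B = dim S"
    using basis_exists .
  have spB: "span B = S" using B S span_minimal by blast
  have "B \<subseteq> span F" using B(1) ST F(2) by blast
  \<comment> \<open>The count below relies on this, since \<open>card\<close> of an infinite basis
    would be 0.\<close>
  then have fin: "finite B" using independent_span_bound[OF F(1) B(2)] by blast
  have xB: "x \<notin> span B" using x(2) spB by simp
  then have ind: "independent (insert x B)" using B(2) independent_insert by auto
  have "T \<subseteq> span (insert x B)"
  proof
    fix y assume "y \<in> T"
    then obtain a where "y - scale a x \<in> span B" using cod spB by blast
    then show "y \<in> span (insert x B)" unfolding span_insert by blast
  qed
  moreover have "insert x B \<subseteq> T" using x(1) B(1) ST by blast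
  ultimately have "span (insert x B) = span T"
    using T span_minimal[of "insert x B" T] span_eq_iff by blast
  then have "dim T = card (insert x B)" by (rule dim_eq_card[OF _ ind])
  also have "\<dots> = card B + 1" using fin xB span_base by (subst card_insert_disjoint) auto
  finally show ?thesis using B(4) by simp
qed

context symplectic_char2
begin

abbreviation scale_fun :: "'k \<Rightarrow> ('v \<Rightarrow> 'v) \<Rightarrow> 'v \<Rightarrow> 'v" where
  "scale_fun \<equiv> \<lambda>c X x. scale c (X x)"

abbreviation scale_coord :: "'k \<Rightarrow> (ad_ix \<Rightarrow> 'k) \<Rightarrow> ad_ix \<Rightarrow> 'k" where
  "scale_coord \<equiv> \<lambda>c y p. c * y p"

lemma vector_space_fun: "vector_space scale_fun"
  by unfold_locales (simp_all add: fun_eq_iff scale_right_distrib scale_left_distrib)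

lemma vector_space_coord: "vector_space scale_coord"
  by unfold_locales (simp_all add: fun_eq_iff distrib_left distrib_right mult.assoc)

text \<open>\<open>P\<close> stands for a subspace of the pairs \<open>(\<mu>, c)\<close>. The zero
  space yields the fixed points in \<open>sp_algebra\<close>, and all pairs yield the preimage in
  \<open>gsp\<close> of the fixed points in \<open>g_ad\<close>.\<close>

definition quasi_centralizer :: "('v \<Rightarrow> 'v) \<Rightarrow> ('k \<Rightarrow> 'k \<Rightarrow> bool) \<Rightarrow> ('v \<Rightarrow> 'v) set" where
  "quasi_centralizer u P = {X. \<exists>\<mu> c. P \<mu> c \<and> gsp \<mu> X \<and> qcomm u c X}"

lemma gsp_lin: "gsp \<mu> X \<Longrightarrow> lin X"
  by (simp add: gsp_def)

lemma gsp_add: "gsp \<mu> X \<Longrightarrow> gsp \<nu> Y \<Longrightarrow> gsp (\<mu> + \<nu>) (X + Y)"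
proof -
  assume X: "gsp \<mu> X" and Y: "gsp \<nu> Y"
  have "b ((X + Y) x) y + b x ((X + Y) y) = (\<mu> + \<nu>) * b x y" for x y
  proof -
    have "b ((X + Y) x) y + b x ((X + Y) y) = (b (X x) y + b x (X y)) + (b (Y x) y + b x (Y y))"
      by (simp add: add_ac)
    also have "b (X x) y + b x (X y) = \<mu> * b x y" using X unfolding gsp_def by blast
    also have "b (Y x) y + b x (Y y) = \<nu> * b x y" using Y unfolding gsp_def by blast
    finally show ?thesis by (simp only: distrib_right)
  qed
  moreover have "lin (X + Y)"
    using X Y by (intro linI) (simp_all add: gsp_lin[THEN lin_add] gsp_lin[THEN lin_scale]
        scale_right_distrib add_ac)
  ultimately show ?thesis unfolding gsp_def by blast
qed

lemma gsp_scale: "gsp \<mu> X \<Longrightarrow> gsp (a * \<mu>) (scale_fun a X)"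
proof -
  assume X: "gsp \<mu> X"
  have "b (scale a (X x)) y + b x (scale a (X y)) = a * (b (X x) y + b x (X y))" for x y
    by (simp add: distrib_left)
  moreover have "lin (scale_fun a X)"
    using X by (intro linI) (simp_all add: gsp_lin[THEN lin_add] gsp_lin[THEN lin_scale]
        scale_right_distrib mult.commute)
  ultimately show ?thesis using X by (simp add: gsp_def mult.assoc)
qed

lemma qcomm_add: "lin u \<Longrightarrow> qcomm u c X \<Longrightarrow> qcomm u d Y \<Longrightarrow> qcomm u (c + d) (X + Y)"
  by (simp add: qcomm_def lin_add scale_left_distrib add_ac)

lemma qcomm_scale: "lin u \<Longrightarrow> qcomm u c X \<Longrightarrow> qcomm u (a * c) (scale_fun a X)"
  by (simp add: qcomm_def lin_scale scale_right_distrib)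

lemma v1_vn: "b (v 1) (v (op 1)) = 1" "1 \<in> ix"
proof -
  show "1 \<in> ix" using l_pos by (simp add: ix_def)
  then show "b (v 1) (v (op 1)) = 1" by (simp add: gram)
qed

lemma gsp_unique: "gsp \<mu> X \<Longrightarrow> gsp \<nu> X \<Longrightarrow> \<mu> = \<nu>"
  unfolding gsp_def using v1_vn(1) by (metis mult.right_neutral)

lemma qcomm_unique:
  assumes u: "isom u" and "qcomm u c X" "qcomm u d X" shows "c = d"
proof -
  have "scale c (u (v 1)) = scale d (u (v 1))" using assms(2,3) unfolding qcomm_def by (metis add_left_cancel)
  moreover have "u (v 1) \<noteq> 0"
  proof
    assume "u (v 1) = 0"
    then have "b (v 1) (v (op 1)) = 0" using u by (metis isom_def b_zero_left)
    then show False using v1_vn(1) by simp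
  qed
  ultimately show ?thesis by simp
qed

lemma quasi_centralizer_subspace:
  assumes u: "isom u" and P: "P 0 0" "\<And>\<mu> c \<nu> d. P \<mu> c \<Longrightarrow> P \<nu> d \<Longrightarrow> P (\<mu> + \<nu>) (c + d)"
    "\<And>\<mu> c a. P \<mu> c \<Longrightarrow> P (a * \<mu>) (a * c)"
  shows "module.subspace scale_fun (quasi_centralizer u P)"
proof -
  interpret F: vector_space scale_fun by (rule vector_space_fun)
  have lu: "lin u" using u by (simp add: isom_def)
  show ?thesis
  proof (rule F.subspaceI)
    have "gsp 0 0" "qcomm u 0 0" using lin_zero[OF lu] by (auto simp: gsp_def qcomm_def intro!: linI)
    then show "0 \<in> quasi_centralizer u P" using P(1) unfolding quasi_centralizer_def by blast
    show "X + Y \<in> quasi_centralizer u P" if "X \<in> quasi_centralizer u P" "Y \<in> quasi_centralizer u P" for X Y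
      using that P(2) gsp_add qcomm_add[OF lu] unfolding quasi_centralizer_def by blast
    show "scale_fun a X \<in> quasi_centralizer u P" if "X \<in> quasi_centralizer u P" for a X
      using that P(3) gsp_scale qcomm_scale[OF lu] unfolding quasi_centralizer_def by blast
  qed
qed

lemma quasi_centralizer_finite:
  obtains F where "finite F" "quasi_centralizer u P \<subseteq> module.span scale_fun F"
proof
  interpret F: vector_space scale_fun by (rule vector_space_fun)
  let ?F = "insert id ((\<lambda>p. act (int_basis l p)) ` ad_index l)"
  show "finite ?F" by simp
  show "quasi_centralizer u P \<subseteq> F.span ?F"
  proof
    fix X assume "X \<in> quasi_centralizer u P"
    then obtain \<mu> where "gsp \<mu> X" unfolding quasi_centralizer_def by blast
    then obtain y d where X: "\<And>x. X x = Psi y x + scale d x" using gsp_decompose by blast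
    have "(\<Sum>p\<in>S. scale_fun (y p) (act (int_basis l p))) x = (\<Sum>p\<in>S. scale (y p) (act (int_basis l p) x))" for x S
      by (induction S rule: infinite_finite_induct) simp_all
    then have "X = (\<Sum>p\<in>ad_index l. scale_fun (y p) (act (int_basis l p))) + scale_fun d id"
      by (simp add: fun_eq_iff X Psi_def)
    moreover have "(\<Sum>p\<in>ad_index l. scale_fun (y p) (act (int_basis l p))) + scale_fun d id \<in> F.span ?F"
      by (intro F.span_add F.span_sum F.span_scale F.span_base) auto
    ultimately show "X \<in> F.span ?F" by simp
  qed
qed

text \<open>\<open>Q\<close> is \<open>P\<close> plus the line of the pair realised by
  \<open>X\<close>, so every element of the larger space falls into the smaller one after adding a
  multiple of \<open>X\<close>.\<close>

lemma quasi_centralizer_codim_one: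
  assumes u: "isom u"
    and P: "P 0 0" "\<And>\<mu> c \<nu> d. P \<mu> c \<Longrightarrow> P \<nu> d \<Longrightarrow> P (\<mu> + \<nu>) (c + d)" "\<And>\<mu> c a. P \<mu> c \<Longrightarrow> P (a * \<mu>) (a * c)"
    and Q: "Q 0 0" "\<And>\<mu> c \<nu> d. Q \<mu> c \<Longrightarrow> Q \<nu> d \<Longrightarrow> Q (\<mu> + \<nu>) (c + d)" "\<And>\<mu> c a. Q \<mu> c \<Longrightarrow> Q (a * \<mu>) (a * c)"
    and PQ: "\<And>\<mu> c. P \<mu> c \<Longrightarrow> Q \<mu> c" and X: "gsp \<mu> X" "qcomm u c X" "Q \<mu> c" "\<not> P \<mu> c"
    and cod: "\<And>\<nu> d. Q \<nu> d \<Longrightarrow> \<exists>a. P (\<nu> + a * \<mu>) (d + a * c)"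
  shows "vector_space.dim scale_fun (quasi_centralizer u Q) = vector_space.dim scale_fun (quasi_centralizer u P) + 1"
proof -
  interpret F: vector_space scale_fun by (rule vector_space_fun)
  have lu: "lin u" using u by (simp add: isom_def)
  obtain B where B: "finite B" "quasi_centralizer u Q \<subseteq> F.span B" using quasi_centralizer_finite .
  show ?thesis
  proof (rule F.dim_codim_one[OF _ _ _ B])
    show "F.subspace (quasi_centralizer u P)" using quasi_centralizer_subspace[of u P] u P by blast
    show "F.subspace (quasi_centralizer u Q)" using quasi_centralizer_subspace[of u Q] u Q by blast
    show "quasi_centralizer u P \<subseteq> quasi_centralizer u Q" using PQ unfolding quasi_centralizer_def by blast
    show "X \<in> quasi_centralizer u Q" using X unfolding quasi_centralizer_def by blast
    show "X \<notin> quasi_centralizer u P"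
      using X gsp_unique[OF X(1)] qcomm_unique[OF u X(2)] unfolding quasi_centralizer_def by blast
    fix Y assume "Y \<in> quasi_centralizer u Q"
    then obtain \<nu> d where Y: "Q \<nu> d" "gsp \<nu> Y" "qcomm u d Y" unfolding quasi_centralizer_def by blast
    obtain a where a: "P (\<nu> + a * \<mu>) (d + a * c)" using cod[OF Y(1)] by blast
    have "Y - scale_fun a X = Y + scale_fun a X" by (simp add: fun_eq_iff)
    moreover have "Y + scale_fun a X \<in> quasi_centralizer u P"
      using a gsp_add[OF Y(2) gsp_scale[OF X(1), of a]] qcomm_add[OF lu Y(3) qcomm_scale[OF lu X(2), of a]]
      unfolding quasi_centralizer_def by blast
    ultimately show "\<exists>a. Y - scale_fun a X \<in> quasi_centralizer u P" by metis
  qed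
qed

lemma g_sc_fixed_eq:
  assumes u: "isom u" "bij u"
  shows "g_sc_fixed scale b u = quasi_centralizer u (\<lambda>\<mu> c. \<mu> = 0 \<and> c = 0)"
proof -
  have "u \<circ> X \<circ> inv_into UNIV u = X \<longleftrightarrow> qcomm u 0 X" for X
  proof -
    have "u \<circ> X \<circ> inv_into UNIV u = X \<longleftrightarrow> u \<circ> X = X \<circ> u"
      using u(2) by (metis bij_is_inj bij_is_surj comp_assoc comp_id inv_o_cancel surj_iff)
    then show ?thesis by (simp add: qcomm_def fun_eq_iff)
  qed
  then show ?thesis
    by (auto simp: g_sc_fixed_def sp_algebra_def quasi_centralizer_def gsp_def)
qed

text \<open>The image of \<open>g_ad_fixed\<close> under \<open>Psi\<close> has the line of
  \<open>id\<close> as a complement in \<open>?N\<close>: \<open>id\<close> commutes with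
  \<open>u\<close> and has multiplier 2 = 0.\<close>

lemma dim_g_ad_fixed_eq:
  assumes u: "isom u"
  shows "vector_space.dim scale_fun (quasi_centralizer u (\<lambda>_ _. True)) = dim_g_ad_fixed scale l v u + 1"
proof -
  interpret F: vector_space scale_fun by (rule vector_space_fun)
  interpret C: vector_space scale_coord by (rule vector_space_coord)
  interpret CF: vector_space_pair scale_coord scale_fun ..
  let ?N = "quasi_centralizer u (\<lambda>_ _. True)"
  have lu: "lin u" using u by (simp add: isom_def)
  have fixed: "g_ad_fixed scale l v u = {y \<in> g_ad l. Psi y \<in> ?N}"
    using act_ad_fixed_iff[OF u] gsp_Psi by (auto simp: g_ad_fixed_def quasi_centralizer_def)
  have lin: "Vector_Spaces.linear scale_coord scale_fun Psi"
    unfolding Vector_Spaces.linear_iff using C.vector_space_axioms F.vector_space_axioms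
    by (auto simp: fun_eq_iff Psi_def scale_left_distrib sum.distrib scale_sum_right)
  have N: "F.subspace ?N" using quasi_centralizer_subspace[OF u, of "\<lambda>_ _. True"] by blast
  have Psi0: "Psi (y + z) = Psi y + Psi z" "Psi (scale_coord a y) = scale_fun a (Psi y)" for y z a
    using lin unfolding Vector_Spaces.linear_iff by blast+
  have sub: "C.subspace (g_ad_fixed scale l v u)"
  proof (rule C.subspaceI)
    have "Psi 0 = 0" using Psi0(2)[of 0 0] by (simp add: fun_eq_iff zero_fun_def)
    then show "0 \<in> g_ad_fixed scale l v u" unfolding fixed using F.subspace_0[OF N] by (simp add: g_ad_def)
    show "y + z \<in> g_ad_fixed scale l v u" if "y \<in> g_ad_fixed scale l v u" "z \<in> g_ad_fixed scale l v u" for y z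
      using that F.subspace_add[OF N] unfolding fixed by (simp add: Psi0 g_ad_def)
    show "scale_coord a y \<in> g_ad_fixed scale l v u" if "y \<in> g_ad_fixed scale l v u" for a y
      using that F.subspace_scale[OF N] unfolding fixed by (simp add: Psi0 g_ad_def)
  qed
  have inj: "inj_on Psi (g_ad_fixed scale l v u)"
  proof (rule inj_onI)
    fix y z assume "y \<in> g_ad_fixed scale l v u" "z \<in> g_ad_fixed scale l v u" "Psi y = Psi z"
    then show "y = z" using Psi_eq_mod_scalar[of y z 0] by (simp add: fixed)
  qed
  have span: "C.span (g_ad_fixed scale l v u) = g_ad_fixed scale l v u" using sub C.span_eq_iff by blast
  have dim: "F.dim (Psi ` g_ad_fixed scale l v u) = C.dim (g_ad_fixed scale l v u)"
    by (rule CF.dim_image_inj[OF lin]) (unfold span, rule inj)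
  have idN: "id \<in> ?N"
  proof -
    have "gsp 0 id" by (auto simp: gsp_def intro!: linI)
    moreover have "qcomm u 0 id" by (simp add: qcomm_def)
    ultimately show ?thesis unfolding quasi_centralizer_def by blast
  qed
  obtain B where B: "finite B" "?N \<subseteq> F.span B" using quasi_centralizer_finite .
  have "F.dim ?N = F.dim (Psi ` g_ad_fixed scale l v u) + 1"
  proof (rule F.dim_codim_one[OF _ N _ B idN])
    show "F.subspace (Psi ` g_ad_fixed scale l v u)" using CF.linear_subspace_image[OF lin sub] .
    show "Psi ` g_ad_fixed scale l v u \<subseteq> ?N" by (auto simp: fixed)
    show "id \<notin> Psi ` g_ad_fixed scale l v u"
    proof
      assume "id \<in> Psi ` g_ad_fixed scale l v u"
      then obtain y where y: "y \<in> g_ad l" "Psi y = id" by (auto simp: fixed)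
      then have y0: "y = (\<lambda>_. 0)" using Psi_scalar[of y 1] by simp
      have "v 1 = Psi y (v 1)" using y(2) by simp
      also have "\<dots> = 0" unfolding y0 by (simp add: Psi_def)
      finally show False using v1_vn(1) by simp
    qed
    fix X assume X: "X \<in> ?N"
    then obtain \<mu> where "gsp \<mu> X" unfolding quasi_centralizer_def by blast
    then obtain y d where y: "y \<in> g_ad l" "\<And>x. X x = Psi y x + scale d x" using gsp_decompose by blast
    have eq: "X - scale_fun d id = Psi y" by (simp add: fun_eq_iff y(2) add.assoc)
    have "X - scale_fun d id \<in> ?N" using X idN F.subspace_diff[OF N] F.subspace_scale[OF N] by blast
    then have "y \<in> g_ad_fixed scale l v u" unfolding eq fixed using y(1) by blast
    then show "\<exists>a. X - scale_fun a id \<in> Psi ` g_ad_fixed scale l v u" using eq by blast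
  qed
  then show ?thesis unfolding dim by (simp add: dim_g_ad_fixed_def)
qed

text \<open>The rank is the dimension of the space of pairs \<open>(\<mu>, c)\<close> for which some \<open>X\<close> with
  multiplier \<open>\<mu>\<close> satisfies \<open>u X = (X + c) u\<close>.\<close>

lemma dim_fixed_rank_0:
  assumes u: "isom u" "bij u"
    and r: "\<And>\<mu> c X. gsp \<mu> X \<Longrightarrow> qcomm u c X \<Longrightarrow> \<mu> = 0 \<and> c = 0"
  shows "dim_g_ad_fixed scale l v u + 1 = dim_g_sc_fixed scale b u"
proof -
  have "quasi_centralizer u (\<lambda>_ _. True) = quasi_centralizer u (\<lambda>\<mu> c. \<mu> = 0 \<and> c = 0)"
    using r unfolding quasi_centralizer_def by blast
  then show ?thesis
    using dim_g_ad_fixed_eq[OF u(1)] g_sc_fixed_eq[OF u] by (simp add: dim_g_sc_fixed_def)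
qed

lemma dim_fixed_rank_1:
  assumes u: "isom u" "bij u"
    and r: "\<And>\<mu> c X. gsp \<mu> X \<Longrightarrow> qcomm u c X \<Longrightarrow> \<exists>a. \<mu> = a * \<mu>0 \<and> c = a * c0"
    and X: "gsp \<mu>0 X" "qcomm u c0 X" "\<mu>0 \<noteq> 0 \<or> c0 \<noteq> 0"
  shows "dim_g_ad_fixed scale l v u = dim_g_sc_fixed scale b u"
proof -
  let ?Q = "\<lambda>\<mu> c. \<exists>a. \<mu> = a * \<mu>0 \<and> c = a * c0"
  have "quasi_centralizer u (\<lambda>_ _. True) = quasi_centralizer u ?Q"
    using r unfolding quasi_centralizer_def by blast
  moreover have "vector_space.dim scale_fun (quasi_centralizer u ?Q)
      = vector_space.dim scale_fun (quasi_centralizer u (\<lambda>\<mu> c. \<mu> = 0 \<and> c = 0)) + 1"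
  proof (rule quasi_centralizer_codim_one[OF u(1) _ _ _ _ _ _ _ X(1,2)])
    show "?Q (\<mu> + \<nu>) (c + d)" if "?Q \<mu> c" "?Q \<nu> d" for \<mu> c \<nu> d
      using that by (metis distrib_right)
    show "?Q (a * \<mu>) (a * c)" if "?Q \<mu> c" for \<mu> c a
      using that by (metis mult.assoc)
    show "\<exists>a. \<nu> + a * \<mu>0 = 0 \<and> d + a * c0 = 0" if "?Q \<nu> d" for \<nu> d
      using that by (metis add_self_K)
    show "?Q 0 0" by (rule exI[of _ 0]) simp
    show "?Q \<mu>0 c0" by (rule exI[of _ 1]) simp
    show "?Q \<mu> c" if "\<mu> = 0 \<and> c = 0" for \<mu> c using that by (intro exI[of _ 0]) simp
  qed (use X(3) in auto)
  ultimately show ?thesis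
    using dim_g_ad_fixed_eq[OF u(1)] g_sc_fixed_eq[OF u] by (simp add: dim_g_sc_fixed_def)
qed

text \<open>Codimension one twice, along the chain zero pair, \<open>c = 0\<close>, all pairs:
  \<open>X\<close> accounts for the lower step and \<open>Y\<close> for the upper one.\<close>

lemma dim_fixed_rank_2:
  assumes u: "isom u" "bij u"
    and X: "gsp 1 X" "qcomm u 0 X" and Y: "gsp \<epsilon> Y" "qcomm u 1 Y"
  shows "dim_g_ad_fixed scale l v u = dim_g_sc_fixed scale b u + 1"
proof -
  let ?Q = "\<lambda>\<mu> c. c = (0 :: 'k)"
  have "vector_space.dim scale_fun (quasi_centralizer u (\<lambda>_ _. True))
      = vector_space.dim scale_fun (quasi_centralizer u ?Q) + 1"
    by (rule quasi_centralizer_codim_one[OF u(1) _ _ _ _ _ _ _ Y]) (auto simp: add_eq_0_K)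
  moreover have "vector_space.dim scale_fun (quasi_centralizer u ?Q)
      = vector_space.dim scale_fun (quasi_centralizer u (\<lambda>\<mu> c. \<mu> = 0 \<and> c = 0)) + 1"
    by (rule quasi_centralizer_codim_one[OF u(1) _ _ _ _ _ _ _ X]) (auto simp: add_eq_0_K)
  ultimately show ?thesis
    using dim_g_ad_fixed_eq[OF u(1)] g_sc_fixed_eq[OF u] by (simp add: dim_g_sc_fixed_def)
qed

section \<open>From the block sizes to the case distinction\<close>

lemma decomposition_nonempty:
  assumes "decomposition scale b u t m s k" shows "t \<ge> 1 \<or> s \<ge> 1"
proof (rule ccontr)
  assume "\<not> ?thesis"
  then have "t = 0" "s = 0" by auto
  then have I: "{1..t} <+> {1..s} = ({} :: (nat + nat) set)" by auto
  obtain U :: "nat + nat \<Rightarrow> 'v set" where "orthogonal_direct_sum scale b ({1..t} <+> {1..s}) U"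
    using assms unfolding decomposition_def by blast
  then obtain w :: "nat + nat \<Rightarrow> 'v" where "v 1 = (\<Sum>i\<in>{1..t} <+> {1..s}. w i)"
    unfolding orthogonal_direct_sum_def by blast
  then have "v 1 = 0" unfolding I by simp
  then show False using v1_vn(1) by simp
qed

text \<open>In the order of the claims, the pairs \<open>(\<mu>, c)\<close> that occur form the line
  \<open>c = 0\<close>, all of K^2, twice the zero space, and the lines spanned by (1, 1) and (0,
  1). Where the dimension drops, 1 is added on the left to avoid truncated subtraction.\<close>

lemma fixed_dimensions:
  assumes u: "isom u" "bij u" and dec: "decomposition scale b u t m s k"
  shows "s = 0 \<Longrightarrow> \<exists>i\<in>{1..t}. odd (m i) \<Longrightarrow> dim_g_ad_fixed scale l v u = dim_g_sc_fixed scale b u"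
    and "s = 0 \<Longrightarrow> \<forall>i\<in>{1..t}. even (m i) \<Longrightarrow> dim_g_ad_fixed scale l v u = dim_g_sc_fixed scale b u + 1"
    and "s > 0 \<Longrightarrow> \<exists>i\<in>{1..t}. odd (m i) \<Longrightarrow> dim_g_ad_fixed scale l v u + 1 = dim_g_sc_fixed scale b u"
    and "\<exists>j\<in>{1..s}. odd (k j) \<Longrightarrow> \<exists>j\<in>{1..s}. even (k j) \<Longrightarrow>
      dim_g_ad_fixed scale l v u + 1 = dim_g_sc_fixed scale b u"
    and "s > 0 \<Longrightarrow> \<forall>i\<in>{1..t}. even (m i) \<Longrightarrow> \<forall>j\<in>{1..s}. odd (k j) \<Longrightarrow>
      dim_g_ad_fixed scale l v u = dim_g_sc_fixed scale b u"
    and "s > 0 \<Longrightarrow> \<forall>i\<in>{1..t}. even (m i) \<Longrightarrow> \<forall>j\<in>{1..s}. even (k j) \<Longrightarrow>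
      dim_g_ad_fixed scale l v u = dim_g_sc_fixed scale b u"
proof -
  have lu: "lin u" using u by (simp add: isom_def)
  obtain e where bl: "blocks ({1..t} <+> {1..s}) (case_sum m k) e"
    and W: "\<And>i. i \<in> {1..t} \<Longrightarrow> W_act u (m i) (e (Inl i)) \<and> antidiag_gram b (2 * m i) (e (Inl i)) \<and> 1 \<le> m i"
    and V: "\<And>j. j \<in> {1..s} \<Longrightarrow> V_act u (k j) (e (Inr j)) \<and> antidiag_gram b (2 * k j) (e (Inr j)) \<and> 1 \<le> k j"
    using decomposition_blocks[OF dec] by blast
  have odd_W: "c = 0" if "gsp \<mu> X" "qcomm u c X" "\<exists>i\<in>{1..t}. odd (m i)" for \<mu> c X
    using that W_obstruction[OF u(1) gsp_lin[OF that(1)] that(2)] W by blast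
  have V_rel: "\<mu> = of_nat (k j) * c" if "gsp \<mu> X" "qcomm u c X" "j \<in> {1..s}" for \<mu> c X j
    using V_obstruction[OF u(1) that(1,2)] V[OF that(3)] by blast
  have proj: "\<exists>X. gsp 1 X \<and> qcomm u 0 X" if "s = 0"
    by (rule exists_projection[OF bl lu]) (use that W in auto)
  have der: "\<exists>X. gsp \<epsilon> X \<and> qcomm u 1 X" if "\<forall>i\<in>{1..t}. even (m i)" "\<forall>j\<in>{1..s}. of_nat (k j) = (\<epsilon> :: 'k)" for \<epsilon>
    by (rule exists_derivation[OF bl lu]) (use that W V in auto)
  have sj: "s \<in> {1..s}" if "s > 0" using that by auto
  show "dim_g_ad_fixed scale l v u = dim_g_sc_fixed scale b u" if s: "s = 0" "\<exists>i\<in>{1..t}. odd (m i)"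
  proof -
    obtain X where X: "gsp 1 X" "qcomm u 0 X" using proj s by blast
    show ?thesis
    proof (rule dim_fixed_rank_1[OF u _ X])
      fix \<mu> c X assume "gsp \<mu> X" "qcomm u c X"
      then show "\<exists>a. \<mu> = a * 1 \<and> c = a * 0" using odd_W s by (intro exI[of _ \<mu>]) auto
    qed simp
  qed
  show "dim_g_ad_fixed scale l v u = dim_g_sc_fixed scale b u + 1" if s: "s = 0" "\<forall>i\<in>{1..t}. even (m i)"
  proof -
    obtain X where X: "gsp 1 X" "qcomm u 0 X" using proj s by blast
    \<comment> \<open>Without V-blocks the multiplier in \<open>der\<close> is free, and 0 is one
      choice.\<close>
    obtain Y where Y: "gsp 0 Y" "qcomm u 1 Y" using der[of 0] s by auto
    show ?thesis by (rule dim_fixed_rank_2[OF u X Y])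
  qed
  show "dim_g_ad_fixed scale l v u + 1 = dim_g_sc_fixed scale b u" if s: "s > 0" "\<exists>i\<in>{1..t}. odd (m i)"
  proof (rule dim_fixed_rank_0[OF u])
    fix \<mu> c X assume X: "gsp \<mu> X" "qcomm u c X"
    then show "\<mu> = 0 \<and> c = 0" using odd_W[OF X s(2)] V_rel[OF X sj[OF s(1)]] by simp
  qed
  show "dim_g_ad_fixed scale l v u + 1 = dim_g_sc_fixed scale b u"
    if s: "\<exists>j\<in>{1..s}. odd (k j)" "\<exists>j\<in>{1..s}. even (k j)"
  proof (rule dim_fixed_rank_0[OF u])
    fix \<mu> c X assume X: "gsp \<mu> X" "qcomm u c X"
    obtain i j where "i \<in> {1..s}" "odd (k i)" "j \<in> {1..s}" "even (k j)" using s by blast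
    then show "\<mu> = 0 \<and> c = 0" using V_rel[OF X, of i] V_rel[OF X, of j] by (simp add: of_nat_K)
  qed
  have rank1: "dim_g_ad_fixed scale l v u = dim_g_sc_fixed scale b u"
    if s: "s > 0" "\<forall>i\<in>{1..t}. even (m i)" "\<forall>j\<in>{1..s}. of_nat (k j) = (\<epsilon> :: 'k)" for \<epsilon>
  proof -
    obtain Y where Y: "gsp \<epsilon> Y" "qcomm u 1 Y" using der[OF s(2,3)] by blast
    show ?thesis
    proof (rule dim_fixed_rank_1[OF u _ Y])
      fix \<mu> c X assume X: "gsp \<mu> X" "qcomm u c X"
      show "\<exists>a. \<mu> = a * \<epsilon> \<and> c = a * 1"
        using V_rel[OF X sj[OF s(1)]] s(3) sj[OF s(1)] by (intro exI[of _ c]) (simp add: mult.commute)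
    qed simp
  qed
  show "dim_g_ad_fixed scale l v u = dim_g_sc_fixed scale b u"
    if "s > 0" "\<forall>i\<in>{1..t}. even (m i)" "\<forall>j\<in>{1..s}. odd (k j)"
    using rank1[of 1] that by (simp add: of_nat_K)
  show "dim_g_ad_fixed scale l v u = dim_g_sc_fixed scale b u"
    if "s > 0" "\<forall>i\<in>{1..t}. even (m i)" "\<forall>j\<in>{1..s}. even (k j)"
    using rank1[of 0] that by (simp add: of_nat_K)
qed

text \<open>Some block exists and has positive size q, and a < 2^a \<le> q bounds the exponents;
  hence the \<open>GREATEST\<close> is attained.\<close>

lemma GREATEST_power_dvd_pos_iff:
  assumes dec: "decomposition scale b u t m s k"
    and \<alpha>: "\<alpha> = (GREATEST a. (\<forall>i\<in>{1..t}. 2 ^ a dvd m i) \<and> (\<forall>j\<in>{1..s}. 2 ^ a dvd k j))"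
  shows "\<alpha> > 0 \<longleftrightarrow> (\<forall>i\<in>{1..t}. even (m i)) \<and> (\<forall>j\<in>{1..s}. even (k j))"
proof -
  let ?P = "\<lambda>a. (\<forall>i\<in>{1..t}. 2 ^ a dvd m i) \<and> (\<forall>j\<in>{1..s}. 2 ^ a dvd k j)"
  have pos: "\<forall>i\<in>{1..t}. 1 \<le> m i" "\<forall>j\<in>{1..s}. 1 \<le> k j" using dec by (auto simp: decomposition_def)
  have lt: "a \<le> q" if "2 ^ a dvd q" "1 \<le> q" for a q :: nat
  proof -
    have "a < 2 ^ a" by (rule less_exp)
    also have "2 ^ a \<le> q" using that by (intro dvd_imp_le) auto
    finally show ?thesis by simp
  qed
  obtain B where B: "\<And>a. ?P a \<Longrightarrow> a \<le> B"
  proof (cases "t \<ge> 1")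
    case True
    then show ?thesis using lt[of _ "m 1"] pos that[of "m 1"] by auto
  next
    case False
    then have "s \<ge> 1" using decomposition_nonempty[OF dec] by auto
    then show ?thesis using lt[of _ "k 1"] pos that[of "k 1"] by auto
  qed
  have P\<alpha>: "?P \<alpha>" unfolding \<alpha> using B by (intro GreatestI_nat[of ?P 0 B]) auto
  show ?thesis
  proof
    assume "\<alpha> > 0"
    then have "2 dvd (2 :: nat) ^ \<alpha>" by simp
    then show "(\<forall>i\<in>{1..t}. even (m i)) \<and> (\<forall>j\<in>{1..s}. even (k j))" using P\<alpha> dvd_trans by blast
  next
    assume "(\<forall>i\<in>{1..t}. even (m i)) \<and> (\<forall>j\<in>{1..s}. even (k j))"
    then have "?P 1" by simp
    then have "1 \<le> \<alpha>" unfolding \<alpha> using B by (intro Greatest_le_nat[of ?P 1 B]) auto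
    then show "\<alpha> > 0" by simp
  qed
qed

end

theorem corollary1p6:
  fixes scale :: "'k::alg_closed_field \<Rightarrow> 'v::ab_group_add \<Rightarrow> 'v"
    and b :: "'v \<Rightarrow> 'v \<Rightarrow> 'k"
    and l :: nat and v :: "nat \<Rightarrow> 'v" and u :: "'v \<Rightarrow> 'v"
    and t s :: nat and m k :: "nat \<Rightarrow> nat" and \<alpha> :: nat
  assumes "CHAR('k) = 2"
    and "vector_space scale" and "l \<ge> 1" and "vector_space.dim scale (UNIV :: 'v set) = 2 * l"
    and "nondeg_alternating scale b"
    and "symplectic_basis scale b l v"
    and "u \<in> Sp scale b" and "unipotent u"
    and "decomposition scale b u t m s k"
    and "\<alpha> = (GREATEST a. (\<forall>i\<in>{1..t}. 2 ^ a dvd m i) \<and> (\<forall>j\<in>{1..s}. 2 ^ a dvd k j))"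
  shows "(s = 0 \<longrightarrow>
            (\<alpha> = 0 \<longrightarrow> dim_g_ad_fixed scale l v u = dim_g_sc_fixed scale b u) \<and>
            (\<alpha> > 0 \<longrightarrow> dim_g_ad_fixed scale l v u = dim_g_sc_fixed scale b u + 1)) \<and>
         (s > 0 \<longrightarrow>
            (\<alpha> = 0 \<and> (\<exists>j\<in>{1..s}. multiplicity 2 (k j) > 0) \<longrightarrow>
               int (dim_g_ad_fixed scale l v u) = int (dim_g_sc_fixed scale b u) - 1) \<and>
            (\<alpha> = 0 \<and> (\<exists>i\<in>{1..t}. multiplicity 2 (m i) = 0) \<longrightarrow>
               int (dim_g_ad_fixed scale l v u) = int (dim_g_sc_fixed scale b u) - 1) \<and>
            (\<alpha> = 0 \<and> (\<forall>j\<in>{1..s}. multiplicity 2 (k j) = 0) \<and>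
               (\<forall>i\<in>{1..t}. multiplicity 2 (m i) > 0) \<longrightarrow>
               dim_g_ad_fixed scale l v u = dim_g_sc_fixed scale b u) \<and>
            (\<alpha> > 0 \<longrightarrow> dim_g_ad_fixed scale l v u = dim_g_sc_fixed scale b u))"
proof -
  interpret symplectic_char2 scale b l v
    using assms(1-3,5,6) by (simp add: symplectic_char2_def symplectic_char2_axioms_def)
  have u: "isom u" "bij u" using assms(7) by (auto simp: Sp_def isom_def)
  have pos: "\<And>i. i \<in> {1..t} \<Longrightarrow> m i \<noteq> 0" "\<And>j. j \<in> {1..s} \<Longrightarrow> k j \<noteq> 0"
    using assms(9) unfolding decomposition_def by (metis not_one_le_zero)+
  have mult: "multiplicity 2 (m i) = 0 \<longleftrightarrow> odd (m i)" if "i \<in> {1..t}" for i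
    using pos(1)[OF that] by (simp add: multiplicity_eq_zero_iff)
  have mult': "multiplicity 2 (k j) = 0 \<longleftrightarrow> odd (k j)" if "j \<in> {1..s}" for j
    using pos(2)[OF that] by (simp add: multiplicity_eq_zero_iff)
  have \<alpha>: "\<alpha> > 0 \<longleftrightarrow> (\<forall>i\<in>{1..t}. even (m i)) \<and> (\<forall>j\<in>{1..s}. even (k j))"
    by (rule GREATEST_power_dvd_pos_iff[OF assms(9,10)])
  note dims = fixed_dimensions[OF u assms(9)]
  show ?thesis
  proof (intro conjI impI)
    assume "s = 0" "\<alpha> = 0"
    then show "dim_g_ad_fixed scale l v u = dim_g_sc_fixed scale b u" using dims(1) \<alpha> by auto
  next
    assume "s = 0" "\<alpha> > 0"
    then show "dim_g_ad_fixed scale l v u = dim_g_sc_fixed scale b u + 1" using dims(2) \<alpha> by blast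
  next
    assume "s > 0" "\<alpha> = 0 \<and> (\<exists>j\<in>{1..s}. multiplicity 2 (k j) > 0)"
    then obtain j where j: "j \<in> {1..s}" "multiplicity 2 (k j) > 0" and "\<not> \<alpha> > 0" by auto
    \<comment> \<open>\<open>\<alpha>\<close> = 0 yields an odd size. If it is some
      \<open>m i\<close>, then c = 0 and so \<open>\<mu>\<close> = 0; if it is some
      \<open>k j\<close>, it conflicts with the even one.\<close>
    then have "(\<exists>i\<in>{1..t}. odd (m i)) \<or> (\<exists>j\<in>{1..s}. odd (k j))" unfolding \<alpha> by blast
    moreover have "\<exists>j\<in>{1..s}. even (k j)" using mult'[of j] j by auto
    ultimately have "dim_g_ad_fixed scale l v u + 1 = dim_g_sc_fixed scale b u" using dims(3,4) \<open>s > 0\<close> by blast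
    then show "int (dim_g_ad_fixed scale l v u) = int (dim_g_sc_fixed scale b u) - 1" by linarith
  next
    assume "s > 0" "\<alpha> = 0 \<and> (\<exists>i\<in>{1..t}. multiplicity 2 (m i) = 0)"
    then have "dim_g_ad_fixed scale l v u + 1 = dim_g_sc_fixed scale b u" using dims(3) mult by blast
    then show "int (dim_g_ad_fixed scale l v u) = int (dim_g_sc_fixed scale b u) - 1" by linarith
  next
    assume s: "s > 0" "\<alpha> = 0 \<and> (\<forall>j\<in>{1..s}. multiplicity 2 (k j) = 0) \<and> (\<forall>i\<in>{1..t}. multiplicity 2 (m i) > 0)"
    then have "\<forall>j\<in>{1..s}. odd (k j)" "\<forall>i\<in>{1..t}. even (m i)"
      using mult mult' by (metis less_irrefl)+
    then show "dim_g_ad_fixed scale l v u = dim_g_sc_fixed scale b u" using dims(5) s by blast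
  next
    assume "s > 0" "\<alpha> > 0"
    then show "dim_g_ad_fixed scale l v u = dim_g_sc_fixed scale b u" using dims(6) \<alpha> by blast
  qed
qed

end
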